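(* Let $1<p<\infty$, $\lambda_1\le 0$, $\lambda_2<0$ and $Z>0$ be such that $-\frac{p\lambda_1^2}{(p+1)^2\lambda_2}<\frac{Z^2}{4}$. Then for every $\omega<0$ satisfying $$-\frac{p\lambda_1^2}{(p+1)^2\lambda_2}<-\omega<\frac{Z^2}{4},$$ and for the profile $\phi_\omega$ defined in the context, the standing wave solution $e^{-i\omega t}\phi_\omega$ is orbitally stable in $H^1(\mathbb{R})$ by the flow of the equation $$iu_t+u_{xx}+Z\delta(x)u+\lambda_1u|u|^{p-1}+\lambda_2u|u|^{2p-2}=0,\qquad t,x\in\mathbb{R}.$$
   Context: Functions are complex-valued and $\delta$ is the Dirac distribution at the origin. The operator $-\partial_{xx}-Z\delta(x)$ is the self-adjoint operator $A_Z$ on $L^2(\mathbb{R})$ with $A_Zf=-f''$ for $x\ne0$ and domain $D(A_Z)=\{f\in H^1(\mathbb{R})\cap H^2(\mathbb{R}\setminus\{0\}): f'(0+)-f'(0-)=-Zf(0)\}$; it extends to a bounded operator $H^1(\mathbb{R})\to H^{-1}(\mathbb{R})$ by $\langle A_Zu,v\rangle=\mathrm{Re}\int_{\mathbb{R}}u'\overline{v'}\,dx-Z\,\mathrm{Re}(u(0)\overline{v(0)})$. The equation means $iu_t-A_Zu+\lambda_1u|u|^{p-1}+\lambda_2u|u|^{2p-2}=0$ in $H^{-1}(\mathbb{R})$, with solutions $u\in C(\mathbb{R};H^1(\mathbb{R}))\cap C^1(\mathbb{R};H^{-1}(\mathbb{R}))$; for these parameters the Cauchy problem is globally well-posed in $H^1(\mathbb{R})$.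 Profile: put $\alpha=\frac{\lambda_1}{p+1}$, $\beta=\frac{\lambda_2}{p}$ (so the condition on $\omega$ gives $\omega\beta-\alpha^2>0$), and $l=\frac{1}{(p-1)\sqrt{-\omega}}\sinh^{-1}\!\left(\frac{\alpha}{\sqrt{\omega\beta-\alpha^2}}\right)\le 0$. Let $R_1:(-l,\infty)\to(1,\infty)$ be the (decreasing) diffeomorphism $$R_1(d)=\frac{\sqrt{\omega\beta-\alpha^2}\cosh((p-1)\sqrt{-\omega}\,d)}{\sqrt{\omega\beta-\alpha^2}\sinh((p-1)\sqrt{-\omega}\,d)+\alpha}.$$ Then $$\phi_\omega(x)=\left[\frac{\alpha}{-\omega}+\frac{\sqrt{\omega\beta-\alpha^2}}{-\omega}\sinh\!\left((p-1)\sqrt{-\omega}\left(|x|+R_1^{-1}\!\left(\tfrac{Z}{2\sqrt{-\omega}}\right)\right)\right)\right]^{-\frac{1}{p-1}}.$$ Orbital stability: $e^{-i\omega t}\phi_\omega$ is orbitally stable in $H^1(\mathbb{R})$ if for every $\epsilon>0$ there is $\eta>0$ such that whenever $u_0\in H^1(\mathbb{R})$ and $\|u_0-\phi_\omega\|_{H^1}<\eta$, the solution $u(t)$ with $u(0)=u_0$ satisfies $\inf_{\theta\in\mathbb{R}}\|u(t)-e^{i\theta}\phi_\omega\|_{H^1}<\epsilon$ for all $t\in\mathbb{R}$. *)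

theory Defs
  imports "HOL-Analysis.Analysis"
begin

section \<open>Square-integrable functions and weak derivatives on the real line\<close>

definition L2 :: "(real \<Rightarrow> complex) set" where
  "L2 = {f. f \<in> borel_measurable lborel \<and> integrable lborel (\<lambda>x. (cmod (f x))\<^sup>2)}"

text \<open>Real-valued test functions suffice for complex-valued \<open>f\<close> and \<open>g\<close> below, by linearity.\<close>

definition test_function :: "(real \<Rightarrow> real) \<Rightarrow> bool" where
  "test_function \<phi> \<longleftrightarrow>
     (\<forall>n x. (deriv ^^ n) \<phi> differentiable (at x)) \<and> compact (closure {x. \<phi> x \<noteq> 0})"

definition weak_deriv :: "(real \<Rightarrow> complex) \<Rightarrow> (real \<Rightarrow> complex) \<Rightarrow> bool" where
  "weak_deriv f g \<longleftrightarrow>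
     (\<forall>\<phi>. test_function \<phi> \<longrightarrow>
        (LINT x|lborel. deriv \<phi> x *\<^sub>R f x) = - (LINT x|lborel. \<phi> x *\<^sub>R g x))"

text \<open>Every class in \<open>H\<^sup>1(\<real>)\<close> contains exactly one continuous function; it is taken as the
  representative, so that point values and equality of functions are meaningful.\<close>

definition H1 :: "(real \<Rightarrow> complex) set" where
  "H1 = {f. continuous_on UNIV f \<and> f \<in> L2 \<and> (\<exists>g\<in>L2. weak_deriv f g)}"

lemma L2_add: assumes "f \<in> L2" "g \<in> L2" shows "(\<lambda>x. f x + g x) \<in> L2"
proof -
  have [measurable]: "f \<in> borel_measurable borel" "g \<in> borel_measurable borel"
    using assms by (auto simp: L2_def)
  have "integrable lborel (\<lambda>x. 2 * (cmod (f x))\<^sup>2 + 2 * (cmod (g x))\<^sup>2)"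
    using assms by (auto simp: L2_def)
  then have "integrable lborel (\<lambda>x. (cmod (f x + g x))\<^sup>2)"
  proof (rule Bochner_Integration.integrable_bound)
    show "AE x in lborel. norm ((cmod (f x + g x))\<^sup>2)
        \<le> norm (2 * (cmod (f x))\<^sup>2 + 2 * (cmod (g x))\<^sup>2)"
    proof (intro always_eventually allI)
      fix x
      have "(cmod (f x + g x))\<^sup>2 \<le> (cmod (f x) + cmod (g x))\<^sup>2"
        by (intro power_mono norm_triangle_ineq) auto
      also have "\<dots> \<le> 2 * (cmod (f x))\<^sup>2 + 2 * (cmod (g x))\<^sup>2"
        using sum_squares_bound[of "cmod (f x)" "cmod (g x)"] by (simp add: power2_sum)
      finally show "norm ((cmod (f x + g x))\<^sup>2)
        \<le> norm (2 * (cmod (f x))\<^sup>2 + 2 * (cmod (g x))\<^sup>2)" by simp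
    qed
  qed measurable
  then show ?thesis by (auto simp: L2_def)
qed

lemma L2_cmult: assumes "f \<in> L2" shows "(\<lambda>x. c * f x) \<in> L2"
  using assms by (auto simp: L2_def norm_mult power_mult_distrib)

lemma L2_diff: assumes "f \<in> L2" "g \<in> L2" shows "(\<lambda>x. f x - g x) \<in> L2"
  using L2_add[OF assms(1) L2_cmult[OF assms(2), of "-1"]] by simp

lemma L2_zero: "(\<lambda>_. 0) \<in> L2"
  by (auto simp: L2_def)

lemma L2_mult_integrable:
  assumes "f \<in> L2" "g \<in> L2" shows "integrable lborel (\<lambda>x. f x * g x)"
proof -
  have [measurable]: "f \<in> borel_measurable borel" "g \<in> borel_measurable borel"
    using assms by (auto simp: L2_def)
  have "integrable lborel (\<lambda>x. (cmod (f x))\<^sup>2 + (cmod (g x))\<^sup>2)"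
    using assms by (auto simp: L2_def)
  then show ?thesis
  proof (rule Bochner_Integration.integrable_bound)
    show "AE x in lborel. norm (f x * g x) \<le> norm ((cmod (f x))\<^sup>2 + (cmod (g x))\<^sup>2)"
    proof (intro always_eventually allI)
      fix x
      have "2 * (cmod (f x) * cmod (g x)) \<le> (cmod (f x))\<^sup>2 + (cmod (g x))\<^sup>2"
        using sum_squares_bound[of "cmod (f x)" "cmod (g x)"] by simp
      moreover have "0 \<le> cmod (f x) * cmod (g x)" by simp
      ultimately show "norm (f x * g x) \<le> norm ((cmod (f x))\<^sup>2 + (cmod (g x))\<^sup>2)"
        unfolding norm_mult real_norm_def by linarith
    qed
  qed measurable
qed

lemma L2_cnj: assumes "f \<in> L2" shows "(\<lambda>x. cnj (f x)) \<in> L2"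
proof -
  have [measurable]: "f \<in> borel_measurable borel" using assms by (auto simp: L2_def)
  have "(\<lambda>x. cnj (f x)) \<in> borel_measurable borel"
    by (intro borel_measurable_continuous_on[OF _ \<open>f \<in> borel_measurable borel\<close>] continuous_intros)
  then show ?thesis using assms by (auto simp: L2_def)
qed

lemma L2_inner_integrable:
  assumes "f \<in> L2" "g \<in> L2" shows "integrable lborel (\<lambda>x. Re (f x * cnj (g x)))"
  using L2_mult_integrable[OF assms(1) L2_cnj[OF assms(2)]] by (rule integrable_Re)

lemma continuous_compact_support_L2:
  fixes \<psi> :: "real \<Rightarrow> real"
  assumes "continuous_on UNIV \<psi>" "\<And>x. \<bar>x\<bar> > a \<Longrightarrow> \<psi> x = 0"
  shows "(\<lambda>x. complex_of_real (\<psi> x)) \<in> L2"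
proof -
  have "continuous_on {-a..a} (\<lambda>x. (\<psi> x)\<^sup>2)"
    using assms(1) by (intro continuous_intros) (auto intro: continuous_on_subset)
  then have "set_integrable lborel {-a..a} (\<lambda>x. (\<psi> x)\<^sup>2)"
    by (rule borel_integrable_atLeastAtMost')
  moreover have "(\<lambda>x. indicator {-a..a} x *\<^sub>R (\<psi> x)\<^sup>2) = (\<lambda>x. (\<psi> x)\<^sup>2)"
  proof
    fix x show "indicator {-a..a} x *\<^sub>R (\<psi> x)\<^sup>2 = (\<psi> x)\<^sup>2"
      using assms(2)[of x] by (cases "\<bar>x\<bar> > a") (auto simp: indicator_def)
  qed
  ultimately have "integrable lborel (\<lambda>x. (\<psi> x)\<^sup>2)"
    by (simp add: set_integrable_def)
  moreover have "(\<lambda>x. complex_of_real (\<psi> x)) \<in> borel_measurable borel"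
    using assms(1) by (intro borel_measurable_continuous_onI continuous_intros)
  ultimately show ?thesis by (simp add: L2_def)
qed

lemma test_function_support:
  assumes "test_function \<phi>"
  obtains a where "\<And>x. \<bar>x\<bar> > a \<Longrightarrow> \<phi> x = 0" "\<And>x. \<bar>x\<bar> > a \<Longrightarrow> deriv \<phi> x = 0"
proof -
  have "bounded {x. \<phi> x \<noteq> 0}" using assms by (simp add: test_function_def)
  then obtain a where "\<And>x. \<phi> x \<noteq> 0 \<Longrightarrow> \<bar>x\<bar> \<le> a" by (auto simp: bounded_iff)
  then have a: "\<And>x. \<bar>x\<bar> > a \<Longrightarrow> \<phi> x = 0" by (meson not_le)
  have "deriv \<phi> x = 0" if "\<bar>x\<bar> > a" for x
  proof -
    have "open {x::real. \<bar>x\<bar> > a}" by (intro open_Collect_less continuous_intros)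
    then have "\<forall>\<^sub>F y in nhds x. \<phi> y = 0"
      using a that by (auto simp: eventually_nhds)
    then have "deriv \<phi> x = deriv (\<lambda>_. 0) x"
      by (intro deriv_cong_ev) auto
    then show ?thesis by simp
  qed
  with a that show thesis by blast
qed

lemma test_function_L2:
  assumes "test_function \<phi>"
  shows "(\<lambda>x. complex_of_real (\<phi> x)) \<in> L2" "(\<lambda>x. complex_of_real (deriv \<phi> x)) \<in> L2"
proof -
  have "(deriv ^^ 0) \<phi> differentiable (at x)" "(deriv ^^ 1) \<phi> differentiable (at x)" for x
    using assms unfolding test_function_def by blast+
  then have "continuous_on UNIV \<phi>" "continuous_on UNIV (deriv \<phi>)"
    by (auto simp: continuous_on_eq_continuous_at differentiable_imp_continuous_within)
  then show "(\<lambda>x. complex_of_real (\<phi> x)) \<in> L2" "(\<lambda>x. complex_of_real (deriv \<phi> x)) \<in> L2"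
    using test_function_support[OF assms] continuous_compact_support_L2 by metis+
qed

lemma test_function_integrable:
  assumes "test_function \<phi>" "f \<in> L2"
  shows "integrable lborel (\<lambda>x. \<phi> x *\<^sub>R f x)" "integrable lborel (\<lambda>x. deriv \<phi> x *\<^sub>R f x)"
  using L2_mult_integrable[OF test_function_L2(1)[OF assms(1)] assms(2)]
    L2_mult_integrable[OF test_function_L2(2)[OF assms(1)] assms(2)]
  by (simp_all add: scaleR_conv_of_real)

lemma weak_deriv_add:
  assumes "f1 \<in> L2" "g1 \<in> L2" "weak_deriv f1 g1" "f2 \<in> L2" "g2 \<in> L2" "weak_deriv f2 g2"
  shows "weak_deriv (\<lambda>x. f1 x + f2 x) (\<lambda>x. g1 x + g2 x)"
  unfolding weak_deriv_def
proof (intro allI impI)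
  fix \<phi> assume T: "test_function \<phi>"
  show "(LINT x|lborel. deriv \<phi> x *\<^sub>R (f1 x + f2 x)) = - (LINT x|lborel. \<phi> x *\<^sub>R (g1 x + g2 x))"
    using assms T test_function_integrable[OF T] by (simp add: scaleR_add_right weak_deriv_def)
qed

lemma weak_deriv_cmult:
  assumes "weak_deriv f g" shows "weak_deriv (\<lambda>x. c * f x) (\<lambda>x. c * g x)"
proof -
  have "(LINT x|lborel. a x *\<^sub>R (c * k x)) = c * (LINT x|lborel. a x *\<^sub>R k x)"
    for a :: "real \<Rightarrow> real" and k
  proof -
    have "(\<lambda>x. a x *\<^sub>R (c * k x)) = (\<lambda>x. c * (a x *\<^sub>R k x))" by simp
    then show ?thesis by (simp only: integral_mult_right_zero)
  qed
  with assms show ?thesis by (simp only: weak_deriv_def mult_minus_right) simp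
qed

section \<open>Uniqueness of weak derivatives\<close>

definition smooth_jet :: "(nat \<Rightarrow> real \<Rightarrow> real) \<Rightarrow> bool" where
  "smooth_jet D \<longleftrightarrow> (\<forall>n x. (D n has_real_derivative D (Suc n) x) (at x))"

lemma smooth_jet_deriv: assumes "smooth_jet D" shows "(deriv ^^ n) (D 0) = D n"
proof (induction n)
  case (Suc n)
  have "deriv (D n) = D (Suc n)"
    using assms by (auto simp: smooth_jet_def intro!: ext DERIV_imp_deriv)
  with Suc show ?case by simp
qed simp

lemma smooth_jet_mult:
  assumes "smooth_jet D" "smooth_jet E"
  shows "smooth_jet (\<lambda>n x. \<Sum>k\<le>n. real (n choose k) * D k x * E (n - k) x)"
  unfolding smooth_jet_def
proof (intro allI)
  fix n x
  have D: "(D k has_real_derivative D (Suc k) x) (at x)"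
    and E: "(E k has_real_derivative E (Suc k) x) (at x)" for k
    using assms by (auto simp: smooth_jet_def)
  have "((\<lambda>x. \<Sum>k\<le>n. real (n choose k) * D k x * E (n - k) x) has_real_derivative
     (\<Sum>k\<le>n. real (n choose k) * D (Suc k) x * E (n - k) x
            + real (n choose k) * D k x * E (Suc (n - k)) x)) (at x)"
    by (rule derivative_eq_intros D E refl | simp add: algebra_simps)+
  also have "(\<Sum>k\<le>n. real (n choose k) * D (Suc k) x * E (n - k) x
            + real (n choose k) * D k x * E (Suc (n - k)) x)
     = (\<Sum>k\<le>n. real (n choose k) * D (Suc k) x * E (Suc n - Suc k) x)
     + (\<Sum>k\<le>n. real (n choose k) * D k x * E (Suc n - k) x)"
    by (simp add: sum.distrib Suc_diff_le)
  also have "(\<Sum>k\<le>n. real (n choose k) * D k x * E (Suc n - k) x)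
     = (\<Sum>k\<le>Suc n. real (n choose k) * D k x * E (Suc n - k) x)"
    by simp
  also have "\<dots> = D 0 x * E (Suc n) x
     + (\<Sum>k\<le>n. real (n choose Suc k) * D (Suc k) x * E (Suc n - Suc k) x)"
    by (subst sum.atMost_Suc_shift) simp
  also have "(\<Sum>k\<le>n. real (n choose k) * D (Suc k) x * E (Suc n - Suc k) x) +
      (D 0 x * E (Suc n) x
       + (\<Sum>k\<le>n. real (n choose Suc k) * D (Suc k) x * E (Suc n - Suc k) x))
     = (\<Sum>k\<le>Suc n. real (Suc n choose k) * D k x * E (Suc n - k) x)"
    by (subst sum.atMost_Suc_shift) (simp add: sum.distrib algebra_simps)
  finally show "((\<lambda>x. \<Sum>k\<le>n. real (n choose k) * D k x * E (n - k) x) has_real_derivative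
     (\<Sum>k\<le>Suc n. real (Suc n choose k) * D k x * E (Suc n - k) x)) (at x)" .
qed

lemma smooth_jet_affine:
  assumes "smooth_jet D" shows "smooth_jet (\<lambda>n x. c ^ n * D n (c * x + d))"
  unfolding smooth_jet_def
proof (intro allI)
  fix n x
  have D: "(D n has_real_derivative D (Suc n) (c * x + d)) (at (c * x + d))"
    using assms by (auto simp: smooth_jet_def)
  have "((\<lambda>x. c * x + d) has_real_derivative c) (at x)"
    by (auto intro!: derivative_eq_intros)
  from DERIV_chain2[OF D this]
  have "((\<lambda>x. D n (c * x + d)) has_real_derivative D (Suc n) (c * x + d) * c) (at x)" .
  then show "((\<lambda>x. c ^ n * D n (c * x + d)) has_real_derivative
      c ^ Suc n * D (Suc n) (c * x + d)) (at x)"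
    by (auto intro!: derivative_eq_intros)
qed

lemma test_function_jet:
  assumes "smooth_jet D" "\<And>x. \<bar>x\<bar> > a \<Longrightarrow> D 0 x = 0"
  shows "test_function (D 0)"
  unfolding test_function_def
proof (intro conjI allI)
  fix n x show "(deriv ^^ n) (D 0) differentiable (at x)"
    using assms(1) unfolding smooth_jet_deriv[OF assms(1)] smooth_jet_def
    by (auto simp: real_differentiable_def)
next
  have "{x. D 0 x \<noteq> 0} \<subseteq> cball 0 a" using assms(2) by (force simp: not_le[symmetric])
  then show "compact (closure {x. D 0 x \<noteq> 0})"
    by (meson bounded_cball bounded_subset compact_closure)
qed

definition flat_exp :: "real \<Rightarrow> real" where
  "flat_exp x = (if x > 0 then exp (- 1 / x) else 0)"

lemma flat_exp_jet: "\<exists>D. smooth_jet D \<and> D 0 = flat_exp"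
proof -
  define P :: "nat \<Rightarrow> real poly" where
    "P = rec_nat 1 (\<lambda>_ q. [:0, 0, 1:] * (q - pderiv q))"
  define D where "D n x = (if x > 0 then poly (P n) (inverse x) * exp (- inverse x) else 0)" for n x
  have P: "P 0 = 1" "P (Suc n) = [:0, 0, 1:] * (P n - pderiv (P n))" for n
    by (simp_all add: P_def)
  have lim: "((\<lambda>x. poly q (inverse x) * exp (- inverse x)) \<longlongrightarrow> 0) (at_right 0)" for q :: "real poly"
  proof -
    have "((\<lambda>t. poly q t * exp (- t)) \<longlongrightarrow> 0) at_top"
    proof -
      have "((\<lambda>t. \<Sum>i\<le>degree q. coeff q i * (t ^ i / exp t)) \<longlongrightarrow> (\<Sum>i\<le>degree q. coeff q i * 0)) at_top"
        by (intro tendsto_intros tendsto_power_div_exp_0)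
      then show ?thesis
        by (simp add: poly_altdef sum_distrib_right exp_minus divide_inverse mult.assoc)
    qed
    from filterlim_compose[OF this filterlim_inverse_at_top_right] show ?thesis .
  qed
  have "(D n has_real_derivative D (Suc n) x) (at x)" for n x
  proof -
    consider "x > 0" | "x < 0" | "x = 0" by linarith
    then show ?thesis
    proof cases
      case 1
      have "((\<lambda>x. poly (P n) (inverse x) * exp (- inverse x)) has_real_derivative D (Suc n) x) (at x)"
        using 1
        by (auto intro!: derivative_eq_intros DERIV_chain2[OF poly_DERIV]
             simp: D_def P algebra_simps power2_eq_square)
      moreover have "\<forall>\<^sub>F y in nhds x. poly (P n) (inverse y) * exp (- inverse y) = D n y"
        using eventually_nhds_in_open[of "{0<..}" x] 1
        by (auto elim!: eventually_mono simp: D_def)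
      ultimately show ?thesis by (subst DERIV_cong_ev[OF refl _ refl]) (auto elim: eventually_mono)
    next
      case 2
      have "\<forall>\<^sub>F y in nhds x. D n y = 0"
        using eventually_nhds_in_open[of "{..<0}" x] 2
        by (auto elim!: eventually_mono simp: D_def)
      then show ?thesis using 2
        by (subst DERIV_cong_ev[OF refl _ refl, where g = "\<lambda>_. 0"]) (auto simp: D_def)
    next
      case 3
      have "((\<lambda>y. (D n y - D n 0) / (y - 0)) \<longlongrightarrow> 0) (at 0)"
      proof (rule filterlim_split_at)
        have "\<forall>\<^sub>F y in at_left (0::real). (D n y - D n 0) / (y - 0) = 0"
          by (auto simp: eventually_at_filter D_def)
        then show "((\<lambda>y. (D n y - D n 0) / (y - 0)) \<longlongrightarrow> 0) (at_left 0)"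
          by (rule tendsto_eventually)
        have "\<forall>\<^sub>F y in at_right (0::real).
          poly ([:0,1:] * P n) (inverse y) * exp (- inverse y) = (D n y - D n 0) / (y - 0)"
          by (auto simp: eventually_at_filter D_def field_simps)
        then show "((\<lambda>y. (D n y - D n 0) / (y - 0)) \<longlongrightarrow> 0) (at_right 0)"
          using lim[of "[:0,1:] * P n"] by (rule Lim_transform_eventually[rotated])
      qed
      then show ?thesis using 3 by (simp add: has_field_derivative_iff D_def)
    qed
  qed
  moreover have "D 0 = flat_exp"
    by (auto simp: D_def P flat_exp_def divide_inverse)
  ultimately show ?thesis by (auto simp: smooth_jet_def)
qed

lemma L2_set_integrable:
  assumes "h \<in> L2" "A \<in> sets borel" "bounded A"
  shows "set_integrable lborel A h"
proof -
  have [measurable]: "h \<in> borel_measurable borel" "A \<in> sets borel"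
    using assms by (auto simp: L2_def)
  obtain a where a: "A \<subseteq> {-a..a}"
    using assms(3) by (force simp: bounded_iff abs_le_iff)
  have "emeasure lborel A \<le> emeasure lborel {-a..a}" using a by (intro emeasure_mono) auto
  also have "\<dots> < \<infinity>" by (simp add: emeasure_lborel_Icc_eq)
  finally have "integrable lborel (indicator A :: real \<Rightarrow> real)"
    by (intro integrable_real_indicator) auto
  moreover have "(\<lambda>x. (cmod (indicator A x))\<^sup>2) = (indicator A :: real \<Rightarrow> real)"
    by (auto simp: indicator_def)
  moreover have "(indicator A :: real \<Rightarrow> complex) \<in> borel_measurable borel" by measurable
  ultimately have "(indicator A :: real \<Rightarrow> complex) \<in> L2" by (simp add: L2_def)
  from L2_mult_integrable[OF this assms(1)]
  have "integrable lborel (\<lambda>x. indicator A x * h x)" .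
  moreover have "(\<lambda>x. indicator A x *\<^sub>R h x) = (\<lambda>x. indicator A x * h x)"
    by (auto simp: indicator_def fun_eq_iff)
  ultimately show ?thesis by (simp only: set_integrable_def)
qed

lemma du_Bois_Reymond:
  assumes h: "h \<in> L2" and 0: "\<And>\<phi>. test_function \<phi> \<Longrightarrow> (LINT x|lborel. \<phi> x *\<^sub>R h x) = 0"
  shows "AE x in lborel. h x = 0"
proof -
  have [measurable]: "h \<in> borel_measurable borel" using h by (auto simp: L2_def)
  have Ioo: "(LINT x:{a<..<b}|lborel. h x) = 0" for a b :: real
  proof -
    define \<phi> where "\<phi> n x = flat_exp (real (Suc n) * x + - real (Suc n) * a) *
        flat_exp (- real (Suc n) * x + real (Suc n) * b)" for n x
    have outside: "\<phi> n x = 0" if "x \<notin> {a<..<b}" for n x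
    proof -
      have "real (Suc n) * (x - a) \<le> 0 \<or> real (Suc n) * (b - x) \<le> 0"
        using that by (auto simp: mult_le_0_iff simp del: of_nat_Suc)
      then show ?thesis by (auto simp: \<phi>_def flat_exp_def algebra_simps)
    qed
    have T: "test_function (\<phi> n)" for n
    proof -
      obtain D where D: "smooth_jet D" "D 0 = flat_exp" using flat_exp_jet by blast
      define E where "E n' x = (\<Sum>k\<le>n'. real (n' choose k)
          * (real (Suc n) ^ k * D k (real (Suc n) * x + - real (Suc n) * a))
          * ((- real (Suc n)) ^ (n' - k) * D (n' - k) (- real (Suc n) * x + real (Suc n) * b)))"
        for n' x
      have "smooth_jet E" unfolding E_def by (intro smooth_jet_mult smooth_jet_affine D)
      moreover have E0: "E 0 = \<phi> n" by (simp add: E_def D \<phi>_def fun_eq_iff)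
      moreover have "\<phi> n x = 0" if "\<bar>x\<bar> > \<bar>a\<bar> + \<bar>b\<bar>" for x
        using that by (intro outside) auto
      ultimately have "test_function (E 0)"
        by (intro test_function_jet[of E "\<bar>a\<bar> + \<bar>b\<bar>"]) simp_all
      then show ?thesis unfolding E0 .
    qed
    have flat: "0 \<le> flat_exp y" "flat_exp y \<le> 1" for y by (auto simp: flat_exp_def)
    have meas[measurable]: "\<phi> n \<in> borel_measurable borel" for n
      unfolding \<phi>_def flat_exp_def by measurable
    have lim: "(\<lambda>n. \<phi> n x) \<longlonglongrightarrow> indicator {a<..<b} x" for x
    proof (cases "x \<in> {a<..<b}")
      case True
      have "(\<lambda>n. flat_exp (real (Suc n) * c)) \<longlonglongrightarrow> 1" if "c > 0" for c
      proof -
        have "(\<lambda>n. exp (- (inverse (real (Suc n)) * inverse c))) \<longlonglongrightarrow> exp (- (0 * inverse c))"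
          by (intro tendsto_intros LIMSEQ_inverse_real_of_nat)
        then show ?thesis
          using that by (simp add: flat_exp_def divide_inverse mult.commute del: of_nat_Suc)
      qed
      from tendsto_mult[OF this[of "x - a"] this[of "b - x"]] True show ?thesis
        by (simp add: \<phi>_def algebra_simps)
    qed (use outside in simp)
    have "(\<lambda>n. LINT x|lborel. \<phi> n x *\<^sub>R h x) \<longlonglongrightarrow> (LINT x|lborel. indicator {a<..<b} x *\<^sub>R h x)"
    proof (rule integral_dominated_convergence)
      show "integrable lborel (\<lambda>x. norm (indicator {a<..<b} x *\<^sub>R h x))"
        using L2_set_integrable[OF h, of "{a<..<b}"]
        by (intro integrable_norm) (simp add: set_integrable_def)
      show "AE x in lborel. (\<lambda>n. \<phi> n x *\<^sub>R h x) \<longlonglongrightarrow> indicator {a<..<b} x *\<^sub>R h x"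
        by (intro always_eventually allI tendsto_scaleR lim tendsto_const)
      fix n
      show "AE x in lborel. norm (\<phi> n x *\<^sub>R h x) \<le> norm (indicator {a<..<b} x *\<^sub>R h x)"
      proof (intro always_eventually allI)
        fix x
        have "\<bar>\<phi> n x\<bar> \<le> indicator {a<..<b} x"
          using outside[of x n] flat by (auto simp: indicator_def \<phi>_def abs_mult intro!: mult_le_one)
        then show "norm (\<phi> n x *\<^sub>R h x) \<le> norm (indicator {a<..<b} x *\<^sub>R h x)"
          by (auto intro!: mult_right_mono)
      qed
    qed measurable
    then show ?thesis
      using 0[OF T] by (simp add: LIMSEQ_const_iff set_lebesgue_integral_def)
  qed
  have "AE x in lborel. indicator {-real m<..<real m} x *\<^sub>R h x = 0" for m
  proof (rule sigma_finite_measure.density_unique_banach[OF lborel.sigma_finite_measure_axioms])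
    let ?I = "{-real m<..<real m}"
    let ?k = "\<lambda>x. indicator ?I x *\<^sub>R h x"
    show ik: "integrable lborel ?k"
      using L2_set_integrable[OF h, of ?I] by (simp add: set_integrable_def)
    show "integrable lborel (\<lambda>_. 0 :: complex)" by simp
    fix A :: "real set" assume "A \<in> sets lborel"
    then have A: "A \<in> sigma_sets UNIV (range (\<lambda>(a, b). box a b))"
      by (simp add: borel_eq_box)
    have "Int_stable (range (\<lambda>(a, b). box a b :: real set))"
      by (auto simp: Int_stable_def box_Int_box)
    moreover have "range (\<lambda>(a, b). box a b :: real set) \<subseteq> Pow UNIV" by simp
    ultimately have "(LINT x:A|lborel. ?k x) = 0"
      using A
    proof (induction rule: sigma_sets_induct_disjoint)
      case (basic A)
      then obtain a b where "A = {a<..<b}" by (auto simp: box_real)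
      then have "(LINT x:A|lborel. ?k x) = (LINT x:{max a (-real m)<..<min b (real m)}|lborel. h x)"
        unfolding set_lebesgue_integral_def
        by (intro Bochner_Integration.integral_cong refl) (auto simp: indicator_def)
      then show ?case using Ioo by simp
    next
      case (compl A)
      then have [measurable]: "A \<in> sets borel" by (simp add: borel_eq_box)
      have "(LINT x:UNIV - A|lborel. ?k x) = (LINT x|lborel. ?k x - indicator A x *\<^sub>R ?k x)"
        unfolding set_lebesgue_integral_def
        by (intro Bochner_Integration.integral_cong refl) (auto simp: indicator_def)
      also have "\<dots> = (LINT x|lborel. ?k x) - (LINT x|lborel. indicator A x *\<^sub>R ?k x)"
        by (rule Bochner_Integration.integral_diff[OF ik integrable_mult_indicator[OF _ ik]]) simp
      finally show ?case
        using compl Ioo[of "-real m" "real m"] by (simp add: set_lebesgue_integral_def)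
    next
      case (union F)
      then have F: "F i \<in> sets lborel" for i by (auto simp: borel_eq_box)
      have "set_integrable lborel (\<Union>i. F i) ?k"
        unfolding set_integrable_def using F by (intro integrable_mult_indicator ik) auto
      from lebesgue_integral_countable_add[OF F _ this] union
      show ?case by (auto simp: disjoint_family_on_def)
    qed (simp add: set_lebesgue_integral_def)
    then show "(LINT x:A|lborel. ?k x) = (LINT x:A|lborel. 0)"
      by (simp add: set_lebesgue_integral_def)
  qed
  then have "AE x in lborel. \<forall>m. indicator {-real m<..<real m} x *\<^sub>R h x = 0"
    unfolding AE_all_countable by blast
  then show ?thesis
  proof (eventually_elim)
    case (elim x)
    obtain m where "\<bar>x\<bar> < real m" using reals_Archimedean2 by blast
    then show ?case using elim[rule_format, of m] by (simp add: indicator_def abs_less_iff split: if_splits)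
  qed
qed

lemma weak_deriv_unique:
  assumes "g1 \<in> L2" "g2 \<in> L2" "weak_deriv f g1" "weak_deriv f g2"
  shows "AE x in lborel. g1 x = g2 x"
proof -
  have "AE x in lborel. g1 x - g2 x = 0"
  proof (rule du_Bois_Reymond)
    fix \<phi> assume T: "test_function \<phi>"
    have "- (LINT x|lborel. \<phi> x *\<^sub>R g1 x) = - (LINT x|lborel. \<phi> x *\<^sub>R g2 x)"
      using T assms(3,4) unfolding weak_deriv_def by auto
    then have "(LINT x|lborel. \<phi> x *\<^sub>R g1 x) = (LINT x|lborel. \<phi> x *\<^sub>R g2 x)" by simp
    then show "(LINT x|lborel. \<phi> x *\<^sub>R (g1 x - g2 x)) = 0"
      using test_function_integrable(1)[OF T] assms(1,2) by (simp add: scaleR_diff_right)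
  qed (intro L2_diff assms)
  then show ?thesis by simp
qed

section \<open>The Hilbert space \<open>H\<^sup>1(\<real>)\<close>, viewed as a real inner product space\<close>

lemma H1_zero: "(\<lambda>_. 0) \<in> H1"
  using L2_zero by (force simp: H1_def weak_deriv_def)

lemma H1_add: assumes "f \<in> H1" "g \<in> H1" shows "(\<lambda>x. f x + g x) \<in> H1"
proof -
  obtain f' g' where "f' \<in> L2" "weak_deriv f f'" "g' \<in> L2" "weak_deriv g g'"
    using assms by (auto simp: H1_def)
  then show ?thesis using assms unfolding H1_def
    by (auto intro!: continuous_on_add L2_add bexI[of _ "\<lambda>x. f' x + g' x"] weak_deriv_add)
qed

lemma H1_cmult: assumes "f \<in> H1" shows "(\<lambda>x. c * f x) \<in> H1"
proof -
  obtain f' where "f' \<in> L2" "weak_deriv f f'" using assms by (auto simp: H1_def)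
  then show ?thesis using assms unfolding H1_def
    by (auto intro!: continuous_intros L2_cmult bexI[of _ "\<lambda>x. c * f' x"] weak_deriv_cmult)
qed

typedef h1 = H1 morphisms h1_fun Abs_h1
  using H1_zero by blast

setup_lifting type_definition_h1

lift_definition h1_cscale :: "complex \<Rightarrow> h1 \<Rightarrow> h1" is "\<lambda>c f x. c * f x"
  by (rule H1_cmult)

definition h1_deriv :: "h1 \<Rightarrow> real \<Rightarrow> complex" where
  "h1_deriv u = (SOME g. g \<in> L2 \<and> weak_deriv (h1_fun u) g)"

definition L2_inner :: "(real \<Rightarrow> complex) \<Rightarrow> (real \<Rightarrow> complex) \<Rightarrow> real" where
  "L2_inner f g = Re (LINT x|lborel. f x * cnj (g x))"

lemma h1_deriv: "h1_deriv u \<in> L2" "weak_deriv (h1_fun u) (h1_deriv u)"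
proof -
  have "\<exists>g. g \<in> L2 \<and> weak_deriv (h1_fun u) g" using h1_fun[of u] by (auto simp: H1_def)
  from someI_ex[OF this] show "h1_deriv u \<in> L2" "weak_deriv (h1_fun u) (h1_deriv u)"
    by (simp_all add: h1_deriv_def)
qed

lemma h1_fun_L2: "h1_fun u \<in> L2"
  using h1_fun[of u] by (simp add: H1_def)

lemma h1_deriv_AE:
  assumes "g \<in> L2" "weak_deriv (h1_fun u) g" shows "AE x in lborel. h1_deriv u x = g x"
  using weak_deriv_unique h1_deriv assms by blast

lemma L2_inner_commute: "L2_inner f g = L2_inner g f"
proof -
  have "(LINT x|lborel. g x * cnj (f x)) = (LINT x|lborel. cnj (f x * cnj (g x)))"
    by (simp add: mult.commute)
  also have "\<dots> = cnj (LINT x|lborel. f x * cnj (g x))"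
    by (rule Bochner_Integration.integral_cnj)
  finally show ?thesis by (simp add: L2_inner_def)
qed

lemma L2_inner_add:
  assumes "f \<in> L2" "g \<in> L2" "k \<in> L2"
  shows "L2_inner (\<lambda>x. f x + g x) k = L2_inner f k + L2_inner g k"
  using assms by (simp add: L2_inner_def distrib_right L2_mult_integrable L2_cnj)

lemma L2_inner_scale: "L2_inner (\<lambda>x. of_real r * f x) g = r * L2_inner f g"
  by (simp add: L2_inner_def mult.assoc)

lemma L2_inner_cong_AE:
  assumes "AE x in lborel. f x = g x" "f \<in> L2" "g \<in> L2" "k \<in> L2"
  shows "L2_inner f k = L2_inner g k"
proof -
  have "(LINT x|lborel. f x * cnj (k x)) = (LINT x|lborel. g x * cnj (k x))"
    using assms L2_mult_integrable[OF _ L2_cnj]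
    by (intro integral_cong_AE) (auto intro: borel_measurable_integrable)
  then show ?thesis by (simp add: L2_inner_def)
qed

lemma L2_inner_self: "L2_inner f f = (LINT x|lborel. (cmod (f x))\<^sup>2)"
proof -
  have "(LINT x|lborel. f x * cnj (f x)) = (LINT x|lborel. complex_of_real ((cmod (f x))\<^sup>2))"
    by (simp only: complex_norm_square)
  then show ?thesis by (simp add: L2_inner_def del: of_real_power)
qed

lemma L2_inner_self_nonneg: "L2_inner f f \<ge> 0"
  by (simp add: L2_inner_self)

instantiation h1 :: real_inner
begin

lift_definition zero_h1 :: h1 is "\<lambda>_. 0" by (rule H1_zero)
lift_definition plus_h1 :: "h1 \<Rightarrow> h1 \<Rightarrow> h1" is "\<lambda>f g x. f x + g x" by (rule H1_add)
definition uminus_h1 :: "h1 \<Rightarrow> h1" where "uminus_h1 u = h1_cscale (-1) u"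
definition minus_h1 :: "h1 \<Rightarrow> h1 \<Rightarrow> h1" where "minus_h1 u v = u + (- v)"
definition scaleR_h1 :: "real \<Rightarrow> h1 \<Rightarrow> h1" where "scaleR_h1 r u = h1_cscale (of_real r) u"
definition inner_h1 :: "h1 \<Rightarrow> h1 \<Rightarrow> real" where
  "inner_h1 u v = L2_inner (h1_fun u) (h1_fun v) + L2_inner (h1_deriv u) (h1_deriv v)"
definition norm_h1 :: "h1 \<Rightarrow> real" where "norm_h1 u = sqrt (inner u u)"
definition dist_h1 :: "h1 \<Rightarrow> h1 \<Rightarrow> real" where "dist_h1 u v = norm (u - v)"
definition sgn_h1 :: "h1 \<Rightarrow> h1" where "sgn_h1 u = h1_cscale (of_real (inverse (norm u))) u"
definition uniformity_h1 :: "(h1 \<times> h1) filter" where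
  "uniformity_h1 = (INF e\<in>{0 <..}. principal {(x, y). dist x y < e})"
definition open_h1 :: "h1 set \<Rightarrow> bool" where
  "open_h1 U \<longleftrightarrow> (\<forall>x\<in>U. eventually (\<lambda>(x', y). x' = x \<longrightarrow> y \<in> U) uniformity)"

instance
proof
  fix x y z :: h1 and a b r :: real
  show "x + y + z = x + (y + z)" by transfer (simp add: add.assoc)
  show "x + y = y + x" by transfer (simp add: add.commute)
  show "0 + x = x" by transfer simp
  show "- x + x = 0" unfolding uminus_h1_def by transfer simp
  show "x - y = x + - y" by (simp add: minus_h1_def)
  show "a *\<^sub>R (x + y) = a *\<^sub>R x + a *\<^sub>R y"
    unfolding scaleR_h1_def by transfer (simp add: distrib_left)
  show "(a + b) *\<^sub>R x = a *\<^sub>R x + b *\<^sub>R x"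
    unfolding scaleR_h1_def by transfer (simp add: distrib_right)
  show "a *\<^sub>R b *\<^sub>R x = (a * b) *\<^sub>R x"
    unfolding scaleR_h1_def by transfer (simp add: mult.assoc)
  show "1 *\<^sub>R x = x" unfolding scaleR_h1_def by transfer simp
  show "dist x y = norm (x - y)" by (simp add: dist_h1_def)
  show "sgn x = inverse (norm x) *\<^sub>R x" by (simp add: sgn_h1_def scaleR_h1_def)
  show "(uniformity :: (h1 \<times> h1) filter) = (INF e\<in>{0 <..}. principal {(x, y). dist x y < e})"
    by (rule uniformity_h1_def)
  show "open U \<longleftrightarrow> (\<forall>x\<in>U. eventually (\<lambda>(x', y). x' = x \<longrightarrow> y \<in> U) uniformity)" for U :: "h1 set"
    by (rule open_h1_def)
  show "inner x y = inner y x"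
    by (simp add: inner_h1_def L2_inner_commute[of "h1_fun x"] L2_inner_commute[of "h1_deriv x"])
  show "inner (x + y) z = inner x z + inner y z"
  proof -
    have f: "h1_fun (x + y) = (\<lambda>t. h1_fun x t + h1_fun y t)" by transfer simp
    have "AE t in lborel. h1_deriv (x + y) t = h1_deriv x t + h1_deriv y t"
      by (intro h1_deriv_AE L2_add h1_deriv) (simp add: f weak_deriv_add h1_fun_L2 h1_deriv)
    then have "L2_inner (h1_deriv (x + y)) (h1_deriv z)
        = L2_inner (\<lambda>t. h1_deriv x t + h1_deriv y t) (h1_deriv z)"
      by (intro L2_inner_cong_AE L2_add h1_deriv)
    then show ?thesis by (simp add: inner_h1_def f L2_inner_add h1_fun_L2 h1_deriv)
  qed
  show "inner (r *\<^sub>R x) y = r * inner x y"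
  proof -
    have f: "h1_fun (r *\<^sub>R x) = (\<lambda>t. of_real r * h1_fun x t)"
      unfolding scaleR_h1_def by transfer simp
    have "AE t in lborel. h1_deriv (r *\<^sub>R x) t = of_real r * h1_deriv x t"
      by (intro h1_deriv_AE L2_cmult h1_deriv) (simp add: f weak_deriv_cmult h1_deriv)
    then have "L2_inner (h1_deriv (r *\<^sub>R x)) (h1_deriv y)
        = L2_inner (\<lambda>t. of_real r * h1_deriv x t) (h1_deriv y)"
      by (intro L2_inner_cong_AE L2_cmult h1_deriv)
    then show ?thesis by (simp add: inner_h1_def f L2_inner_scale distrib_left)
  qed
  show "0 \<le> inner x x" by (simp add: inner_h1_def L2_inner_self_nonneg)
  show "inner x x = 0 \<longleftrightarrow> x = 0"
  proof
    assume "x = 0"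
    have "h1_fun 0 = (\<lambda>_. 0)" by transfer simp
    moreover have "AE t in lborel. h1_deriv 0 t = 0"
      by (intro h1_deriv_AE L2_zero) (simp add: calculation weak_deriv_def)
    then have "L2_inner (h1_deriv 0) (h1_deriv 0) = L2_inner (\<lambda>_. 0) (h1_deriv 0)"
      by (intro L2_inner_cong_AE L2_zero h1_deriv)
    ultimately show "inner x x = 0" using \<open>x = 0\<close> by (simp add: inner_h1_def L2_inner_def)
  next
    assume "inner x x = 0"
    then have "L2_inner (h1_fun x) (h1_fun x) = 0"
      using L2_inner_self_nonneg[of "h1_fun x"] L2_inner_self_nonneg[of "h1_deriv x"]
      unfolding inner_h1_def by linarith
    then have "AE t in lborel. (cmod (h1_fun x t))\<^sup>2 = 0"
      using h1_fun_L2[of x]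
      by (subst (asm) L2_inner_self, subst (asm) integral_nonneg_eq_0_iff_AE) (auto simp: L2_def)
    then have AE: "AE t in lborel. h1_fun x t = 0" by simp
    have cont: "continuous_on UNIV (h1_fun x)" using h1_fun[of x] by (simp add: H1_def)
    have "h1_fun x t = 0" for t
    proof (rule ccontr)
      assume "h1_fun x t \<noteq> 0"
      moreover have op: "open {t. h1_fun x t \<noteq> 0}"
        by (intro open_Collect_neq cont continuous_on_const)
      ultimately have "\<not> negligible {t. h1_fun x t \<noteq> 0}" by (intro open_not_negligible) auto
      moreover have "{t. h1_fun x t \<noteq> 0} \<in> null_sets lborel"
        using AE op by (subst AE_iff_null_sets) auto
      ultimately show False
        by (auto simp: negligible_iff_null_sets intro: null_sets_completionI)
    qed
    then show "x = 0" by transfer auto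
  qed
  show "norm x = sqrt (inner x x)" by (simp add: norm_h1_def)
qed

end

section \<open>The equation and its standing waves\<close>

text \<open>\<open>H\<^sup>-\<^sup>1(\<real>)\<close> is the space \<open>h1 \<Rightarrow>\<^sub>L real\<close> of bounded real-linear functionals;
  \<open>L\<^sup>2\<close> functions act through the real pairing \<open>L2_inner\<close>. In particular
  multiplication by \<open>\<i>\<close> on \<open>H\<^sup>-\<^sup>1\<close> is \<open>\<langle>\<i> F, v\<rangle> = \<langle>F, - \<i> v\<rangle>\<close>.\<close>

lift_definition h1_embed :: "h1 \<Rightarrow> (h1 \<Rightarrow>\<^sub>L real)" is
  "\<lambda>u v. L2_inner (h1_fun u) (h1_fun v)"
proof -
  fix u :: h1
  have add: "h1_fun (v + w) = (\<lambda>t. h1_fun v t + h1_fun w t)" for v w by transfer simp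
  have scale: "h1_fun (r *\<^sub>R v) = (\<lambda>t. of_real r * h1_fun v t)" for r v
    unfolding scaleR_h1_def by transfer simp
  have le: "L2_inner (h1_fun v) (h1_fun v) \<le> (norm v)\<^sup>2" for v
    using L2_inner_self_nonneg[of "h1_deriv v"] by (simp add: power2_norm_eq_inner inner_h1_def)
  let ?L = "\<lambda>v. L2_inner (h1_fun u) (h1_fun v)"
  have comm: "?L v = L2_inner (h1_fun v) (h1_fun u)" for v by (rule L2_inner_commute)
  show "bounded_linear ?L"
  proof (rule bounded_linear_intro)
    show "?L (v + w) = ?L v + ?L w" for v w
      unfolding comm unfolding add by (intro L2_inner_add h1_fun_L2)
    show "?L (r *\<^sub>R v) = r *\<^sub>R ?L v" for r v
      unfolding comm unfolding scale L2_inner_scale by simp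
    show "norm (?L v) \<le> norm v * (L2_inner (h1_fun u) (h1_fun u) + 1)" for v
    proof (cases "v = 0")
      case True
      have "h1_fun 0 = (\<lambda>_. 0)" by transfer simp
      with True show ?thesis by (simp add: L2_inner_def)
    next
      case False
      define t where "t = norm v"
      have t: "t > 0" using False by (simp add: t_def)
      let ?a = "h1_fun u" and ?b = "h1_fun v"
      have "2 * \<bar>?L v\<bar> \<le> t * L2_inner ?a ?a + L2_inner ?b ?b / t"
      proof -
        have iR: "integrable lborel (\<lambda>x. Re (?a x * cnj (?b x)))"
          by (intro L2_inner_integrable h1_fun_L2)
        have sq: "integrable lborel (\<lambda>x. (cmod (h1_fun w x))\<^sup>2)" for w
          using h1_fun_L2[of w] by (simp add: L2_def)
        have pt: "\<bar>2 * Re (?a x * cnj (?b x))\<bar> \<le> t * (cmod (?a x))\<^sup>2 + (cmod (?b x))\<^sup>2 / t" for x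
        proof -
          have "\<bar>Re (?a x * cnj (?b x))\<bar> \<le> cmod (?a x) * cmod (?b x)"
            using abs_Re_le_cmod[of "?a x * cnj (?b x)"] by (simp add: norm_mult)
          moreover have "2 * (cmod (?a x) * cmod (?b x))
              \<le> t * (cmod (?a x))\<^sup>2 + (cmod (?b x))\<^sup>2 / t"
          proof -
            have "0 \<le> (t * cmod (?a x) - cmod (?b x))\<^sup>2 / t" using t by simp
            also have "\<dots> = t * (cmod (?a x))\<^sup>2 + (cmod (?b x))\<^sup>2 / t
                - 2 * (cmod (?a x) * cmod (?b x))"
              using t by (simp add: power2_diff field_simps power2_eq_square)
            finally show ?thesis by simp
          qed
          ultimately show ?thesis by simp
        qed
        have "2 * \<bar>?L v\<bar> = \<bar>LINT x|lborel. 2 * Re (?a x * cnj (?b x))\<bar>"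
          using L2_mult_integrable[OF h1_fun_L2[of u] L2_cnj[OF h1_fun_L2[of v]]]
          by (simp only: L2_inner_def integral_mult_right_zero integral_Re abs_mult abs_numeral)
        also have "\<dots> \<le> (LINT x|lborel. \<bar>2 * Re (?a x * cnj (?b x))\<bar>)"
          by (rule integral_abs_bound)
        also have "\<dots> \<le> (LINT x|lborel. t * (cmod (?a x))\<^sup>2 + (cmod (?b x))\<^sup>2 / t)"
          using iR sq pt by (intro integral_mono integrable_abs integrable_mult_right
              Bochner_Integration.integrable_add integrable_divide_zero) auto
        also have "\<dots> = t * L2_inner ?a ?a + L2_inner ?b ?b / t"
          using sq by (simp add: L2_inner_self)
        finally show ?thesis .
      qed
      also have "\<dots> \<le> t * L2_inner ?a ?a + t"
        using le[of v] t by (simp add: t_def field_simps power2_eq_square)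
      finally have "2 * \<bar>?L v\<bar> \<le> t * (L2_inner ?a ?a + 1)" by (simp add: algebra_simps)
      moreover have "0 \<le> \<bar>?L v\<bar>" by simp
      ultimately show ?thesis by (simp add: t_def)
    qed
  qed
qed

text \<open>The form of the operator \<open>A\<^sub>Z = -\<partial>\<^sub>x\<^sub>x - Z\<delta>\<close> on \<open>H\<^sup>1\<close>.\<close>

definition delta_form :: "real \<Rightarrow> h1 \<Rightarrow> h1 \<Rightarrow> real" where
  "delta_form Z u v =
     L2_inner (h1_deriv u) (h1_deriv v) - Z * Re (h1_fun u 0 * cnj (h1_fun v 0))"

definition nonlinearity :: "real \<Rightarrow> real \<Rightarrow> real \<Rightarrow> complex \<Rightarrow> complex" where
  "nonlinearity p lam1 lam2 z =
     of_real lam1 * z * of_real (cmod z powr (p - 1)) + of_real lam2 * z * of_real (cmod z powr (2 * p - 2))"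

definition nls_solution :: "real \<Rightarrow> real \<Rightarrow> real \<Rightarrow> real \<Rightarrow> (real \<Rightarrow> h1) \<Rightarrow> bool" where
  "nls_solution p lam1 lam2 Z u \<longleftrightarrow>
     continuous_on UNIV u \<and>
     (\<exists>u_t :: real \<Rightarrow> h1 \<Rightarrow>\<^sub>L real.
        continuous_on UNIV u_t \<and>
        (\<forall>t. ((\<lambda>s. h1_embed (u s)) has_vector_derivative u_t t) (at t)) \<and>
        (\<forall>t v. blinfun_apply (u_t t) (h1_cscale (- \<i>) v) - delta_form Z (u t) v
            + L2_inner (\<lambda>x. nonlinearity p lam1 lam2 (h1_fun (u t) x)) (h1_fun v) = 0))"

text \<open>Only \<open>\<phi>\<close> occurs below, not the frequency: for \<open>\<omega> \<noteq> 0\<close> the orbit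
  of \<open>exp (- \<i> \<omega> t) \<phi>\<close> is the phase orbit of \<open>\<phi>\<close>. The Cauchy problem being
  globally well-posed, ``the solution with initial value \<open>u0\<close>'' is rendered by quantifying over all
  solutions with that initial value. The function \<open>\<phi>\<close> is required to belong to \<open>H1\<close>.\<close>

definition orbitally_stable ::
  "real \<Rightarrow> real \<Rightarrow> real \<Rightarrow> real \<Rightarrow> (real \<Rightarrow> complex) \<Rightarrow> bool" where
  "orbitally_stable p lam1 lam2 Z \<phi> \<longleftrightarrow>
     (\<exists>\<Phi>. h1_fun \<Phi> = \<phi> \<and>
       (\<forall>\<epsilon>>0. \<exists>\<eta>>0. \<forall>u0. norm (u0 - \<Phi>) < \<eta> \<longrightarrow>
          (\<forall>u. nls_solution p lam1 lam2 Z u \<and> u 0 = u0 \<longrightarrow>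
             (\<forall>t. (INF \<theta>. norm (u t - h1_cscale (cis \<theta>) \<Phi>)) < \<epsilon>))))"

text \<open>In the profile, \<open>\<gamma>\<close> stands for \<open>sqrt (\<omega> * \<beta> - \<alpha>\<^sup>2)\<close> and \<open>k\<close> for \<open>(p - 1) * sqrt (- \<omega>)\<close>.\<close>

definition R1 :: "real \<Rightarrow> real \<Rightarrow> real \<Rightarrow> real \<Rightarrow> real" where
  "R1 \<alpha> \<gamma> k d = \<gamma> * cosh (k * d) / (\<gamma> * sinh (k * d) + \<alpha>)"

definition profile :: "real \<Rightarrow> real \<Rightarrow> real \<Rightarrow> real \<Rightarrow> real \<Rightarrow> real \<Rightarrow> complex" where
  "profile p lam1 lam2 Z \<omega> x =
     (let \<alpha> = lam1 / (p + 1);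
          \<beta> = lam2 / p;
          \<gamma> = sqrt (\<omega> * \<beta> - \<alpha>\<^sup>2);
          k = (p - 1) * sqrt (- \<omega>);
          l = 1 / k * arsinh (\<alpha> / \<gamma>);
          d = inv_into {- l<..} (R1 \<alpha> \<gamma> k) (Z / (2 * sqrt (- \<omega>)))
      in of_real ((\<alpha> / (- \<omega>) + \<gamma> / (- \<omega>) * sinh (k * (\<bar>x\<bar> + d))) powr (- 1 / (p - 1))))"

end

theory Submission
  imports Defs
begin

text \<open>
  Put \<open>W = - \<omega>\<close>. The action \<open>S = E - \<omega> M / 2\<close> (energy \<open>E\<close>, mass \<open>M\<close>) is
  \<open>S(u) = T(u) - Z/2 |u(0)|\<^sup>2\<close> with \<open>T(u) = \<integral> |u'|\<^sup>2/2 + \<rho>(|u|)\<^sup>2/2\<close>, because both nonlinear terms are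
  defocusing. From \<open>|u'|\<^sup>2/2 + \<rho>(|u|)\<^sup>2/2 \<ge> \<rho>(|u|) |u'|\<close> one gets \<open>S(u) \<ge> g(|u(0)|)\<close> for the
  function \<open>g(s) = 2 \<integral>\<^sub>0\<^sup>s \<rho> - Z s\<^sup>2/2\<close>, with equality for the profile, which solves
  \<open>\<phi>' = - \<rho>(\<phi>)\<close> on the right half-line; and \<open>g\<close> has a strict minimum at \<open>\<phi>(0)\<close>. So the profile
  minimizes \<open>S\<close> on all of \<open>H\<^sup>1\<close>, and if \<open>S(u)\<close> is almost minimal, then \<open>|u(0)|\<close> is close to
  \<open>\<phi>(0)\<close>. As \<open>T\<close> is strongly convex, comparing \<open>u\<close>, the profile with the phase of \<open>u(0)\<close>, and their
  midpoint then shows that \<open>u\<close> is close to the orbit in \<open>H\<^sup>1\<close>.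

  It remains to conserve \<open>S\<close>. A solution is only \<open>C\<^sup>1\<close> with values in \<open>H\<^sup>-\<^sup>1\<close>, so \<open>E\<close> cannot be
  differentiated directly. Instead, for \<open>m(s, t) = \<langle>u(s), - \<i> u(t)\<rangle>\<close> the quadratic terms cancel in
  \<open>d/dt m(t + h, t)\<close>; what is left is, up to \<open>O(|u(t + h) - u(t)|\<^sub>2\<^sup>2) = o(h)\<close>, an increment
  \<open>H(t + h) - H(t)\<close>. Integrating in \<open>t\<close>, dividing by \<open>h\<close> and letting \<open>h\<close> tend to \<open>0\<close> shows that
  \<open>\<langle>E'(u), u\<rangle> - H\<close>, which is \<open>2 E\<close>, is constant.
\<close>

section \<open>Power nonlinearities\<close>

text \<open>Convexity of the power: subtracting the linear part of the tangent at \<open>a\<close>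
  leaves \<open>f\<close>, whose derivative has the sign of \<open>x - a\<close>. At
  \<open>a = 0\<close> all terms on the left vanish.\<close>

lemma powr_tangent:
  fixes a b q :: real
  assumes "0 \<le> a" "0 \<le> b" "1 < q"
  shows "a powr q + q * a powr (q - 1) * (b - a) \<le> b powr q"
proof (cases "a = 0 \<or> a = b")
  case False
  then have "0 < a" using assms by simp
  define f where "f x = x powr q - q * a powr (q - 1) * x" for x
  have df: "(f has_real_derivative q * x powr (q - 1) - q * a powr (q - 1)) (at x)" if "0 < x" for x
    unfolding f_def using that by (auto intro!: derivative_eq_intros)
  have cont: "continuous_on {0..} f"
    unfolding f_def using assms(3) by (auto intro!: continuous_intros continuous_on_powr')
  have "f a \<le> f b"
  proof (cases "a < b")
    case True
    show ?thesis
    proof (rule DERIV_nonneg_imp_increasing_open[OF less_imp_le[OF True]])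
      fix x assume "a < x" "x < b"
      then show "\<exists>y. (f has_real_derivative y) (at x) \<and> 0 \<le> y"
        using df[of x] \<open>0 < a\<close> assms by (intro exI conjI) (auto intro!: mult_left_mono powr_mono2)
    qed (use cont \<open>0 < a\<close> in \<open>auto elim: continuous_on_subset\<close>)
  next
    case False
    then have "b \<le> a" by simp
    then show ?thesis
    proof (rule DERIV_nonpos_imp_decreasing_open)
      fix x assume "b < x" "x < a"
      then show "\<exists>y. (f has_real_derivative y) (at x) \<and> y \<le> 0"
        using df[of x] \<open>0 < a\<close> assms by (intro exI conjI) (auto intro!: mult_left_mono powr_mono2)
    qed (use cont assms in \<open>auto elim: continuous_on_subset\<close>)
  qed
  then show ?thesis by (simp add: f_def algebra_simps)
qed (use assms in auto)

lemma power_term_Re: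
  "Re (z * of_real (cmod z powr r) * cnj z) = cmod z powr (r + 2)"
proof (cases "z = 0")
  case False
  have "z * of_real (cmod z powr r) * cnj z = of_real (cmod z powr r * (cmod z)\<^sup>2)"
    by (simp add: complex_norm_square[symmetric] mult.commute mult.left_commute)
  then show ?thesis
    using False by (simp only: Re_complex_of_real) (simp add: powr_add powr_numeral)
qed simp

text \<open>For |w| \<le> |z| the difference is |z|^r (z - w) + w (|z|^r - |w|^r). The factor
  \<open>w\<close> stays in the second term because s^r alone is not Lipschitz at 0 when r < 1; the
  tangent inequality for the exponent r + 1 bounds the product.\<close>

lemma power_term_Lipschitz:
  fixes z w :: complex
  assumes "0 < r" "cmod z \<le> M" "cmod w \<le> M"
  shows "cmod (z * of_real (cmod z powr r) - w * of_real (cmod w powr r))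
    \<le> (r + 1) * M powr r * cmod (z - w)"
proof -
  have *: "cmod (z * of_real (cmod z powr r) - w * of_real (cmod w powr r))
    \<le> (r + 1) * M powr r * cmod (z - w)" if "cmod w \<le> cmod z" "cmod z \<le> M" for z w
  proof -
    define s t where "s = cmod z" and "t = cmod w"
    have st: "0 \<le> t" "t \<le> s" "s \<le> M" using that by (auto simp: s_def t_def)
    have tz: "s - t \<le> cmod (z - w)"
      unfolding s_def t_def by (rule norm_triangle_ineq2)
    have "t * (s powr r - t powr r) \<le> r * s powr r * (s - t)"
    proof (cases "s = 0")
      case False
      have tan: "s powr (r + 1) + (r + 1) * s powr (r + 1 - 1) * (t - s) \<le> t powr (r + 1)"
        using st assms by (intro powr_tangent) auto
      moreover have "s powr (r + 1) = s powr r * s" "t powr (r + 1) = t powr r * t"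
        using st by (simp_all add: powr_add)
      ultimately show ?thesis by (simp add: algebra_simps)
    qed (use st in auto)
    also have "\<dots> \<le> r * M powr r * cmod (z - w)"
      using st assms tz by (intro mult_mono powr_mono2) auto
    finally have 1: "t * (s powr r - t powr r) \<le> r * M powr r * cmod (z - w)" .
    have 2: "s powr r * cmod (z - w) \<le> M powr r * cmod (z - w)"
      using st assms by (intro mult_right_mono powr_mono2) auto
    have "z * of_real (s powr r) - w * of_real (t powr r)
        = of_real (s powr r) * (z - w) + w * of_real (s powr r - t powr r)"
      by (simp add: algebra_simps)
    also have "cmod \<dots> \<le> s powr r * cmod (z - w) + t * \<bar>s powr r - t powr r\<bar>"
      by (rule order_trans[OF norm_triangle_ineq]) (simp add: norm_mult t_def del: of_real_diff)
    also have "\<bar>s powr r - t powr r\<bar> = s powr r - t powr r"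
      using st assms by (simp add: powr_mono2)
    finally show ?thesis using 1 2 by (simp add: s_def t_def algebra_simps)
  qed
  show ?thesis
    using *[of w z] *[of z w] assms by (cases "cmod w \<le> cmod z") (auto simp: norm_minus_commute)
qed

text \<open>Convexity of |w|^(r + 2) on the plane; Cauchy-Schwarz reduces it to the scalar tangent
  inequality at |z|.\<close>

lemma power_term_tangent:
  fixes z w :: complex
  assumes "0 \<le> r"
  shows "cmod z powr (r + 2) + (r + 2) * Re (z * of_real (cmod z powr r) * cnj (w - z))
    \<le> cmod w powr (r + 2)"
proof (cases "z = 0")
  case False
  have "Re (z * of_real (cmod z powr r) * cnj (w - z))
      = cmod z powr r * Re (z * cnj w) - cmod z powr (r + 2)"
    unfolding power_term_Re[symmetric] by (simp add: algebra_simps)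
  also have "\<dots> \<le> cmod z powr r * (cmod z * cmod w) - cmod z powr (r + 2)"
    using complex_Re_le_cmod[of "z * cnj w"] by (intro diff_mono mult_left_mono) (auto simp: norm_mult)
  also have "\<dots> = cmod z powr (r + 1) * (cmod w - cmod z)"
    using False by (simp add: powr_add powr_numeral power2_eq_square algebra_simps)
  finally have "(r + 2) * Re (z * of_real (cmod z powr r) * cnj (w - z))
      \<le> (r + 2) * (cmod z powr (r + 1) * (cmod w - cmod z))"
    using assms by (intro mult_left_mono) auto
  moreover have "cmod z powr (r + 2) + (r + 2) * cmod z powr (r + 2 - 1) * (cmod w - cmod z)
      \<le> cmod w powr (r + 2)"
    using assms by (intro powr_tangent) auto
  moreover have "r + 2 - 1 = r + 1" by simp
  ultimately show ?thesis by (simp only: mult.assoc)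
qed (use assms in auto)

text \<open>The tangent inequality based at \<open>w\<close> becomes an upper bound once the
  gradient at \<open>w\<close> is traded for the gradient at \<open>z\<close>; by the Lipschitz
  estimate the price is quadratic.\<close>

lemma power_term_tangent_upper:
  fixes z w :: complex
  assumes "0 < r" "cmod z \<le> M" "cmod w \<le> M"
  shows "cmod w powr (r + 2) \<le> cmod z powr (r + 2)
    + (r + 2) * Re (z * of_real (cmod z powr r) * cnj (w - z))
    + (r + 2) * (r + 1) * M powr r * (cmod (w - z))\<^sup>2"
proof -
  let ?F = "\<lambda>z. z * of_real (cmod z powr r)"
  have "cmod w powr (r + 2) + (r + 2) * Re (?F w * cnj (z - w)) \<le> cmod z powr (r + 2)"
    using assms by (intro power_term_tangent) auto
  moreover have "Re (?F w * cnj (z - w)) = - Re (?F z * cnj (w - z)) - Re ((?F w - ?F z) * cnj (w - z))"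
    by (simp add: algebra_simps)
  moreover have "Re ((?F w - ?F z) * cnj (w - z)) \<le> (r + 1) * M powr r * (cmod (w - z))\<^sup>2"
  proof -
    have "Re ((?F w - ?F z) * cnj (w - z)) \<le> cmod (?F w - ?F z) * cmod (w - z)"
      using complex_Re_le_cmod[of "(?F w - ?F z) * cnj (w - z)"] unfolding norm_mult complex_mod_cnj .
    also have "\<dots> \<le> (r + 1) * M powr r * cmod (w - z) * cmod (w - z)"
      using assms by (intro mult_right_mono power_term_Lipschitz) auto
    finally show ?thesis by (simp add: power2_eq_square mult.assoc)
  qed
  then have "(r + 2) * Re ((?F w - ?F z) * cnj (w - z)) \<le> (r + 2) * ((r + 1) * M powr r * (cmod (w - z))\<^sup>2)"
    using assms by (intro mult_left_mono) auto
  ultimately show ?thesis by (simp add: algebra_simps)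
qed

text \<open>The linear terms of the two tangent inequalities at the midpoint cancel.\<close>

lemma power_term_midpoint:
  fixes z w :: complex
  assumes "0 \<le> r"
  shows "2 * cmod ((z + w) / 2) powr (r + 2) \<le> cmod z powr (r + 2) + cmod w powr (r + 2)"
proof -
  define m where "m = (z + w) / 2"
  have "Re (m * of_real (cmod m powr r) * cnj (z - m)) + Re (m * of_real (cmod m powr r) * cnj (w - m))
      = Re (m * of_real (cmod m powr r) * cnj ((z - m) + (w - m)))"
    by (simp add: algebra_simps)
  also have "(z - m) + (w - m) = 0" by (simp add: m_def field_simps)
  finally have "(r + 2) * Re (m * of_real (cmod m powr r) * cnj (z - m))
      + (r + 2) * Re (m * of_real (cmod m powr r) * cnj (w - m)) = 0"
    by (simp flip: distrib_left)
  then show ?thesis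
    using power_term_tangent[OF assms, of m z] power_term_tangent[OF assms, of m w]
    unfolding m_def[symmetric] by linarith
qed

text \<open>Up to \<open>K\<close>, both \<open>A\<close> and \<open>- B\<close> equal
  \<open>(Y - X) / (r + 2)\<close>, so the difference of the cross terms,
  \<open>A - B + X - Y\<close>, is an increment plus a quadratic error. Energy conservation rests on
  this: along a solution the increment can be integrated in time.\<close>

lemma power_term_cross:
  fixes z w :: complex
  assumes "0 < r" "cmod z \<le> M" "cmod w \<le> M"
  shows "\<bar>Re (z * of_real (cmod z powr r) * cnj w) - Re (w * of_real (cmod w powr r) * cnj z)
      - (2 / (r + 2) - 1) * (cmod w powr (r + 2) - cmod z powr (r + 2))\<bar>
    \<le> (r + 1) * M powr r * (cmod (w - z))\<^sup>2"
proof -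
  let ?F = "\<lambda>z. z * of_real (cmod z powr r)"
  define A B where "A = Re (?F z * cnj (w - z))" and "B = Re (?F w * cnj (z - w))"
  define X Y K where "X = cmod z powr (r + 2)" and "Y = cmod w powr (r + 2)"
    and "K = (r + 1) * M powr r * (cmod (w - z))\<^sup>2"
  have "Re (?F z * cnj w) = A + X" "Re (?F w * cnj z) = B + Y"
    unfolding A_def B_def X_def Y_def power_term_Re[symmetric] by (simp_all add: algebra_simps)
  moreover have "X + (r + 2) * A \<le> Y" "Y + (r + 2) * B \<le> X"
    unfolding A_def B_def X_def Y_def using assms by (intro power_term_tangent; simp)+
  moreover have "Y \<le> X + (r + 2) * A + (r + 2) * K" "X \<le> Y + (r + 2) * B + (r + 2) * K"
    using power_term_tangent_upper[OF assms] power_term_tangent_upper[OF assms(1,3,2)]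
    unfolding A_def B_def X_def Y_def K_def by (simp_all add: algebra_simps norm_minus_commute)
  ultimately show ?thesis
    unfolding X_def[symmetric] Y_def[symmetric] K_def[symmetric]
    using assms(1) 
    by (simp add: abs_le_iff field_simps)
qed

lemma power_term_diff:
  fixes z w :: complex
  assumes "0 < r" "cmod z \<le> M" "cmod w \<le> M"
  shows "\<bar>cmod w powr (r + 2) - cmod z powr (r + 2)\<bar>
    \<le> (r + 2) * M powr r * (cmod z * cmod (w - z) + (r + 1) * (cmod (w - z))\<^sup>2)"
proof -
  let ?A = "Re (z * of_real (cmod z powr r) * cnj (w - z))"
  have "\<bar>?A\<bar> \<le> cmod z powr r * (cmod z * cmod (w - z))"
    using abs_Re_le_cmod[of "z * of_real (cmod z powr r) * cnj (w - z)"]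
    by (simp add: norm_mult mult_ac flip: complex_cnj_diff)
  also have "\<dots> \<le> M powr r * (cmod z * cmod (w - z))"
    using assms by (intro mult_right_mono powr_mono2) auto
  finally have "(r + 2) * \<bar>?A\<bar> \<le> (r + 2) * (M powr r * (cmod z * cmod (w - z)))"
    using assms by (intro mult_left_mono) auto
  moreover have "\<bar>(r + 2) * ?A\<bar> = (r + 2) * \<bar>?A\<bar>" using assms by (simp add: abs_mult)
  moreover have "0 \<le> (r + 2) * (r + 1) * M powr r * (cmod (w - z))\<^sup>2"
    using assms by (intro mult_nonneg_nonneg) auto
  moreover have "(r + 2) * M powr r * (cmod z * cmod (w - z) + (r + 1) * (cmod (w - z))\<^sup>2)
      = (r + 2) * (M powr r * (cmod z * cmod (w - z))) + (r + 2) * (r + 1) * M powr r * (cmod (w - z))\<^sup>2"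
    by (simp add: algebra_simps)
  moreover have "cmod z powr (r + 2) + (r + 2) * ?A \<le> cmod w powr (r + 2)"
    using assms by (intro power_term_tangent) auto
  ultimately show ?thesis
    using power_term_tangent_upper[OF assms] by linarith
qed

section \<open>The space \<open>H\<^sup>1\<close>: algebra and increments\<close>

lemma h1_fun_zero [simp]: "h1_fun 0 x = 0"
  by transfer simp

lemma h1_fun_add [simp]: "h1_fun (u + v) x = h1_fun u x + h1_fun v x"
  by transfer simp

lemma h1_fun_cscale [simp]: "h1_fun (h1_cscale c u) x = c * h1_fun u x"
  by transfer simp

lemma h1_fun_scaleR [simp]: "h1_fun (r *\<^sub>R u) x = of_real r * h1_fun u x"
  by (simp add: scaleR_h1_def)

lemma h1_fun_diff [simp]: "h1_fun (u - v) x = h1_fun u x - h1_fun v x"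
  by (simp add: minus_h1_def uminus_h1_def)

lemma h1_fun_continuous: "continuous_on A (h1_fun u)"
  using h1_fun[of u] by (auto simp: H1_def intro: continuous_on_subset)

lemma h1_fun_measurable [measurable]: "h1_fun u \<in> borel_measurable borel"
  using h1_fun_L2[of u] by (simp add: L2_def)

lemma h1_deriv_measurable [measurable]: "h1_deriv u \<in> borel_measurable borel"
  using h1_deriv(1)[of u] by (simp add: L2_def)

lemma L2_square_integrable: "f \<in> L2 \<Longrightarrow> integrable lborel (\<lambda>x. (cmod (f x))\<^sup>2)"
  by (simp add: L2_def)

lemma h1_deriv_cscale: "AE x in lborel. h1_deriv (h1_cscale c u) x = c * h1_deriv u x"
proof -
  have "h1_fun (h1_cscale c u) = (\<lambda>x. c * h1_fun u x)" by (simp add: fun_eq_iff)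
  then show ?thesis
    using h1_deriv[of u] by (intro h1_deriv_AE L2_cmult) (simp_all add: weak_deriv_cmult)
qed

lemma h1_deriv_add: "AE x in lborel. h1_deriv (u + v) x = h1_deriv u x + h1_deriv v x"
proof -
  have "h1_fun (u + v) = (\<lambda>x. h1_fun u x + h1_fun v x)" by (simp add: fun_eq_iff)
  then show ?thesis
    using h1_deriv[of u] h1_deriv[of v]
    by (intro h1_deriv_AE L2_add) (simp_all add: weak_deriv_add h1_fun_L2)
qed

lemma norm_h1_square:
  "(norm u)\<^sup>2 = (LINT x|lborel. (cmod (h1_fun u x))\<^sup>2) + (LINT x|lborel. (cmod (h1_deriv u x))\<^sup>2)"
  by (simp add: power2_norm_eq_inner inner_h1_def L2_inner_self)

lemma h1_cscale_diff: "h1_cscale c (u - v) = h1_cscale c u - h1_cscale c v"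
  by (rule h1_fun_inject[THEN iffD1]) (simp add: fun_eq_iff algebra_simps)

lemma h1_cscale_cscale: "h1_cscale c (h1_cscale d u) = h1_cscale (c * d) u"
  by (rule h1_fun_inject[THEN iffD1]) (simp add: fun_eq_iff algebra_simps)

lemma h1_cscale_1 [simp]: "h1_cscale 1 u = u"
  by (rule h1_fun_inject[THEN iffD1]) (simp add: fun_eq_iff algebra_simps)

lemma norm_h1_cscale: "norm (h1_cscale c u) = cmod c * norm u"
proof (rule power2_eq_imp_eq)
  have "(LINT x|lborel. (cmod (h1_deriv (h1_cscale c u) x))\<^sup>2)
      = (LINT x|lborel. (cmod (c * h1_deriv u x))\<^sup>2)"
    using h1_deriv_cscale[of c u] by (intro integral_cong_AE) auto
  then show "(norm (h1_cscale c u))\<^sup>2 = (cmod c * norm u)\<^sup>2"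
    by (simp add: norm_h1_square norm_mult power_mult_distrib distrib_left)
qed auto

section \<open>The fundamental theorem of calculus for functions in H^1\<close>

lemma continuous_support_integrable:
  fixes h :: "real \<Rightarrow> 'a :: {banach, second_countable_topology}"
  assumes "continuous_on UNIV h" "\<And>x. x \<notin> {a..b} \<Longrightarrow> h x = 0"
  shows "integrable lborel h"
proof -
  have "set_integrable lborel {a..b} h"
    using assms(1) by (intro borel_integrable_atLeastAtMost') (auto intro: continuous_on_subset)
  moreover have "(\<lambda>x. indicator {a..b} x *\<^sub>R h x) = h"
    using assms(2) by (auto simp: indicator_def fun_eq_iff)
  ultimately show ?thesis by (simp add: set_integrable_def)
qed

lemma flat_exp_at_top: "(flat_exp \<longlongrightarrow> 1) at_top"
proof (rule Lim_transform_eventually)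
  show "((\<lambda>x::real. exp (- 1 / x)) \<longlongrightarrow> 1) at_top" by real_asymp
  show "\<forall>\<^sub>F x in at_top. exp (- 1 / x) = flat_exp x"
    using eventually_gt_at_top[of 0] by eventually_elim (simp add: flat_exp_def)
qed

text \<open>As \<open>flat_exp\<close> increases from 0 to 1, its derivative is a probability
  density on the positive half-line; rescaled, it is the kernel of an approximate identity.\<close>

lemma flat_exp_deriv:
  obtains f' where "\<And>x. (flat_exp has_real_derivative f' x) (at x)" "continuous_on UNIV f'"
    "\<And>x. 0 \<le> f' x" "\<And>x. x \<le> 0 \<Longrightarrow> f' x = 0" "has_bochner_integral lborel f' 1"
proof -
  obtain D where D: "smooth_jet D" "D 0 = flat_exp" using flat_exp_jet by blast
  have d: "(flat_exp has_real_derivative D 1 x) (at x)" for x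
    using D unfolding smooth_jet_def by (metis One_nat_def)
  have c: "continuous_on UNIV (D 1)"
    using D unfolding smooth_jet_def by (meson DERIV_isCont continuous_at_imp_continuous_on)
  have "mono flat_exp"
    by (rule monoI) (auto simp: flat_exp_def field_simps)
  then have nn: "0 \<le> D 1 x" for x
    by (intro mono_on_imp_deriv_nonneg[of UNIV flat_exp _ x]) (use d in auto)
  have z: "D 1 x = 0" if "x \<le> 0" for x
    by (rule DERIV_local_min[OF d, of 1]) (use that in \<open>auto simp: flat_exp_def\<close>)
  have m: "D 1 \<in> borel_measurable borel"
    using c by (rule borel_measurable_continuous_onI)
  from nn_integral_FTC_atLeast[OF m d nn flat_exp_at_top, of 0]
  have "(\<integral>\<^sup>+x. ennreal (D 1 x) * indicator {0..} x \<partial>lborel) = 1"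
    by (simp add: flat_exp_def)
  also have "(\<integral>\<^sup>+x. ennreal (D 1 x) * indicator {0..} x \<partial>lborel) = (\<integral>\<^sup>+x. ennreal (D 1 x) \<partial>lborel)"
    using z by (intro nn_integral_cong) (auto simp: indicator_def)
  finally have "has_bochner_integral lborel (D 1) 1"
    using m nn by (intro has_bochner_integral_nn_integral) auto
  with d c nn z that show thesis by blast
qed

lemma flat_exp_bounds: "0 \<le> flat_exp x" "flat_exp x \<le> 1"
  by (auto simp: flat_exp_def)

lemma flat_exp_scaled_limit:
  assumes "c > 0"
  shows "(\<lambda>n. flat_exp (real (Suc n) * c - y)) \<longlonglongrightarrow> 1"
proof -
  have lim: "filterlim (\<lambda>n. real (Suc n) * c - y) at_top sequentially"
    using assms by real_asymp
  from filterlim_compose[OF flat_exp_at_top lim] show ?thesis .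
qed

lemma test_function_flat_exp_product:
  assumes "0 < N"
  shows "test_function (\<lambda>x. flat_exp (N * x + - N * a) * flat_exp (- N * x + N * b))" (is "test_function ?\<phi>")
proof -
  obtain D where D: "smooth_jet D" "D 0 = flat_exp" using flat_exp_jet by blast
  define E where "E n x = (\<Sum>k\<le>n. real (n choose k) * (N ^ k * D k (N * x + - N * a))
      * ((- N) ^ (n - k) * D (n - k) (- N * x + N * b)))" for n x
  have "smooth_jet E" unfolding E_def by (intro smooth_jet_mult smooth_jet_affine D)
  moreover have E0: "E 0 = ?\<phi>" by (simp add: E_def D fun_eq_iff)
  moreover have "E 0 x = 0" if "\<bar>x\<bar> > \<bar>a\<bar> + \<bar>b\<bar>" for x
  proof -
    have "x - a \<le> 0 \<or> b - x \<le> 0" using that by auto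
    then have "N * (x - a) \<le> 0 \<or> N * (b - x) \<le> 0" using assms by (auto simp: mult_le_0_iff)
    then show ?thesis by (auto simp: E0 flat_exp_def algebra_simps)
  qed
  ultimately have "test_function (E 0)" by (intro test_function_jet)
  then show ?thesis unfolding E0 .
qed

text \<open>Dominated convergence: the argument of \<open>U\<close> shrinks to 0 and the second
  factor tends to 1. A bound of \<open>U\<close> on \<open>{0..L}\<close> suffices, since the
  integrand vanishes for \<open>y\<close> outside \<open>{0..real (Suc n) * L}\<close>.\<close>

lemma flat_exp_approximate_identity:
  fixes U :: "real \<Rightarrow> complex"
  assumes f': "continuous_on UNIV f'" "\<And>x. 0 \<le> f' x" "\<And>x. x \<le> 0 \<Longrightarrow> f' x = 0"
    "has_bochner_integral lborel f' 1"
    and U: "continuous_on UNIV U" and L: "L > 0"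
  shows "(\<lambda>n. LINT y|lborel. (f' y * flat_exp (real (Suc n) * L - y)) *\<^sub>R U (y / real (Suc n))) \<longlonglongrightarrow> U 0"
proof -
  have "compact (U ` {0..L})" using U by (intro compact_continuous_image) (auto intro: continuous_on_subset)
  then obtain B where B: "\<And>y. y \<in> {0..L} \<Longrightarrow> norm (U y) \<le> B"
    by (meson bounded_iff compact_imp_bounded imageI)
  have [measurable]: "f' \<in> borel_measurable borel" "U \<in> borel_measurable borel" "flat_exp \<in> borel_measurable borel"
    using f' U by (auto intro: borel_measurable_continuous_onI) (simp add: flat_exp_def[abs_def])
  have "(\<lambda>n. LINT y|lborel. (f' y * flat_exp (real (Suc n) * L - y)) *\<^sub>R U (y / real (Suc n)))
      \<longlonglongrightarrow> (LINT y|lborel. f' y *\<^sub>R U 0)"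
  proof (rule integral_dominated_convergence[where w = "\<lambda>y. f' y * B"])
    show "integrable lborel (\<lambda>y. f' y * B)" using f'(4) by (auto simp: has_bochner_integral_iff)
    show "AE y in lborel. (\<lambda>n. (f' y * flat_exp (real (Suc n) * L - y)) *\<^sub>R U (y / real (Suc n)))
        \<longlonglongrightarrow> f' y *\<^sub>R U 0"
    proof (intro always_eventually allI)
      fix y
      have "(\<lambda>n. y / real (Suc n)) \<longlonglongrightarrow> 0"
        by (intro real_tendsto_divide_at_top[OF tendsto_const] filterlim_compose[OF filterlim_real_sequentially filterlim_Suc])
      moreover have "isCont U 0" using U by (simp add: continuous_on_eq_continuous_at)
      ultimately have "(\<lambda>n. U (y / real (Suc n))) \<longlonglongrightarrow> U 0" by (rule isCont_tendsto_compose[rotated])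
      with tendsto_mult[OF tendsto_const flat_exp_scaled_limit[OF L], of "f' y" y]
      show "(\<lambda>n. (f' y * flat_exp (real (Suc n) * L - y)) *\<^sub>R U (y / real (Suc n))) \<longlonglongrightarrow> f' y *\<^sub>R U 0"
        by (intro tendsto_scaleR) auto
    qed
    fix n
    show "AE y in lborel. norm ((f' y * flat_exp (real (Suc n) * L - y)) *\<^sub>R U (y / real (Suc n))) \<le> f' y * B"
    proof (intro always_eventually allI)
      fix y
      consider "y \<le> 0" | "y \<ge> real (Suc n) * L" | "0 < y" "y < real (Suc n) * L" by linarith
      then show "norm ((f' y * flat_exp (real (Suc n) * L - y)) *\<^sub>R U (y / real (Suc n))) \<le> f' y * B"
      proof cases
        case 2
        have "0 \<le> norm (U 0)" by simp
        also have "\<dots> \<le> B" using B[of 0] L by simp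
        finally show ?thesis using 2 f'(2)[of y] by (simp add: flat_exp_def)
      next
        case 3
        then have "norm (U (y / real (Suc n))) \<le> B" by (intro B) (auto simp: field_simps)
        then have "flat_exp (real (Suc n) * L - y) * norm (U (y / real (Suc n))) \<le> 1 * B"
          by (intro mult_mono) (auto simp: flat_exp_bounds)
        then show ?thesis using f'(2)[of y] flat_exp_bounds
          by (simp add: abs_mult mult.assoc mult_left_mono)
      qed (use f'(3) in simp)
    qed
  qed measurable
  moreover have "(LINT y|lborel. f' y *\<^sub>R U 0) = U 0"
    using f'(4) by (simp add: has_bochner_integral_iff)
  ultimately show ?thesis by simp
qed

text \<open>The weak derivative is tested with the smooth functions
  \<open>flat_exp (n (x - a)) * flat_exp (n (b - x))\<close>: they tend to the indicator of \<open>(a, b)\<close>, and the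
  derivative of each factor is an approximate identity at the respective endpoint.\<close>

lemma weak_deriv_increment:
  assumes u: "continuous_on UNIV u" and g: "g \<in> L2" and wd: "weak_deriv u g" and "a \<le> b"
  shows "u b - u a = (LINT x:{a<..b}|lborel. g x)"
proof (cases "a = b")
  case False
  then have ab: "a < b" using \<open>a \<le> b\<close> by simp
  obtain f' where f': "\<And>x. (flat_exp has_real_derivative f' x) (at x)" "continuous_on UNIV f'"
    "\<And>x. 0 \<le> f' x" "\<And>x. x \<le> 0 \<Longrightarrow> f' x = 0" "has_bochner_integral lborel f' 1"
    using flat_exp_deriv by blast
  define N where "N n = real (Suc n)" for n
  have N: "N n > 0" for n by (simp add: N_def)
  define \<phi> where "\<phi> n x = flat_exp (N n * x + - N n * a) * flat_exp (- N n * x + N n * b)" for n x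
  have T: "test_function (\<phi> n)" for n
    unfolding \<phi>_def by (rule test_function_flat_exp_product[OF N])
  have fe_cont: "continuous_on UNIV flat_exp"
    using f'(1) by (meson DERIV_isCont continuous_at_imp_continuous_on)
  have [measurable]: "flat_exp \<in> borel_measurable borel" "g \<in> borel_measurable borel"
    using fe_cont g by (auto intro: borel_measurable_continuous_onI simp: L2_def)
  define P Q where "P n x = (N n * (f' (N n * (x - a)) * flat_exp (N n * (b - x)))) *\<^sub>R u x"
    and "Q n x = (N n * (flat_exp (N n * (x - a)) * f' (N n * (b - x)))) *\<^sub>R u x" for n x
  have deriv: "deriv (\<phi> n) x *\<^sub>R u x = P n x - Q n x" for n x
  proof -
    have "((\<lambda>x. flat_exp (N n * x + - N n * a) * flat_exp (- N n * x + N n * b)) has_real_derivative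
      f' (N n * x + - N n * a) * N n * flat_exp (- N n * x + N n * b)
        + f' (- N n * x + N n * b) * (- N n) * flat_exp (N n * x + - N n * a)) (at x)"
      by (intro DERIV_mult DERIV_chain2[OF f'(1)]) (auto intro!: derivative_eq_intros)
    then have "deriv (\<phi> n) x = f' (N n * x + - N n * a) * N n * flat_exp (- N n * x + N n * b)
        + f' (- N n * x + N n * b) * (- N n) * flat_exp (N n * x + - N n * a)"
      unfolding \<phi>_def by (rule DERIV_imp_deriv)
    then have "deriv (\<phi> n) x = N n * (f' (N n * (x - a)) * flat_exp (N n * (b - x)))
        - N n * (flat_exp (N n * (x - a)) * f' (N n * (b - x)))"
      by (simp add: algebra_simps)
    then show ?thesis by (simp only: P_def Q_def scaleR_diff_left)
  qed
  have out: "f' (N n * y) = 0" "flat_exp (N n * y) = 0" if "y \<le> 0" for n y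
    using that N[of n] f'(4)[of "N n * y"] by (auto simp: flat_exp_def mult_le_0_iff not_less zero_less_mult_iff)
  have contP: "continuous_on UNIV (P n)" "continuous_on UNIV (Q n)" for n
    unfolding P_def Q_def
    by (intro continuous_intros u continuous_on_compose2[OF f'(2)] continuous_on_compose2[OF fe_cont]; simp)+
  have int: "integrable lborel (P n)" "integrable lborel (Q n)" for n
    by (intro continuous_support_integrable[of _ a b] contP; force simp: P_def Q_def out)+
  \<comment> \<open>\<open>u (a + 0)\<close> is the value at 0 of
    \<open>\<lambda>y. u (a + y)\<close>, to which the approximate identity applies after the
    substitution \<open>x = a + y / N n\<close>. At \<open>b\<close> the substitution is
    reflected.\<close>
  have P: "(\<lambda>n. integral\<^sup>L lborel (P n)) \<longlonglongrightarrow> u (a + 0)"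
  proof -
    have "integral\<^sup>L lborel (P n) = (LINT y|lborel. (f' y * flat_exp (real (Suc n) * (b - a) - y)) *\<^sub>R u (a + y / real (Suc n)))" for n
    proof -
      have "integral\<^sup>L lborel (P n) = \<bar>1 / N n\<bar> *\<^sub>R (LINT y|lborel. P n (a + 1 / N n * y))"
        using N[of n] by (intro lborel_integral_real_affine) auto
      also have "\<dots> = (LINT y|lborel. (1 / N n) *\<^sub>R P n (a + 1 / N n * y))"
        using N[of n] by simp
      also have "\<dots> = (LINT y|lborel. (f' y * flat_exp (N n * (b - a) - y)) *\<^sub>R u (a + y / N n))"
      proof (intro Bochner_Integration.integral_cong refl)
        fix y
        have "N n * (a + 1 / N n * y - a) = y" "N n * (b - (a + 1 / N n * y)) = N n * (b - a) - y"
          "a + 1 / N n * y = a + y / N n"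
          using N[of n] by (simp_all add: algebra_simps)
        then show "(1 / N n) *\<^sub>R P n (a + 1 / N n * y) = (f' y * flat_exp (N n * (b - a) - y)) *\<^sub>R u (a + y / N n)"
          unfolding P_def using N[of n] by simp
      qed
      finally show ?thesis by (simp only: N_def)
    qed
    then show ?thesis
      by (simp only:) (rule flat_exp_approximate_identity[OF f'(2-5)],
         use ab in \<open>auto intro!: continuous_intros continuous_on_compose2[OF u]\<close>)
  qed
  have Q: "(\<lambda>n. integral\<^sup>L lborel (Q n)) \<longlonglongrightarrow> u (b - 0)"
  proof -
    have "integral\<^sup>L lborel (Q n) = (LINT y|lborel. (f' y * flat_exp (real (Suc n) * (b - a) - y)) *\<^sub>R u (b - y / real (Suc n)))" for n
    proof -
      have "integral\<^sup>L lborel (Q n) = \<bar>- (1 / N n)\<bar> *\<^sub>R (LINT y|lborel. Q n (b + - (1 / N n) * y))"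
        using N[of n] by (intro lborel_integral_real_affine) auto
      also have "\<dots> = (LINT y|lborel. (1 / N n) *\<^sub>R Q n (b + - (1 / N n) * y))"
        using N[of n] by simp
      also have "\<dots> = (LINT y|lborel. (f' y * flat_exp (N n * (b - a) - y)) *\<^sub>R u (b - y / N n))"
      proof (intro Bochner_Integration.integral_cong refl)
        fix y
        have "N n * (b + - (1 / N n) * y - a) = N n * (b - a) - y" "N n * (b - (b + - (1 / N n) * y)) = y"
          "b + - (1 / N n) * y = b - y / N n"
          using N[of n] by (simp_all add: algebra_simps)
        then show "(1 / N n) *\<^sub>R Q n (b + - (1 / N n) * y) = (f' y * flat_exp (N n * (b - a) - y)) *\<^sub>R u (b - y / N n)"
          unfolding Q_def using N[of n] by (simp add: mult.commute)
      qed
      finally show ?thesis by (simp only: N_def)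
    qed
    then show ?thesis
      by (simp only:) (rule flat_exp_approximate_identity[OF f'(2-5)],
         use ab in \<open>auto intro!: continuous_intros continuous_on_compose2[OF u]\<close>)
  qed
  have "(\<lambda>n. LINT x|lborel. \<phi> n x *\<^sub>R g x) \<longlonglongrightarrow> (LINT x|lborel. indicator {a<..<b} x *\<^sub>R g x)"
  proof (rule integral_dominated_convergence)
    show "integrable lborel (\<lambda>x. norm (indicator {a<..<b} x *\<^sub>R g x))"
      using L2_set_integrable[OF g, of "{a<..<b}"]
      by (intro integrable_norm) (simp add: set_integrable_def)
    have \<phi>_out: "\<phi> n x = 0" if "x \<notin> {a<..<b}" for n x
      using that out(2)[of "x - a" n] out(2)[of "b - x" n] by (auto simp: \<phi>_def algebra_simps)
    show "AE x in lborel. (\<lambda>n. \<phi> n x *\<^sub>R g x) \<longlonglongrightarrow> indicator {a<..<b} x *\<^sub>R g x"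
    proof (intro always_eventually allI tendsto_scaleR tendsto_const)
      fix x show "(\<lambda>n. \<phi> n x) \<longlonglongrightarrow> indicator {a<..<b} x"
      proof (cases "x \<in> {a<..<b}")
        case True
        from tendsto_mult[OF flat_exp_scaled_limit[of "x - a" 0] flat_exp_scaled_limit[of "b - x" 0]] True
        show ?thesis by (simp add: \<phi>_def N_def algebra_simps)
      qed (use \<phi>_out in simp)
    qed
    fix n
    show "AE x in lborel. norm (\<phi> n x *\<^sub>R g x) \<le> norm (indicator {a<..<b} x *\<^sub>R g x)"
    proof (intro always_eventually allI)
      fix x
      have "\<bar>\<phi> n x\<bar> \<le> indicator {a<..<b} x"
        using \<phi>_out[of x n] flat_exp_bounds by (auto simp: indicator_def \<phi>_def abs_mult intro!: mult_le_one)
      then show "norm (\<phi> n x *\<^sub>R g x) \<le> norm (indicator {a<..<b} x *\<^sub>R g x)"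
        by (auto intro!: mult_right_mono)
    qed
  qed (unfold \<phi>_def, measurable)
  then have "(\<lambda>n. - (LINT x|lborel. \<phi> n x *\<^sub>R g x)) \<longlonglongrightarrow> - (LINT x|lborel. indicator {a<..<b} x *\<^sub>R g x)"
    by (rule tendsto_minus)
  moreover have "- (LINT x|lborel. \<phi> n x *\<^sub>R g x) = integral\<^sup>L lborel (P n) - integral\<^sup>L lborel (Q n)" for n
    using wd[unfolded weak_deriv_def, rule_format, OF T[of n]]
      Bochner_Integration.integral_diff[OF int[of n]] by (simp add: deriv)
  ultimately have "u (a + 0) - u (b - 0) = - (LINT x|lborel. indicator {a<..<b} x *\<^sub>R g x)"
    using tendsto_diff[OF P Q] by (simp add: LIMSEQ_unique)
  also have "(LINT x|lborel. indicator {a<..<b} x *\<^sub>R g x) = (LINT x|lborel. indicator {a<..b} x *\<^sub>R g x)"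
  proof (rule integral_cong_AE)
    show "AE x in lborel. indicator {a<..<b} x *\<^sub>R g x = indicator {a<..b} x *\<^sub>R g x"
      using AE_lborel_singleton[of b]
      by eventually_elim (auto simp: indicator_def)
  qed auto
  finally show ?thesis by (simp add: set_lebesgue_integral_def algebra_simps)
qed (simp add: set_lebesgue_integral_def)

section \<open>Calibrations and the sup bound\<close>

lemma set_integrable_subset_lborel:
  fixes f :: "real \<Rightarrow> 'a :: {banach, second_countable_topology}"
  shows "integrable lborel f \<Longrightarrow> A \<in> sets borel \<Longrightarrow> set_integrable lborel A f"
  using integrable_mult_indicator[of A lborel f] by (simp add: set_integrable_def)

lemma set_integral_Ioc_combine:
  fixes k :: "real \<Rightarrow> 'a :: {banach, second_countable_topology}"
  assumes "integrable lborel k" "a \<le> b" "b \<le> c"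
  shows "(LINT x:{a<..c}|lborel. k x) = (LINT x:{a<..b}|lborel. k x) + (LINT x:{b<..c}|lborel. k x)"
proof -
  have "{a<..c} = {a<..b} \<union> {b<..c}" using assms by auto
  then show ?thesis
    using assms by (simp add: set_integral_Un set_integrable_subset_lborel)
qed

lemma set_integral_Ioc_const:
  "(x::real) \<le> y \<Longrightarrow> (LINT s:{x<..y}|lborel. c) = (y - x) * (c::real)"
  by (simp add: set_lebesgue_integral_def)

lemma Ioc_set_integrable_const: "set_integrable lborel {x<..y::real} (\<lambda>_. c::real)"
  by (rule set_integrable_subset[of _ "{x..y}"]) (auto intro!: borel_integrable_atLeastAtMost')

lemma h1_increment_bound:
  assumes "x \<le> y"
  shows "cmod (h1_fun u y - h1_fun u x) \<le> (LINT s:{x<..y}|lborel. cmod (h1_deriv u s))"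
proof -
  have "h1_fun u y - h1_fun u x = (LINT s:{x<..y}|lborel. h1_deriv u s)"
    using assms by (intro weak_deriv_increment h1_fun_continuous h1_deriv)
  then show ?thesis
    using set_integral_norm_bound[OF L2_set_integrable[OF h1_deriv(1)], of "{x<..y}"] by simp
qed

text \<open>Since |u|^2 is integrable, |u| cannot stay above \<open>d\<close> on an interval of
  length greater than \<open>I / d\<^sup>2\<close>. Such points on both sides of \<open>x\<close>
  replace limits at infinity.\<close>

lemma h1_small_value:
  assumes "0 < d"
  obtains y y' where "x \<le> y" "cmod (h1_fun u y) < d" "y' \<le> x" "cmod (h1_fun u y') < d"
proof -
  define I where "I = (LINT s|lborel. (cmod (h1_fun u s))\<^sup>2)"
  obtain m :: nat where m: "real m > I / d\<^sup>2" using reals_Archimedean2 by blast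
  have ex: "\<exists>y\<in>{a<..a + real m}. cmod (h1_fun u y) < d" for a
  proof (rule ccontr)
    assume "\<not> ?thesis"
    then have ge: "d \<le> cmod (h1_fun u y)" if "y \<in> {a<..a + real m}" for y
      using that by force
    have "real m * d\<^sup>2 = (LINT s:{a<..a + real m}|lborel. d\<^sup>2)"
      by (subst set_integral_Ioc_const) auto
    also have "\<dots> \<le> (LINT s|lborel. (cmod (h1_fun u s))\<^sup>2)"
      unfolding set_lebesgue_integral_def
      using L2_square_integrable[OF h1_fun_L2[of u]] assms
        Ioc_set_integrable_const[of a "a + real m" "d\<^sup>2", unfolded set_integrable_def]
      by (intro integral_mono) (auto simp: indicator_def intro!: power_mono ge)
    finally have "real m * d\<^sup>2 \<le> I" by (simp add: I_def)
    then show False using m assms by (simp add: field_simps)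
  qed
  obtain y y' where "y \<in> {x<..x + real m}" "cmod (h1_fun u y) < d"
    "y' \<in> {x - real m<..x - real m + real m}" "cmod (h1_fun u y') < d"
    using ex by blast
  then show thesis by (intro that[of y y']) auto
qed

text \<open>Young's inequality bounds \<rho>(|u|) |u'| by the density below, and the left-hand side
  dominates the variation of \<open>P\<close> along |u|. It is used twice: with \<open>P\<close>
  quadratic for the sup bound, and with the potential of the action.\<close>

locale calibration =
  fixes P \<rho> :: "real \<Rightarrow> real"
  assumes P_cont: "continuous_on {0..} P"
    and P_deriv: "\<And>s. 0 < s \<Longrightarrow> (P has_real_derivative \<rho> s) (at s)"
    and \<rho>_cont: "continuous_on {0..} \<rho>"
    and \<rho>_nonneg: "\<And>s. 0 \<le> s \<Longrightarrow> 0 \<le> \<rho> s"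
begin

definition density :: "h1 \<Rightarrow> real \<Rightarrow> real" where
  "density u x = (cmod (h1_deriv u x))\<^sup>2 / 2 + (\<rho> (cmod (h1_fun u x)))\<^sup>2 / 2"

lemma density_nonneg: "0 \<le> density u x"
  by (simp add: density_def)

text \<open>On a short interval the mean value theorem for \<open>P\<close> and Young's inequality give the bound up
  to \<open>\<epsilon> * (b - a)\<close>. This form is additive over intervals, so that no chain rule
  for \<open>P (cmod u)\<close> is needed.\<close>

lemma increment:
  assumes int: "integrable lborel (density u)" and "a \<le> b"
  shows "\<bar>P (cmod (h1_fun u a)) - P (cmod (h1_fun u b))\<bar> \<le> (LINT s:{a<..b}|lborel. density u s)"
proof -
  let ?v = "\<lambda>s. cmod (h1_fun u s)"
  define h where "h s = (\<rho> (?v s))\<^sup>2 / 2" for s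
  have v_cont: "continuous_on A ?v" for A by (intro continuous_intros h1_fun_continuous)
  have h_cont: "continuous_on UNIV h"
    unfolding h_def
    by (intro continuous_intros continuous_on_compose2[OF \<rho>_cont] v_cont) auto
  have "\<bar>P (?v a) - P (?v b)\<bar> \<le> (LINT s:{a<..b}|lborel. density u s) + \<epsilon> * (b - a)" if "0 < \<epsilon>" for \<epsilon>
    using \<open>a \<le> b\<close>
  proof (induction rule: Bolzano)
    case (trans a b c)
    then show ?case
      using set_integral_Ioc_combine[OF int, of a b c] by (simp add: algebra_simps)
  next
    case (local x)
    have "isCont h x" using h_cont by (simp add: continuous_on_eq_continuous_at)
    then obtain d where d: "0 < d" "\<And>s. \<bar>s - x\<bar> < d \<Longrightarrow> \<bar>h s - h x\<bar> < \<epsilon> / 2"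
      using \<open>0 < \<epsilon>\<close> unfolding continuous_at_eps_delta dist_real_def
      by (metis half_gt_zero)
    have "\<bar>P (?v a) - P (?v b)\<bar> \<le> (LINT s:{a<..b}|lborel. density u s) + \<epsilon> * (b - a)"
      if ab: "a \<le> x" "x \<le> b" "b - a < d" for a b
    proof -
      have close: "h c \<le> h s + \<epsilon>" if "c \<in> {a..b}" "s \<in> {a..b}" for c s
      proof -
        have "\<bar>h c - h x\<bar> < \<epsilon> / 2" "\<bar>h s - h x\<bar> < \<epsilon> / 2"
          using that ab by (intro d(2); auto)+
        then show ?thesis by linarith
      qed
      have dens: "set_integrable lborel {a<..b} (density u)"
        using int by (intro set_integrable_subset_lborel) auto
      have est: "\<bar>P (?v a) - P (?v b)\<bar> \<le> \<rho> \<xi> * cmod (h1_fun u b - h1_fun u a)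
          \<Longrightarrow> \<xi> = ?v c \<Longrightarrow> c \<in> {a..b} \<Longrightarrow> ?thesis" for \<xi> c
      proof -
        assume A: "\<bar>P (?v a) - P (?v b)\<bar> \<le> \<rho> \<xi> * cmod (h1_fun u b - h1_fun u a)"
          and c: "\<xi> = ?v c" "c \<in> {a..b}"
        have "0 \<le> \<rho> \<xi>" using c by (intro \<rho>_nonneg) auto
        have "\<rho> \<xi> * cmod (h1_fun u b - h1_fun u a)
            \<le> \<rho> \<xi> * (LINT s:{a<..b}|lborel. cmod (h1_deriv u s))"
          using ab \<open>0 \<le> \<rho> \<xi>\<close> by (intro mult_left_mono h1_increment_bound) auto
        also have "\<dots> = (LINT s:{a<..b}|lborel. \<rho> \<xi> * cmod (h1_deriv u s))" by simp
        also have "\<dots> \<le> (LINT s:{a<..b}|lborel. density u s + \<epsilon>)"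
        proof (rule set_integral_mono)
          show "set_integrable lborel {a<..b} (\<lambda>s. \<rho> \<xi> * cmod (h1_deriv u s))"
            by (intro set_integrable_mult_right set_integrable_norm L2_set_integrable h1_deriv) auto
          show "set_integrable lborel {a<..b} (\<lambda>s. density u s + \<epsilon>)"
            by (intro set_integral_add dens Ioc_set_integrable_const)
          fix s assume s: "s \<in> {a<..b}"
          have "\<rho> \<xi> * cmod (h1_deriv u s) \<le> (cmod (h1_deriv u s))\<^sup>2 / 2 + h c"
            using sum_squares_bound[of "\<rho> \<xi>" "cmod (h1_deriv u s)"] by (simp add: h_def c)
          also have "h c \<le> h s + \<epsilon>" using c s by (intro close) auto
          finally show "\<rho> \<xi> * cmod (h1_deriv u s) \<le> density u s + \<epsilon>"
            by (simp add: density_def h_def)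
        qed
        also have "\<dots> = (LINT s:{a<..b}|lborel. density u s) + \<epsilon> * (b - a)"
          using ab by (subst set_integral_add(2)[OF dens Ioc_set_integrable_const])
            (simp add: set_integral_Ioc_const)
        finally show ?thesis using A by simp
      qed
      define lo hi where "lo = min (?v a) (?v b)" and "hi = max (?v a) (?v b)"
      have lohi: "0 \<le> lo" "hi - lo \<le> cmod (h1_fun u b - h1_fun u a)"
        "\<bar>P (?v a) - P (?v b)\<bar> = \<bar>P hi - P lo\<bar>"
        using norm_triangle_ineq2[of "h1_fun u b" "h1_fun u a"]
          norm_triangle_ineq2[of "h1_fun u a" "h1_fun u b"]
        by (auto simp: lo_def hi_def min_def max_def norm_minus_commute)
      show ?thesis
      proof (cases "lo < hi")
        case False
        then have "?v a = ?v b" by (auto simp: lo_def hi_def min_def max_def split: if_splits)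
        then show ?thesis using est[of "?v a" a] ab \<rho>_nonneg[of "?v a"] by simp
      next
        case True
        obtain l \<xi> where \<xi>: "lo < \<xi>" "\<xi> < hi" "(P has_real_derivative l) (at \<xi>)" "P hi - P lo = (hi - lo) * l"
        proof (rule MVT[OF True, of P, elim_format])
          show "continuous_on {lo..hi} P" using P_cont lohi by (auto elim: continuous_on_subset)
          show "P differentiable (at s)" if "lo < s" "s < hi" for s
            using P_deriv[of s] that lohi by (auto simp: real_differentiable_def)
        qed (use that in blast)
        have l: "l = \<rho> \<xi>" using DERIV_unique[OF \<xi>(3) P_deriv] \<xi>(1) lohi(1) by simp
        \<comment> \<open>The mean value point lies between the values of |u| at the two ends, hence
          is itself a value |u(c)|. This lets the continuity of \<open>h\<close> compare
          \<open>\<rho> \<xi>\<close> with \<rho>(|u|) on the whole interval.\<close>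
        have "\<exists>c. a \<le> c \<and> c \<le> b \<and> ?v c = \<xi>"
        proof (cases "?v a \<le> ?v b")
          case True
          then show ?thesis using \<xi> ab v_cont by (intro IVT') (auto simp: lo_def hi_def)
        next
          case False
          then show ?thesis using \<xi> ab v_cont by (intro IVT2') (auto simp: lo_def hi_def)
        qed
        then obtain c where c: "c \<in> {a..b}" "\<xi> = ?v c" by auto
        have "0 \<le> \<rho> \<xi>" using c by (intro \<rho>_nonneg) auto
        then have "\<bar>P hi - P lo\<bar> = \<rho> \<xi> * (hi - lo)" using \<xi>(4) True l by (simp add: abs_mult)
        also have "\<dots> \<le> \<rho> \<xi> * cmod (h1_fun u b - h1_fun u a)"
          using \<open>0 \<le> \<rho> \<xi>\<close> lohi by (intro mult_left_mono)
        finally show ?thesis using est[OF _ c(2,1)] lohi by simp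
      qed
    qed
    then show ?case using d(1) by blast
  qed
  note * = this
  show ?thesis
  proof (cases "a = b")
    case False
    then have "a < b" using \<open>a \<le> b\<close> by simp
    show ?thesis
    proof (rule field_le_epsilon)
      fix e :: real assume "0 < e"
      then show "\<bar>P (?v a) - P (?v b)\<bar> \<le> (LINT s:{a<..b}|lborel. density u s) + e"
        using *[of "e / (b - a)"] \<open>a < b\<close> by simp
    qed
  qed (simp add: set_lebesgue_integral_def)
qed

text \<open>The factor 2 arises because |u| has to climb from almost 0 to its value at
  \<open>x\<close> from the left and from the right, and the two intervals are disjoint.\<close>

lemma lower_bound:
  assumes int: "integrable lborel (density u)"
  shows "2 * (P (cmod (h1_fun u x)) - P 0) \<le> (LINT s|lborel. density u s)"
proof (rule field_le_epsilon)
  fix e :: real assume "0 < e"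
  obtain d where d: "0 < d" "\<And>s. 0 \<le> s \<Longrightarrow> s < d \<Longrightarrow> \<bar>P s - P 0\<bar> < e / 2"
    using P_cont[unfolded continuous_on_iff, rule_format, of 0 "e / 2"] \<open>0 < e\<close>
    by (auto simp: dist_real_def)
  obtain y y' where y: "x \<le> y" "cmod (h1_fun u y) < d" "y' \<le> x" "cmod (h1_fun u y') < d"
    using h1_small_value[OF d(1)] by metis
  have "2 * P (cmod (h1_fun u x)) - P (cmod (h1_fun u y)) - P (cmod (h1_fun u y'))
      \<le> (LINT s:{y'<..x}|lborel. density u s) + (LINT s:{x<..y}|lborel. density u s)"
    using increment[OF int y(1)] increment[OF int y(3)] by (simp add: abs_le_iff)
  also have "\<dots> = (LINT s:{y'<..y}|lborel. density u s)"
    using set_integral_Ioc_combine[OF int y(3,1)] by simp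
  also have "\<dots> \<le> (LINT s|lborel. density u s)"
    unfolding set_lebesgue_integral_def
    using int set_integrable_subset_lborel[OF int, of "{y'<..y}"]
    by (intro integral_mono) (auto simp: set_integrable_def density_nonneg indicator_def)
  finally have "2 * P (cmod (h1_fun u x)) - P (cmod (h1_fun u y)) - P (cmod (h1_fun u y'))
      \<le> (LINT s|lborel. density u s)" .
  moreover have "\<bar>P (cmod (h1_fun u y)) - P 0\<bar> < e / 2" "\<bar>P (cmod (h1_fun u y')) - P 0\<bar> < e / 2"
    using y by (intro d(2); simp)+
  ultimately show "2 * (P (cmod (h1_fun u x)) - P 0) \<le> (LINT s|lborel. density u s) + e"
    by argo
qed

end

text \<open>The calibration with \<open>\<rho> s = s\<close>: its density integrates to half the
  squared norm.\<close>

lemma h1_sup_bound: "cmod (h1_fun u x) \<le> norm u"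
proof (rule power2_le_imp_le)
  interpret calibration "\<lambda>s. s\<^sup>2 / 2" "\<lambda>s. s"
    by unfold_locales (auto intro!: continuous_intros derivative_eq_intros)
  have "density u = (\<lambda>x. (cmod (h1_deriv u x))\<^sup>2 / 2 + (cmod (h1_fun u x))\<^sup>2 / 2)"
    by (simp add: density_def fun_eq_iff)
  moreover have "integrable lborel (\<lambda>x. (cmod (h1_deriv u x))\<^sup>2)" "integrable lborel (\<lambda>x. (cmod (h1_fun u x))\<^sup>2)"
    by (intro L2_square_integrable h1_deriv h1_fun_L2)+
  ultimately have "integrable lborel (density u)" "(LINT s|lborel. density u s) = (norm u)\<^sup>2 / 2"
    by (simp_all add: norm_h1_square add_divide_distrib)
  with lower_bound[of u x] have "(cmod (h1_fun u x))\<^sup>2 \<le> (norm u)\<^sup>2 / 2" by simp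
  then show "(cmod (h1_fun u x))\<^sup>2 \<le> (norm u)\<^sup>2" by (smt (verit) field_sum_of_halves zero_le_power2)
qed simp

section \<open>Bilinear forms and power integrals\<close>

lemma L2_inner_eq_integral:
  "f \<in> L2 \<Longrightarrow> g \<in> L2 \<Longrightarrow> L2_inner f g = (LINT x|lborel. Re (f x * cnj (g x)))"
  unfolding L2_inner_def by (intro integral_Re[symmetric] L2_mult_integrable L2_cnj)

lemma L2_inner_eq_0:
  assumes "f \<in> L2" "g \<in> L2" "AE x in lborel. Re (f x * cnj (g x)) = 0"
  shows "L2_inner f g = 0"
  using assms by (simp add: L2_inner_eq_integral integral_eq_zero_AE)

lemma h1_product_integrable: "integrable lborel (\<lambda>x. cmod (h1_fun u x) * cmod (h1_fun v x))"
  using integrable_norm[OF L2_mult_integrable[OF h1_fun_L2[of u] h1_fun_L2[of v]]]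
  by (simp add: norm_mult)

lemma h1_product_integral_le:
  "(LINT x|lborel. cmod (h1_fun u x) * cmod (h1_fun v x)) \<le> norm u * norm v"
proof (cases "u = 0 \<or> v = 0")
  case False
  \<comment> \<open>The weight for which both terms of Young's inequality become
    \<open>norm u * norm v\<close>.\<close>
  define t where "t = norm v / norm u"
  have t: "0 < t" using False by (simp add: t_def)
  have sq: "integrable lborel (\<lambda>x. (cmod (h1_fun w x))\<^sup>2)" for w
    by (intro L2_square_integrable h1_fun_L2)
  have le: "(LINT x|lborel. (cmod (h1_fun w x))\<^sup>2) \<le> (norm w)\<^sup>2" for w
    by (simp add: norm_h1_square)
  have "2 * (LINT x|lborel. cmod (h1_fun u x) * cmod (h1_fun v x))
      = (LINT x|lborel. 2 * (cmod (h1_fun u x) * cmod (h1_fun v x)))" by simp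
  also have "\<dots> \<le> (LINT x|lborel. t * (cmod (h1_fun u x))\<^sup>2 + (cmod (h1_fun v x))\<^sup>2 / t)"
  proof (rule integral_mono)
    fix x
    have "0 \<le> (t * cmod (h1_fun u x) - cmod (h1_fun v x))\<^sup>2 / t" using t by simp
    also have "\<dots> = t * (cmod (h1_fun u x))\<^sup>2 + (cmod (h1_fun v x))\<^sup>2 / t
        - 2 * (cmod (h1_fun u x) * cmod (h1_fun v x))"
      using t by (simp add: power2_diff field_simps power2_eq_square)
    finally show "2 * (cmod (h1_fun u x) * cmod (h1_fun v x))
        \<le> t * (cmod (h1_fun u x))\<^sup>2 + (cmod (h1_fun v x))\<^sup>2 / t" by simp
  qed (use sq in \<open>auto intro: h1_product_integrable\<close>)
  also have "\<dots> = t * (LINT x|lborel. (cmod (h1_fun u x))\<^sup>2) + (LINT x|lborel. (cmod (h1_fun v x))\<^sup>2) / t"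
    using sq by simp
  also have "\<dots> \<le> t * (norm u)\<^sup>2 + (norm v)\<^sup>2 / t"
    using t le by (intro add_mono mult_left_mono divide_right_mono) auto
  also have "\<dots> = 2 * (norm u * norm v)"
    using False by (simp add: t_def field_simps power2_eq_square)
  finally show ?thesis by simp
qed auto

lemma bounded_bilinear_L2_inner: "bounded_bilinear (\<lambda>u v. L2_inner (h1_fun u) (h1_fun v))"
proof
  fix u u' v v' :: h1 and r :: real
  show add: "L2_inner (h1_fun (u + u')) (h1_fun v) = L2_inner (h1_fun u) (h1_fun v) + L2_inner (h1_fun u') (h1_fun v)"
    for u u' v
    using L2_inner_add[OF h1_fun_L2 h1_fun_L2 h1_fun_L2, of u u' v]
    by (simp add: L2_inner_def)
  show scale: "L2_inner (h1_fun (r *\<^sub>R u)) (h1_fun v) = r *\<^sub>R L2_inner (h1_fun u) (h1_fun v)" for u v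
    using L2_inner_scale[of r "h1_fun u" "h1_fun v"] by (simp add: L2_inner_def)
  show "L2_inner (h1_fun u) (h1_fun (v + v')) = L2_inner (h1_fun u) (h1_fun v) + L2_inner (h1_fun u) (h1_fun v')"
    using add[of v v' u] by (simp add: L2_inner_commute)
  show "L2_inner (h1_fun u) (h1_fun (r *\<^sub>R v)) = r *\<^sub>R L2_inner (h1_fun u) (h1_fun v)"
    using scale[of v u] by (simp add: L2_inner_commute)
  have "norm (L2_inner (h1_fun u) (h1_fun v)) \<le> norm u * norm v * 1" for u v
  proof -
    have "\<bar>LINT x|lborel. Re (h1_fun u x * cnj (h1_fun v x))\<bar>
        \<le> (LINT x|lborel. \<bar>Re (h1_fun u x * cnj (h1_fun v x))\<bar>)"
      by (rule integral_abs_bound)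
    also have "\<dots> \<le> (LINT x|lborel. cmod (h1_fun u x) * cmod (h1_fun v x))"
    proof (intro integral_mono integrable_abs L2_inner_integrable h1_fun_L2 h1_product_integrable)
      show "\<bar>Re (h1_fun u x * cnj (h1_fun v x))\<bar> \<le> cmod (h1_fun u x) * cmod (h1_fun v x)" for x
        using abs_Re_le_cmod[of "h1_fun u x * cnj (h1_fun v x)"] by (simp add: norm_mult)
    qed
    also note h1_product_integral_le
    finally show ?thesis by (simp add: L2_inner_eq_integral h1_fun_L2)
  qed
  then show "\<exists>K. \<forall>u v. norm (L2_inner (h1_fun u) (h1_fun v)) \<le> norm u * norm v * K" by blast
qed

lemma h1_embed_diff: "h1_embed (u - v) = h1_embed u - h1_embed v"
  by (rule blinfun_eqI)
    (simp add: h1_embed.rep_eq minus_blinfun.rep_eq bounded_bilinear.diff_left[OF bounded_bilinear_L2_inner])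

lemma h1_value_product_bound: "\<bar>Re (h1_fun u x * cnj (h1_fun v x))\<bar> \<le> norm u * norm v"
proof -
  have "\<bar>Re (h1_fun u x * cnj (h1_fun v x))\<bar> \<le> cmod (h1_fun u x) * cmod (h1_fun v x)"
    using abs_Re_le_cmod[of "h1_fun u x * cnj (h1_fun v x)"] by (simp add: norm_mult)
  also have "\<dots> \<le> norm u * norm v" by (intro mult_mono h1_sup_bound) auto
  finally show ?thesis .
qed

text \<open>The form differs from the H^1 inner product by an L^2 pairing and the point term; the
  latter is bounded by the sup bound.\<close>

lemma bounded_bilinear_delta_form: "bounded_bilinear (delta_form Z)"
proof -
  have eq: "delta_form Z u v = inner u v - L2_inner (h1_fun u) (h1_fun v) - Z * Re (h1_fun u 0 * cnj (h1_fun v 0))"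
    for u v by (simp add: delta_form_def inner_h1_def)
  interpret L: bounded_bilinear "\<lambda>u v. L2_inner (h1_fun u) (h1_fun v)" by (rule bounded_bilinear_L2_inner)
  show ?thesis
  proof
    obtain K where K: "\<And>u v. norm (L2_inner (h1_fun u) (h1_fun v)) \<le> norm u * norm v * K"
      using L.bounded by blast
    have "norm (delta_form Z u v) \<le> norm u * norm v * (1 + K + \<bar>Z\<bar>)" for u v
    proof -
      have "\<bar>Z * Re (h1_fun u 0 * cnj (h1_fun v 0))\<bar> \<le> \<bar>Z\<bar> * (norm u * norm v)"
        unfolding abs_mult by (intro mult_left_mono h1_value_product_bound) auto
      moreover have "\<bar>inner u v\<bar> \<le> norm u * norm v" by (rule Cauchy_Schwarz_ineq2)
      ultimately show ?thesis using K[of u v] by (simp add: eq algebra_simps)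
    qed
    then show "\<exists>K. \<forall>u v. norm (delta_form Z u v) \<le> norm u * norm v * K" by blast
  qed (simp_all add: eq L.add_left L.add_right L.scaleR_left L.scaleR_right inner_add_left inner_add_right algebra_simps)
qed

lemma delta_form_commute: "delta_form Z u v = delta_form Z v u"
  by (simp add: delta_form_def L2_inner_commute[of "h1_deriv u"] algebra_simps)

section \<open>The power terms of the energy and their gradients\<close>

definition power_integral :: "real \<Rightarrow> h1 \<Rightarrow> real" where
  "power_integral r u = (LINT x|lborel. cmod (h1_fun u x) powr (r + 2))"

text \<open>The derivative of \<open>power_integral r\<close> at \<open>u\<close> in the direction
  \<open>v\<close>, divided by \<open>r + 2\<close>.\<close>

definition power_pairing :: "real \<Rightarrow> h1 \<Rightarrow> h1 \<Rightarrow> real" where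
  "power_pairing r u v =
     L2_inner (\<lambda>x. h1_fun u x * of_real (cmod (h1_fun u x) powr r)) (h1_fun v)"

lemma power_term_L2:
  assumes "0 < r"
  shows "(\<lambda>x. h1_fun u x * of_real (cmod (h1_fun u x) powr r)) \<in> L2"
proof -
  have "integrable lborel (\<lambda>x. (norm u powr r)\<^sup>2 * (cmod (h1_fun u x))\<^sup>2)"
    using L2_square_integrable[OF h1_fun_L2] by simp
  then have "integrable lborel (\<lambda>x. (cmod (h1_fun u x * of_real (cmod (h1_fun u x) powr r)))\<^sup>2)"
  proof (rule Bochner_Integration.integrable_bound, measurable, intro always_eventually allI)
    fix x
    have "(cmod (h1_fun u x) powr r)\<^sup>2 \<le> (norm u powr r)\<^sup>2"
      using assms by (intro power_mono powr_mono2 h1_sup_bound) auto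
    then show "norm ((cmod (h1_fun u x * of_real (cmod (h1_fun u x) powr r)))\<^sup>2)
        \<le> norm ((norm u powr r)\<^sup>2 * (cmod (h1_fun u x))\<^sup>2)"
      using mult_left_mono[of "(cmod (h1_fun u x) powr r)\<^sup>2" "(norm u powr r)\<^sup>2" "(cmod (h1_fun u x))\<^sup>2"]
      by (simp only: norm_mult power_mult_distrib mult.commute norm_of_real real_norm_def abs_mult abs_power2
          power2_abs abs_norm_cancel abs_of_nonneg[OF powr_ge_zero] zero_le_power2)
  qed
  moreover have "(\<lambda>x. h1_fun u x * of_real (cmod (h1_fun u x) powr r)) \<in> borel_measurable borel"
    by measurable
  ultimately show ?thesis by (simp add: L2_def)
qed

lemma power_integrable:
  assumes "0 < r"
  shows "integrable lborel (\<lambda>x. cmod (h1_fun u x) powr (r + 2))"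
  using L2_inner_integrable[OF power_term_L2[OF assms] h1_fun_L2, of u u]
  by (simp only: power_term_Re)

lemma power_pairing_self: "0 < r \<Longrightarrow> power_pairing r u u = power_integral r u"
  by (simp only: power_pairing_def power_integral_def L2_inner_eq_integral power_term_L2 h1_fun_L2 power_term_Re)

text \<open>The error is measured in L^2 rather than in H^1. For increments of a solution this is
  the quantity that is o(h), by duality between H^-1 and H^1.\<close>

lemma power_pairing_cross:
  assumes "0 < r" "norm u \<le> M" "norm v \<le> M"
  shows "\<bar>power_pairing r u v - power_pairing r v u - (2 / (r + 2) - 1) * (power_integral r v - power_integral r u)\<bar>
    \<le> (r + 1) * M powr r * L2_inner (h1_fun (v - u)) (h1_fun (v - u))" (is "\<bar>?L\<bar> \<le> ?R")
proof -
  let ?F = "\<lambda>z. z * of_real (cmod z powr r)"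
  define k where "k x = Re (?F (h1_fun u x) * cnj (h1_fun v x)) - Re (?F (h1_fun v x) * cnj (h1_fun u x))
      - (2 / (r + 2) - 1) * (cmod (h1_fun v x) powr (r + 2) - cmod (h1_fun u x) powr (r + 2))" for x
  have pair: "integrable lborel (\<lambda>x. Re (?F (h1_fun u x) * cnj (h1_fun v x)))" for u v
    using assms by (intro L2_inner_integrable power_term_L2 h1_fun_L2)
  have int: "integrable lborel k" unfolding k_def
    using assms by (intro Bochner_Integration.integrable_diff integrable_mult_right pair power_integrable)
  have "?L = (LINT x|lborel. k x)"
    unfolding power_pairing_def power_integral_def k_def using pair power_integrable assms
    by (simp only: L2_inner_eq_integral power_term_L2 h1_fun_L2) 
       (subst Bochner_Integration.integral_diff; simp add: right_diff_distrib)+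
  also have "\<bar>\<dots>\<bar> \<le> (LINT x|lborel. \<bar>k x\<bar>)" by (rule integral_abs_bound)
  also have "\<dots> \<le> (LINT x|lborel. (r + 1) * M powr r * (cmod (h1_fun (v - u) x))\<^sup>2)"
  proof (rule integral_mono)
    show "integrable lborel (\<lambda>x. (r + 1) * M powr r * (cmod (h1_fun (v - u) x))\<^sup>2)"
      by (intro integrable_mult_right L2_square_integrable h1_fun_L2)
    show "\<bar>k x\<bar> \<le> (r + 1) * M powr r * (cmod (h1_fun (v - u) x))\<^sup>2" for x
      unfolding k_def h1_fun_diff using assms h1_sup_bound[of u x] h1_sup_bound[of v x]
      by (intro power_term_cross) auto
  qed (use int in auto)
  also have "\<dots> = ?R" by (simp only: L2_inner_self integral_mult_right_zero)
  finally show ?thesis .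
qed

lemma power_integral_diff:
  assumes "0 < r" "norm u \<le> M" "norm v \<le> M"
  shows "\<bar>power_integral r v - power_integral r u\<bar>
    \<le> (r + 2) * M powr r * (norm u * norm (v - u) + (r + 1) * (norm (v - u))\<^sup>2)"
proof -
  have "\<bar>power_integral r v - power_integral r u\<bar>
      = \<bar>LINT x|lborel. cmod (h1_fun v x) powr (r + 2) - cmod (h1_fun u x) powr (r + 2)\<bar>"
    using power_integrable[OF assms(1)] by (simp add: power_integral_def)
  also have "\<dots> \<le> (LINT x|lborel. \<bar>cmod (h1_fun v x) powr (r + 2) - cmod (h1_fun u x) powr (r + 2)\<bar>)"
    by (rule integral_abs_bound)
  also have "\<dots> \<le> (LINT x|lborel. (r + 2) * M powr r * (cmod (h1_fun u x) * cmod (h1_fun (v - u) x)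
      + (r + 1) * (cmod (h1_fun (v - u) x))\<^sup>2))"
  proof (rule integral_mono)
    show "\<bar>cmod (h1_fun v x) powr (r + 2) - cmod (h1_fun u x) powr (r + 2)\<bar>
      \<le> (r + 2) * M powr r * (cmod (h1_fun u x) * cmod (h1_fun (v - u) x) + (r + 1) * (cmod (h1_fun (v - u) x))\<^sup>2)" for x
      unfolding h1_fun_diff using assms h1_sup_bound[of u x] h1_sup_bound[of v x]
      by (intro power_term_diff) auto
  qed (intro integrable_abs Bochner_Integration.integrable_diff Bochner_Integration.integrable_add
      integrable_mult_right power_integrable h1_product_integrable L2_square_integrable h1_fun_L2 assms)+
  also have "\<dots> = (r + 2) * M powr r * ((LINT x|lborel. cmod (h1_fun u x) * cmod (h1_fun (v - u) x))
      + (r + 1) * (LINT x|lborel. (cmod (h1_fun (v - u) x))\<^sup>2))"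
    by (simp only: integral_mult_right_zero Bochner_Integration.integral_add
        h1_product_integrable integrable_mult_right L2_square_integrable h1_fun_L2)
  also have "\<dots> \<le> (r + 2) * M powr r * (norm u * norm (v - u) + (r + 1) * (norm (v - u))\<^sup>2)"
    using assms
    by (intro mult_left_mono add_mono h1_product_integral_le) (auto simp: norm_h1_square simp del: h1_fun_diff)
  finally show ?thesis .
qed

lemma isCont_power_integral:
  assumes "0 < r" shows "isCont (power_integral r) u"
proof -
  have "((\<lambda>v. power_integral r v - power_integral r u) \<longlongrightarrow> 0) (at u)"
  proof (rule Lim_null_comparison)
    have "\<forall>\<^sub>F v in at u. dist v u < 1"
      by (rule eventually_at_ball'[THEN eventually_mono, of 1]) (auto simp: dist_commute)
    then show "\<forall>\<^sub>F v in at u. norm (power_integral r v - power_integral r u)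
      \<le> (r + 2) * (norm u + 1) powr r * (norm u * norm (v - u) + (r + 1) * (norm (v - u))\<^sup>2)"
    proof eventually_elim
      case (elim v)
      then have "norm v \<le> norm u + 1" using norm_triangle_ineq2[of v u] by (simp add: dist_norm)
      then show ?case using power_integral_diff[OF assms, of u "norm u + 1" v] by simp
    qed
    have "((\<lambda>v. (r + 2) * (norm u + 1) powr r * (norm u * norm (v - u) + (r + 1) * (norm (v - u))\<^sup>2))
        \<longlongrightarrow> (r + 2) * (norm u + 1) powr r * (norm u * norm (u - u) + (r + 1) * (norm (u - u))\<^sup>2)) (at u)"
      by (intro tendsto_intros)
    then show "((\<lambda>v. (r + 2) * (norm u + 1) powr r * (norm u * norm (v - u) + (r + 1) * (norm (v - u))\<^sup>2))
        \<longlongrightarrow> 0) (at u)" by simp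
  qed
  then show ?thesis by (simp add: isCont_def LIM_zero_iff)
qed

section \<open>Conservation laws\<close>

lemma has_vector_derivative_quotient:
  assumes "(f has_vector_derivative d) (at t)"
  shows "((\<lambda>y. (f y - f t) /\<^sub>R (y - t)) \<longlongrightarrow> d) (at t)"
proof -
  have "((\<lambda>y. (f y - f t - (y - t) *\<^sub>R d) /\<^sub>R norm (y - t)) \<longlongrightarrow> 0) (at t)"
    using assms unfolding has_vector_derivative_def has_derivative_def by simp
  then have "((\<lambda>y. norm ((f y - f t - (y - t) *\<^sub>R d) /\<^sub>R norm (y - t))) \<longlongrightarrow> 0) (at t)"
    by (rule tendsto_norm_zero)
  moreover have "\<forall>\<^sub>F y in at t. norm ((f y - f t - (y - t) *\<^sub>R d) /\<^sub>R norm (y - t))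
      = norm ((f y - f t) /\<^sub>R (y - t) - d)"
  proof -
    have "norm ((f y - f t - (y - t) *\<^sub>R d) /\<^sub>R norm (y - t)) = norm ((f y - f t) /\<^sub>R (y - t) - d)"
      if "y \<noteq> t" for y
    proof -
      have "(f y - f t) /\<^sub>R (y - t) - d = (f y - f t - (y - t) *\<^sub>R d) /\<^sub>R (y - t)"
        using that by (simp add: scaleR_diff_right)
      then show ?thesis by simp
    qed
    then show ?thesis by (auto simp: eventually_at_filter)
  qed
  ultimately have "((\<lambda>y. norm ((f y - f t) /\<^sub>R (y - t) - d)) \<longlongrightarrow> 0) (at t)"
    by (rule Lim_transform_eventually)
  then show ?thesis by (simp add: tendsto_norm_zero_iff LIM_zero_iff)
qed

text \<open>The argument \<open>v\<close> need not be differentiable.\<close>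

lemma blinfun_apply_DERIV:
  fixes A :: "real \<Rightarrow> 'a::real_normed_vector \<Rightarrow>\<^sub>L real"
  assumes A: "(A has_vector_derivative A') (at t)" and v: "isCont v t"
    and d: "((\<lambda>s. A t (v s)) has_real_derivative d) (at t)"
  shows "((\<lambda>s. A s (v s)) has_real_derivative A' (v t) + d) (at t)"
proof -
  have "((\<lambda>y. ((A y - A t) /\<^sub>R (y - t)) (v y) + (A t (v y) - A t (v t)) / (y - t)) \<longlongrightarrow> A' (v t) + d) (at t)"
    using d v[unfolded isCont_def] has_vector_derivative_quotient[OF A]
    by (intro tendsto_add blinfun.tendsto) (auto simp: has_field_derivative_iff)
  moreover have "((A y - A t) /\<^sub>R (y - t)) (v y) + (A t (v y) - A t (v t)) / (y - t)
      = (A y (v y) - A t (v t)) / (y - t)" for y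
    by (simp add: blinfun.bilinear_simps divide_inverse algebra_simps)
  ultimately show ?thesis by (simp add: has_field_derivative_iff)
qed

text \<open>Infinitesimal phase invariance: the integrand vanishes pointwise. The same holds for the
  quadratic form below, and together they conserve the mass.\<close>

lemma power_pairing_i:
  assumes "0 < r" shows "power_pairing r u (h1_cscale \<i> u) = 0"
  unfolding power_pairing_def
  by (rule L2_inner_eq_0[OF power_term_L2[OF assms] h1_fun_L2]) (simp add: algebra_simps)

lemma delta_form_i: "delta_form Z u (h1_cscale \<i> u) = 0"
proof -
  have "AE x in lborel. Re (h1_deriv u x * cnj (h1_deriv (h1_cscale \<i> u) x)) = 0"
    using h1_deriv_cscale[of \<i> u] by eventually_elim simp
  then have "L2_inner (h1_deriv u) (h1_deriv (h1_cscale \<i> u)) = 0"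
    by (intro L2_inner_eq_0 h1_deriv)
  then show ?thesis by (simp add: delta_form_def)
qed

text \<open>The pairing is the symplectic form of the equation. Antisymmetry turns differentiation
  in the second argument into differentiation of the embedded trajectory, where \<open>u_t\<close>
  is available.\<close>

lemma h1_embed_i_antisym: "h1_embed u (h1_cscale (- \<i>) v) = - h1_embed v (h1_cscale (- \<i>) u)"
proof -
  have "h1_embed u (h1_cscale (- \<i>) v) = (LINT x|lborel. Re (h1_fun u x * cnj (- \<i> * h1_fun v x)))"
    by (subst h1_embed.rep_eq, subst L2_inner_eq_integral[OF h1_fun_L2 h1_fun_L2]) simp
  also have "\<dots> = (LINT x|lborel. - Re (h1_fun v x * cnj (- \<i> * h1_fun u x)))"
    by (intro Bochner_Integration.integral_cong) auto
  also have "\<dots> = - (LINT x|lborel. Re (h1_fun v x * cnj (- \<i> * h1_fun u x)))"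
    by (rule Bochner_Integration.integral_minus)
  also have "\<dots> = - h1_embed v (h1_cscale (- \<i>) u)"
    by (subst h1_embed.rep_eq, subst L2_inner_eq_integral[OF h1_fun_L2 h1_fun_L2]) simp
  finally show ?thesis .
qed

lemma L2_inner_nonlinearity:
  assumes "1 < p"
  shows "L2_inner (\<lambda>x. nonlinearity p lam1 lam2 (h1_fun u x)) (h1_fun v)
    = lam1 * power_pairing (p - 1) u v + lam2 * power_pairing (2 * p - 2) u v"
proof -
  let ?F = "\<lambda>r x. h1_fun u x * of_real (cmod (h1_fun u x) powr r)"
  have "L2_inner (\<lambda>x. of_real lam1 * ?F (p - 1) x + of_real lam2 * ?F (2 * p - 2) x) (h1_fun v)
      = L2_inner (\<lambda>x. of_real lam1 * ?F (p - 1) x) (h1_fun v) + L2_inner (\<lambda>x. of_real lam2 * ?F (2 * p - 2) x) (h1_fun v)"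
    using assms by (intro L2_inner_add L2_cmult power_term_L2 h1_fun_L2) auto
  then show ?thesis
    by (simp only: L2_inner_scale power_pairing_def nonlinearity_def mult.assoc)
qed

section \<open>Conservation of mass and energy along a solution\<close>

locale nls_trajectory =
  fixes p lam1 lam2 Z :: real and u :: "real \<Rightarrow> h1" and u_t :: "real \<Rightarrow> h1 \<Rightarrow>\<^sub>L real"
  assumes p: "1 < p"
    and u_cont: "continuous_on UNIV u"
    and u_t_cont: "continuous_on UNIV u_t"
    and u_deriv: "\<And>t. ((\<lambda>s. h1_embed (u s)) has_vector_derivative u_t t) (at t)"
    and equation: "\<And>t v. u_t t (h1_cscale (- \<i>) v) - delta_form Z (u t) v
      + L2_inner (\<lambda>x. nonlinearity p lam1 lam2 (h1_fun (u t) x)) (h1_fun v) = 0"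
begin

definition mass :: "h1 \<Rightarrow> real" where "mass v = L2_inner (h1_fun v) (h1_fun v)"

text \<open>Twice the Hamiltonian E, hence the coefficients 2/(p + 1) and 1/p instead of 1/(p + 1)
  and 1/(2p).\<close>

definition energy :: "h1 \<Rightarrow> real" where
  "energy v = delta_form Z v v
     - lam1 * (2 / (p + 1)) * power_integral (p - 1) v - lam2 * (1 / p) * power_integral (2 * p - 2) v"

text \<open>The derivative E'(v) applied to \<open>w\<close>; the equation then reads \<i>
  \<open>u_t\<close> = E'(u).\<close>

definition gradient :: "h1 \<Rightarrow> h1 \<Rightarrow> real" where
  "gradient v w = delta_form Z v w - lam1 * power_pairing (p - 1) v w - lam2 * power_pairing (2 * p - 2) v w"

lemma u_t_apply: "u_t t (h1_cscale (- \<i>) v) = gradient (u t) v"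
  using equation[of t v] by (simp add: gradient_def L2_inner_nonlinearity[OF p])

lemma isCont_u: "isCont u t"
  using u_cont by (simp add: continuous_on_eq_continuous_at)

lemma embed_deriv: "((\<lambda>s. h1_embed (u s) v) has_real_derivative u_t t v) (at t)"
  by (simp add: has_real_derivative_iff_has_vector_derivative bounded_linear.has_vector_derivative[OF blinfun.bounded_linear_left u_deriv])

text \<open>The value \<open>u t\<close> lies in H^1 and so may be inserted into
  \<open>u_t t\<close>. The result is the gradient in the direction \<i> u, which vanishes by phase
  invariance.\<close>

lemma mass_conserved: "mass (u t) = mass (u 0)"
proof -
  have "((\<lambda>s. mass (u s)) has_real_derivative 0) (at t)" for t
  proof -
    have comm: "h1_embed (u s) (u t) = h1_embed (u t) (u s)" for s t
      by (simp add: h1_embed.rep_eq L2_inner_commute)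
    have "((\<lambda>s. h1_embed (u t) (u s)) has_real_derivative u_t t (u t)) (at t)"
      using embed_deriv[of "u t" t] by (simp add: comm)
    from blinfun_apply_DERIV[OF u_deriv isCont_u this]
    have "((\<lambda>s. h1_embed (u s) (u s)) has_real_derivative u_t t (u t) + u_t t (u t)) (at t)" .
    moreover have "u_t t (u t) = gradient (u t) (h1_cscale \<i> (u t))"
      by (simp add: u_t_apply[symmetric] h1_cscale_cscale)
    moreover have "gradient (u t) (h1_cscale \<i> (u t)) = 0"
      using p by (simp add: gradient_def delta_form_i power_pairing_i)
    ultimately show ?thesis by (simp add: mass_def h1_embed.rep_eq)
  qed
  then show ?thesis using DERIV_isconst_all by blast
qed

lemma energy_conserved_interval:
  assumes "a \<le> b" shows "energy (u b) = energy (u a)"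
proof -
  \<comment> \<open>The bounds reach to \<open>b + 1\<close> because \<open>u\<close> is evaluated
    at \<open>t + h\<close> with \<open>h < 1\<close>.\<close>
  obtain M where M: "\<forall>t\<in>{a..b + 1}. norm (u t) \<le> M"
    using compact_imp_bounded[OF compact_continuous_image[OF continuous_on_subset[OF u_cont] compact_Icc], of a "b + 1"]
    by (auto simp: bounded_iff)
  obtain B where B: "\<forall>t\<in>{a..b + 1}. norm (u_t t) \<le> B"
    using compact_imp_bounded[OF compact_continuous_image[OF continuous_on_subset[OF u_t_cont] compact_Icc], of a "b + 1"]
    by (auto simp: bounded_iff)
  \<comment> \<open>In H^-1 the trajectory is Lipschitz, whereas in H^1 it is only
    continuous.\<close>
  have Lip: "norm (h1_embed (u s) - h1_embed (u t)) \<le> B * \<bar>s - t\<bar>" if "s \<in> {a..b + 1}" "t \<in> {a..b + 1}" for s t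
  proof -
    have "norm (h1_embed (u s) - h1_embed (u t)) \<le> B * norm (s - t)"
    proof (rule differentiable_bound[of "{a..b + 1}"])
      fix x assume x: "x \<in> {a..b + 1}"
      show "((\<lambda>s. h1_embed (u s)) has_derivative (\<lambda>h. h *\<^sub>R u_t x)) (at x within {a..b + 1})"
        using u_deriv[of x] by (auto simp: has_vector_derivative_def intro: has_derivative_at_withinI)
      show "onorm (\<lambda>h. h *\<^sub>R u_t x) \<le> B"
        using B[rule_format, OF x] by (intro onorm_le) (simp add: mult.commute[of B] mult_left_mono)
    qed (use that in auto)
    then show ?thesis by simp
  qed
  \<comment> \<open>The coefficient of the increment in \<open>power_pairing_cross\<close>;
    \<open>H\<close> collects these increments for both powers.\<close>
  define c where "c r = 2 / (r + 2) - (1::real)" for r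
  define H where "H t = lam1 * c (p - 1) * power_integral (p - 1) (u t)
      + lam2 * c (2 * p - 2) * power_integral (2 * p - 2) (u t)" for t
  \<comment> \<open>The margin on both sides makes \<open>K\<close> differentiable in the two-sided
    sense at all \<open>t\<close> and \<open>t + h\<close> that occur.\<close>
  have H_cont: "continuous_on {a - 1..b + 2} H"
  proof -
    have "continuous_on A (\<lambda>t. power_integral r (u t))" if "0 < r" for r A
      by (intro continuous_at_imp_continuous_on ballI isCont_o2[OF isCont_u] isCont_power_integral that)
    then show ?thesis using p unfolding H_def by (intro continuous_intros) auto
  qed
  define K where "K x = integral {a - 1..x} H" for x
  have K: "(K has_real_derivative H t) (at t)" if "t \<in> {a - 1<..<b + 2}" for t
  proof -
    have "(K has_real_derivative H t) (at t within {a - 1..b + 2})"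
      unfolding K_def using that by (intro integral_has_real_derivative H_cont) auto
    then show ?thesis using that by (simp add: at_within_Icc_at)
  qed
  define m where "m h t = h1_embed (u (t + h)) (h1_cscale (- \<i>) (u t))" for h t
  define C where "C = \<bar>lam1\<bar> * (p * M powr (p - 1)) + \<bar>lam2\<bar> * ((2 * p - 1) * M powr (2 * p - 2))"
  have C: "0 \<le> C" unfolding C_def using p by (intro add_nonneg_nonneg mult_nonneg_nonneg) auto
  \<comment> \<open>Subtracting the increment of the primitive \<open>K\<close> removes
    \<open>H (t + h) - H t\<close> from the derivative of \<open>m h\<close>; what remains is o(h)
    uniformly in \<open>t\<close>.\<close>
  define \<psi> where "\<psi> h t = m h t - (K (t + h) - K t)" for h t
  have \<psi>': "\<exists>d. (\<psi> h has_real_derivative d) (at t) \<and> \<bar>d\<bar> \<le> C * (B * h * norm (u (t + h) - u t))"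
    if h: "0 < h" "h < 1" and t: "t \<in> {a..b}" for h t
  proof -
    have shift: "((\<lambda>s. h1_embed (u (s + h))) has_vector_derivative u_t (t + h)) (at t)"
    proof -
      have "((\<lambda>s. s + h) has_vector_derivative 1) (at t)"
        unfolding has_real_derivative_iff_has_vector_derivative[symmetric]
        by (auto intro!: derivative_eq_intros)
      from vector_diff_chain_at[OF this u_deriv] show ?thesis by (simp add: o_def)
    qed
    have "isCont (\<lambda>s. h1_cscale (- \<i>) (u s)) t"
    proof -
      have "norm (h1_cscale (- \<i>) (u y) - h1_cscale (- \<i>) (u t)) = norm (u y - u t)" for y
        by (simp flip: h1_cscale_diff add: norm_h1_cscale)
      then show ?thesis
        using isCont_u[of t] unfolding continuous_at_eps_delta dist_norm by simp
    qed
    moreover have "((\<lambda>s. h1_embed (u (t + h)) (h1_cscale (- \<i>) (u s))) has_real_derivative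
        - u_t t (h1_cscale (- \<i>) (u (t + h)))) (at t)"
      unfolding h1_embed_i_antisym[of "u (t + h)"] by (intro DERIV_minus embed_deriv)
    ultimately have m1: "(m h has_real_derivative u_t (t + h) (h1_cscale (- \<i>) (u t))
        + - u_t t (h1_cscale (- \<i>) (u (t + h)))) (at t)"
      unfolding m_def by (intro blinfun_apply_DERIV shift)
    have K1: "((\<lambda>t. K (t + h) - K t) has_real_derivative H (t + h) - H t) (at t)"
    proof (rule DERIV_diff)
      show "((\<lambda>t. K (t + h)) has_real_derivative H (t + h)) (at t)"
        using K[of "t + h"] h t by (simp add: DERIV_shift)
    qed (use h t in \<open>auto intro: K\<close>)
    have "(\<psi> h has_real_derivative (gradient (u (t + h)) (u t) - gradient (u t) (u (t + h)))
        - (H (t + h) - H t)) (at t)"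
      using DERIV_diff[OF m1 K1] unfolding \<psi>_def u_t_apply by simp
    moreover have "\<bar>(gradient (u (t + h)) (u t) - gradient (u t) (u (t + h))) - (H (t + h) - H t)\<bar>
        \<le> C * (B * h * norm (u (t + h) - u t))"
    proof -
      define D where "D = L2_inner (h1_fun (u (t + h) - u t)) (h1_fun (u (t + h) - u t))"
      define X where "X r = power_pairing r (u t) (u (t + h)) - power_pairing r (u (t + h)) (u t)
          - c r * (power_integral r (u (t + h)) - power_integral r (u t))" for r
      have X: "\<bar>X r\<bar> \<le> (r + 1) * M powr r * D" if "0 < r" for r
        unfolding X_def c_def D_def using that h t by (intro power_pairing_cross M[rule_format]) auto
      have "(gradient (u (t + h)) (u t) - gradient (u t) (u (t + h))) - (H (t + h) - H t)
          = lam1 * X (p - 1) + lam2 * X (2 * p - 2)"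
        by (simp add: gradient_def H_def X_def delta_form_commute[of Z _ "u t"] algebra_simps)
      also have "\<bar>\<dots>\<bar> \<le> \<bar>lam1\<bar> * \<bar>X (p - 1)\<bar> + \<bar>lam2\<bar> * \<bar>X (2 * p - 2)\<bar>"
        by (rule order_trans[OF abs_triangle_ineq]) (simp add: abs_mult)
      also have "\<dots> \<le> \<bar>lam1\<bar> * (p * M powr (p - 1) * D) + \<bar>lam2\<bar> * ((2 * p - 1) * M powr (2 * p - 2) * D)"
        using X[of "p - 1"] X[of "2 * p - 2"] p by (intro add_mono mult_left_mono) auto
      also have "\<dots> = C * D" by (simp add: C_def algebra_simps)
      \<comment> \<open>The squared L^2 norm is the duality pairing of the increment in H^-1, of
        size O(h), with the increment in H^1, which tends to 0.\<close>
      also have "D \<le> B * h * norm (u (t + h) - u t)"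
      proof -
        have "D = (h1_embed (u (t + h)) - h1_embed (u t)) (u (t + h) - u t)"
          by (simp only: D_def h1_embed_diff[symmetric] h1_embed.rep_eq)
        also have "\<dots> \<le> norm (h1_embed (u (t + h)) - h1_embed (u t)) * norm (u (t + h) - u t)"
          using norm_blinfun[of "h1_embed (u (t + h)) - h1_embed (u t)" "u (t + h) - u t"] by (simp add: abs_le_iff)
        also have "\<dots> \<le> B * h * norm (u (t + h) - u t)"
          using Lip[of "t + h" t] h t by (intro mult_right_mono) auto
        finally show ?thesis .
      qed
      finally show ?thesis using C by (simp add: mult_left_mono)
    qed
    ultimately show ?thesis by blast
  qed
  have lim: "((\<lambda>h. \<psi> h t / h) \<longlongrightarrow> energy (u t)) (at_right 0)" if "t \<in> {a..b}" for t
  proof -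
    have m0: "m 0 t = 0" using h1_embed_i_antisym[of "u t" "u t"] by (simp add: m_def)
    have "((\<lambda>h. (m h t - m 0 t) / h) \<longlongrightarrow> gradient (u t) (u t)) (at 0)"
      using embed_deriv[of "h1_cscale (- \<i>) (u t)" t] by (simp add: DERIV_def m_def u_t_apply)
    moreover have "((\<lambda>h. (K (t + h) - K t) / h) \<longlongrightarrow> H t) (at 0)"
      using K[of t] that by (simp add: DERIV_def)
    ultimately have "((\<lambda>h. (m h t - m 0 t) / h - (K (t + h) - K t) / h) \<longlongrightarrow> gradient (u t) (u t) - H t) (at 0)"
      by (rule tendsto_diff)
    moreover have "gradient (u t) (u t) - H t = energy (u t)"
    \<comment> \<open>Adding the coefficient 1 of the gradient to \<open>c\<close> leaves 2/(r + 2),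
      that is 2/(p + 1) and 1/p for the two powers.\<close>
    proof -
      have c: "c (p - 1) = 2 / (p + 1) - 1" "c (2 * p - 2) = 1 / p - 1"
        using p by (simp_all add: c_def field_simps)
      have alg: "x - l\<^sub>1 * n\<^sub>1 - l\<^sub>2 * n\<^sub>2 - (l\<^sub>1 * (a - 1) * n\<^sub>1 + l\<^sub>2 * (b - 1) * n\<^sub>2)
          = x - l\<^sub>1 * a * n\<^sub>1 - l\<^sub>2 * b * n\<^sub>2" for x l\<^sub>1 l\<^sub>2 n\<^sub>1 n\<^sub>2 a b :: real
        by (simp add: algebra_simps)
      have "0 < p - 1" "0 < 2 * p - 2" using p by auto
      then show ?thesis
        by (simp only: gradient_def H_def energy_def c power_pairing_self alg)
    qed
    ultimately have "((\<lambda>h. \<psi> h t / h) \<longlongrightarrow> energy (u t)) (at 0)"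
      by (simp add: \<psi>_def m0 diff_divide_distrib)
    then show ?thesis by (rule filterlim_mono) (auto simp: at_within_le_at)
  qed
  have "\<bar>energy (u b) - energy (u a)\<bar> \<le> C * (B * \<epsilon>) * (b - a)" if "0 < \<epsilon>" for \<epsilon>
  proof -
    have "uniformly_continuous_on {a..b + 1} u"
      by (intro compact_uniformly_continuous continuous_on_subset[OF u_cont]) auto
    then obtain d where d: "0 < d" "\<And>s t. s \<in> {a..b + 1} \<Longrightarrow> t \<in> {a..b + 1} \<Longrightarrow> dist s t < d \<Longrightarrow> dist (u s) (u t) < \<epsilon>"
      using \<open>0 < \<epsilon>\<close> unfolding uniformly_continuous_on_def by metis
    have B0: "0 \<le> B" using order_trans[OF norm_ge_zero B[rule_format, of a]] assms by simp
    have "\<bar>\<psi> h b / h - \<psi> h a / h\<bar> \<le> C * (B * \<epsilon>) * (b - a)" if h: "0 < h" "h < min d 1" for h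
    proof -
      have "\<forall>t\<in>{a..b}. \<exists>d. (\<psi> h has_real_derivative d) (at t) \<and> \<bar>d\<bar> \<le> C * (B * h * norm (u (t + h) - u t))"
        using h by (intro ballI \<psi>') auto
      from bchoice[OF this] obtain \<psi>_d where \<psi>_d: "\<And>t. t \<in> {a..b} \<Longrightarrow> (\<psi> h has_real_derivative \<psi>_d t) (at t)"
        "\<And>t. t \<in> {a..b} \<Longrightarrow> \<bar>\<psi>_d t\<bar> \<le> C * (B * h * norm (u (t + h) - u t))"
        by blast
      \<comment> \<open>The mean value inequality in \<open>t\<close>: the factor \<open>h\<close>
        in the bound cancels against the division by \<open>h\<close>, so the limit in
        \<open>h\<close> is of order \<epsilon>.\<close>
      have "norm (\<psi> h b - \<psi> h a) \<le> (C * (B * \<epsilon>) * h) * norm (b - a)"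
      proof (rule field_differentiable_bound[of "{a..b}" "\<psi> h" \<psi>_d])
        fix t assume t: "t \<in> {a..b}"
        show "(\<psi> h has_field_derivative \<psi>_d t) (at t within {a..b})"
          using \<psi>_d(1)[OF t] by (rule DERIV_subset) simp
        have "norm (u (t + h) - u t) \<le> \<epsilon>"
          using d(2)[of "t + h" t] t h by (simp add: dist_norm)
        then have "C * (B * h * norm (u (t + h) - u t)) \<le> C * (B * h * \<epsilon>)"
          using C B0 h by (intro mult_left_mono) auto
        then show "norm (\<psi>_d t) \<le> C * (B * \<epsilon>) * h" using \<psi>_d(2)[OF t] by (simp add: algebra_simps)
      qed (use assms in auto)
      then have "\<bar>\<psi> h b - \<psi> h a\<bar> / h \<le> (C * (B * \<epsilon>) * h) * (b - a) / h"
        using h assms by (intro divide_right_mono) auto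
      then show ?thesis using h by (simp add: diff_divide_distrib[symmetric] abs_divide)
    qed
    then have "\<forall>\<^sub>F h in at_right 0. \<bar>\<psi> h b / h - \<psi> h a / h\<bar> \<le> C * (B * \<epsilon>) * (b - a)"
      using d(1) by (intro eventually_at_rightI[of 0 "min d 1"]) auto
    moreover have "((\<lambda>h. \<bar>\<psi> h b / h - \<psi> h a / h\<bar>) \<longlongrightarrow> \<bar>energy (u b) - energy (u a)\<bar>) (at_right 0)"
      using assms by (intro tendsto_intros lim) auto
    ultimately show ?thesis by (intro tendsto_upperbound) auto
  qed
  then have "((\<lambda>\<epsilon>. C * (B * \<epsilon>) * (b - a)) \<longlongrightarrow> C * (B * 0) * (b - a)) (at_right 0)
      \<Longrightarrow> \<bar>energy (u b) - energy (u a)\<bar> \<le> C * (B * 0) * (b - a)"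
    by (intro tendsto_lowerbound[where F = "at_right 0"]) (auto simp: eventually_at_filter)
  moreover have "((\<lambda>\<epsilon>. C * (B * \<epsilon>) * (b - a)) \<longlongrightarrow> C * (B * 0) * (b - a)) (at_right 0)"
    by (intro tendsto_intros)
  ultimately show ?thesis by simp
qed

lemma energy_conserved: "energy (u t) = energy (u 0)"
  using energy_conserved_interval[of 0 t] energy_conserved_interval[of t 0] by linarith

end

section \<open>The profile and its action\<close>

text \<open>Integration by parts on each half-line; the boundary terms at 0 cancel because the even
  extension is continuous there.\<close>

lemma even_extension_weak_deriv:
  assumes f: "\<And>x. 0 \<le> x \<Longrightarrow> (f has_real_derivative f' x) (at x)"
    and f': "continuous_on {0..} f'"
    and L2: "(\<lambda>x. complex_of_real (f \<bar>x\<bar>)) \<in> L2" "(\<lambda>x. complex_of_real (sgn x * f' \<bar>x\<bar>)) \<in> L2"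
  shows "weak_deriv (\<lambda>x. of_real (f \<bar>x\<bar>)) (\<lambda>x. of_real (sgn x * f' \<bar>x\<bar>))"
  unfolding weak_deriv_def
proof (intro allI impI)
  fix \<psi> assume T: "test_function \<psi>"
  obtain a0 where a0: "\<And>x. \<bar>x\<bar> > a0 \<Longrightarrow> \<psi> x = 0" "\<And>x. \<bar>x\<bar> > a0 \<Longrightarrow> deriv \<psi> x = 0"
    using test_function_support[OF T] by metis
  \<comment> \<open>Positive, and large enough that \<open>\<psi>\<close> vanishes at
    \<open>a\<close> and \<open>- a\<close> themselves, which removes the outer boundary
    terms.\<close>
  define a where "a = max a0 0 + 1"
  have a: "0 < a" "\<And>x. \<bar>x\<bar> \<ge> a \<Longrightarrow> \<psi> x = 0" "\<And>x. \<bar>x\<bar> \<ge> a \<Longrightarrow> deriv \<psi> x = 0"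
    using a0 by (auto simp: a_def)
  have "(deriv ^^ 0) \<psi> differentiable (at x)" "(deriv ^^ 1) \<psi> differentiable (at x)" for x
    using T unfolding test_function_def by blast+
  then have \<psi>: "(\<psi> has_real_derivative deriv \<psi> x) (at x)" "isCont (deriv \<psi>) x" for x
    by (auto simp: DERIV_deriv_iff_real_differentiable differentiable_imp_continuous_within)
  have f_cont: "continuous_on {0..} f"
    using f by (meson DERIV_isCont atLeast_iff continuous_at_imp_continuous_on)
  have d\<psi>_cont: "continuous_on A (deriv \<psi>)" and \<psi>_cont: "continuous_on A \<psi>" for A
    using \<psi>(2) DERIV_isCont[OF \<psi>(1)] by (auto intro!: continuous_at_imp_continuous_on)
  have right: "has_bochner_integral lborel (\<lambda>x. indicator {0..a} x *\<^sub>R (deriv \<psi> x * f x + \<psi> x * f' x))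
      (\<psi> a * f a - \<psi> 0 * f 0)"
  proof (rule has_bochner_integral_FTC_Icc)
    fix x assume "0 \<le> x" "x \<le> a"
    then have "((\<lambda>x. \<psi> x * f x) has_real_derivative deriv \<psi> x * f x + \<psi> x * f' x) (at x)"
      by (auto intro!: derivative_eq_intros \<psi> f)
    then show "((\<lambda>x. \<psi> x * f x) has_vector_derivative deriv \<psi> x * f x + \<psi> x * f' x) (at x within {0..a})"
      unfolding has_real_derivative_iff_has_vector_derivative[symmetric] by (rule DERIV_subset) simp
  next
    show "continuous_on {0..a} (\<lambda>x. deriv \<psi> x * f x + \<psi> x * f' x)"
      by (intro continuous_intros d\<psi>_cont \<psi>_cont continuous_on_subset[OF f_cont] continuous_on_subset[OF f']) auto
  qed (use a in simp)
  have left: "has_bochner_integral lborel (\<lambda>x. indicator {-a..0} x *\<^sub>R (deriv \<psi> x * f (- x) - \<psi> x * f' (- x)))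
      (\<psi> 0 * f (- 0) - \<psi> (- a) * f (- (- a)))"
  proof (rule has_bochner_integral_FTC_Icc)
    fix x assume x: "- a \<le> x" "x \<le> 0"
    have "((\<lambda>x. f (- x)) has_real_derivative f' (- x) * - 1) (at x)"
      using x by (intro DERIV_chain2[OF f]) (auto intro!: derivative_eq_intros)
    then have "((\<lambda>x. \<psi> x * f (- x)) has_real_derivative deriv \<psi> x * f (- x) - \<psi> x * f' (- x)) (at x)"
      by (auto intro!: derivative_eq_intros \<psi>)
    then show "((\<lambda>x. \<psi> x * f (- x)) has_vector_derivative deriv \<psi> x * f (- x) - \<psi> x * f' (- x)) (at x within {-a..0})"
      unfolding has_real_derivative_iff_has_vector_derivative[symmetric] by (rule DERIV_subset) simp
  next
    show "continuous_on {-a..0} (\<lambda>x. deriv \<psi> x * f (- x) - \<psi> x * f' (- x))"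
      by (intro continuous_intros d\<psi>_cont \<psi>_cont continuous_on_compose2[OF f_cont] continuous_on_compose2[OF f']) auto
  qed (use a in simp)
  define H where "H x = deriv \<psi> x * f \<bar>x\<bar> + \<psi> x * (sgn x * f' \<bar>x\<bar>)" for x
  have int: "integrable lborel (\<lambda>x. deriv \<psi> x *\<^sub>R complex_of_real (f \<bar>x\<bar>))"
      "integrable lborel (\<lambda>x. \<psi> x *\<^sub>R complex_of_real (sgn x * f' \<bar>x\<bar>))"
    by (rule test_function_integrable(2)[OF T L2(1)], rule test_function_integrable(1)[OF T L2(2)])
  from integrable_Re[OF Bochner_Integration.integrable_add[OF int]]
  have H_int: "integrable lborel H" by (simp add: H_def[abs_def])
  have sum: "has_bochner_integral lborel (\<lambda>x. indicator {0..a} x *\<^sub>R (deriv \<psi> x * f x + \<psi> x * f' x)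
      + indicator {-a..0} x *\<^sub>R (deriv \<psi> x * f (- x) - \<psi> x * f' (- x))) 0"
    using has_bochner_integral_add[OF right left] a(1,2) by simp
  have "(LINT x|lborel. H x) = (LINT x|lborel. indicator {0..a} x *\<^sub>R (deriv \<psi> x * f x + \<psi> x * f' x)
      + indicator {-a..0} x *\<^sub>R (deriv \<psi> x * f (- x) - \<psi> x * f' (- x)))"
  proof (rule integral_cong_AE)
    show "AE x in lborel. H x = indicator {0..a} x *\<^sub>R (deriv \<psi> x * f x + \<psi> x * f' x)
      + indicator {-a..0} x *\<^sub>R (deriv \<psi> x * f (- x) - \<psi> x * f' (- x))"
      using AE_lborel_singleton[of 0]
    proof eventually_elim
      case (elim x)
      then show ?case using a(2,3)[of x] by (cases "x > 0") (auto simp: H_def indicator_def sgn_if)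
    qed
    show "H \<in> borel_measurable lborel" using H_int by auto
    show "(\<lambda>x. indicator {0..a} x *\<^sub>R (deriv \<psi> x * f x + \<psi> x * f' x)
      + indicator {-a..0} x *\<^sub>R (deriv \<psi> x * f (- x) - \<psi> x * f' (- x))) \<in> borel_measurable lborel"
      by (rule borel_measurable_integrable[OF conjunct1[OF sum[unfolded has_bochner_integral_iff]]])
  qed
  also have "\<dots> = 0" using sum by (simp only: has_bochner_integral_iff)
  finally have H0: "(LINT x|lborel. complex_of_real (H x)) = 0" by simp
  have "(LINT x|lborel. deriv \<psi> x *\<^sub>R complex_of_real (f \<bar>x\<bar>))
      + (LINT x|lborel. \<psi> x *\<^sub>R complex_of_real (sgn x * f' \<bar>x\<bar>)) = (LINT x|lborel. complex_of_real (H x))"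
    by (subst Bochner_Integration.integral_add[symmetric, OF int])
      (simp add: H_def scaleR_conv_of_real)
  then show "(LINT x|lborel. deriv \<psi> x *\<^sub>R complex_of_real (f \<bar>x\<bar>))
      = - (LINT x|lborel. \<psi> x *\<^sub>R complex_of_real (sgn x * f' \<bar>x\<bar>))"
    by (simp only: H0 eq_neg_iff_add_eq_0)
qed

text \<open>The half-line integral is doubled by reflection. Working with the nonnegative integral
  yields integrability together with the value.\<close>

lemma has_bochner_integral_even_extension:
  fixes h F :: "real \<Rightarrow> real"
  assumes [measurable]: "h \<in> borel_measurable borel"
    and F: "\<And>x. 0 \<le> x \<Longrightarrow> (F has_real_derivative h x) (at x)"
    and nn: "\<And>x. 0 \<le> x \<Longrightarrow> 0 \<le> h x" and lim: "(F \<longlongrightarrow> T) at_top"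
  shows "has_bochner_integral lborel (\<lambda>x. h \<bar>x\<bar>) (2 * (T - F 0))"
proof (rule has_bochner_integral_nn_integral)
  have half: "(\<integral>\<^sup>+x. ennreal (h x) * indicator {0..} x \<partial>lborel) = ennreal (T - F 0)"
    by (rule nn_integral_FTC_atLeast[OF _ F nn lim]) auto
  have "F 0 \<le> T"
  proof (rule tendsto_lowerbound[OF lim])
    show "\<forall>\<^sub>F x in at_top. F 0 \<le> F x"
      using eventually_ge_at_top[of 0]
    proof eventually_elim
      case (elim x)
      then show ?case by (rule DERIV_nonneg_imp_nondecreasing) (meson F nn)
    qed
  qed simp
  then show "0 \<le> 2 * (T - F 0)" by simp
  have "(\<integral>\<^sup>+x. ennreal (h \<bar>x\<bar>) \<partial>lborel)
      = (\<integral>\<^sup>+x. ennreal (h x) * indicator {0..} x + ennreal (h (- x)) * indicator {0..} (- x) \<partial>lborel)"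
    using AE_lborel_singleton[of 0]
    by (intro nn_integral_cong_AE, eventually_elim) (auto simp: indicator_def abs_if)
  also have "\<dots> = (\<integral>\<^sup>+x. ennreal (h x) * indicator {0..} x \<partial>lborel)
      + (\<integral>\<^sup>+x. ennreal (h (- x)) * indicator {0..} (- x) \<partial>lborel)"
    by (rule nn_integral_add) measurable
  also have "(\<integral>\<^sup>+x. ennreal (h (- x)) * indicator {0..} (- x) \<partial>lborel)
      = (\<integral>\<^sup>+x. ennreal (h x) * indicator {0..} x \<partial>lborel)"
    using nn_integral_real_affine[of "\<lambda>x. ennreal (h x) * indicator {0..} x" "- 1" 0] by simp
  finally show "(\<integral>\<^sup>+x. ennreal (h \<bar>x\<bar>) \<partial>lborel) = ennreal (2 * (T - F 0))"
    using ennreal_plus[of "T - F 0" "T - F 0"] \<open>F 0 \<le> T\<close> by (simp only: half mult_2 diff_ge_0_iff_ge)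
  show "AE x in lborel. 0 \<le> h \<bar>x\<bar>" using nn by auto
qed measurable

text \<open>In the variable D = k d the equation R1 = q reads \<open>G D = 0\<close>. At the left
  end, where the denominator of \<open>R1\<close> vanishes, \<open>G\<close> is negative; since q >
  1, it tends to infinity on the right.\<close>

lemma R1_surj:
  fixes \<alpha> \<gamma> k q :: real
  assumes "0 < \<gamma>" "0 < k" "1 < q"
  shows "q \<in> R1 \<alpha> \<gamma> k ` {- (1 / k * arsinh (\<alpha> / \<gamma>))<..}"
proof -
  define G where "G D = \<gamma> * (q * sinh D - cosh D) + q * \<alpha>" for D
  define D0 where "D0 = - arsinh (\<alpha> / \<gamma>)"
  have sinh0: "\<gamma> * sinh D0 = - \<alpha>" using assms by (simp add: D0_def)
  have "filterlim G at_top at_top"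
  proof -
    define A where "A = \<gamma> * (q - 1) / 2"
    have A: "0 < A" using assms by (simp add: A_def)
    have "G = (\<lambda>D. A * exp D - \<gamma> * (q + 1) / 2 * exp (- D) + q * \<alpha>)"
      by (simp add: G_def A_def sinh_field_def cosh_field_def fun_eq_iff field_simps)
    then show ?thesis using A by (simp only:) real_asymp
  qed
  then have "\<forall>\<^sub>F D in at_top. 0 \<le> G D \<and> D0 \<le> D"
    by (intro eventually_conj eventually_ge_at_top) (simp add: filterlim_at_top)
  then obtain D1 where D1: "0 \<le> G D1" "D0 \<le> D1"
    by (auto simp: eventually_at_top_linorder)
  have "G D0 = q * (\<gamma> * sinh D0) - \<gamma> * cosh D0 + q * \<alpha>"
    by (simp add: G_def algebra_simps)
  then have G0: "G D0 = - \<gamma> * cosh D0" by (simp add: sinh0)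
  have "0 < \<gamma> * cosh D0" using assms by simp
  then have G0neg: "G D0 < 0" using G0 by simp
  have "\<exists>D. D0 \<le> D \<and> D \<le> D1 \<and> G D = 0"
    using D1 G0neg by (intro IVT') (auto simp: G_def intro!: continuous_intros)
  then obtain D where D: "D0 \<le> D" "G D = 0" by blast
  then have "D0 < D" using G0neg by (cases "D = D0") auto
  then have "\<gamma> * sinh D0 < \<gamma> * sinh D" using assms by simp
  then have pos: "0 < \<gamma> * sinh D + \<alpha>" using sinh0 by simp
  have "R1 \<alpha> \<gamma> k (D / k) = q"
    using D(2) pos assms by (simp add: R1_def G_def field_simps)
  moreover have "D / k \<in> {- (1 / k * arsinh (\<alpha> / \<gamma>))<..}"
    using \<open>D0 < D\<close> assms by (simp add: D0_def field_simps)
  ultimately show ?thesis by (metis imageI)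
qed

section \<open>The action for fixed parameters and its lower bound\<close>

text \<open>In the notation of the theorem r = p - 1, W = - \<omega>, and the coupling constants are
  \<alpha> (r + 2) and \<beta> (r + 1).\<close>

locale standing_wave =
  fixes r \<alpha> \<beta> \<gamma> W Z d :: real
  assumes r: "0 < r" and \<alpha>: "\<alpha> \<le> 0" and \<beta>: "\<beta> < 0" and W: "0 < W" and Z: "0 < Z"
    and \<gamma>: "0 < \<gamma>" and \<gamma>_square: "\<gamma>\<^sup>2 = - W * \<beta> - \<alpha>\<^sup>2"
    and d_pos: "0 < \<gamma> * sinh (r * sqrt W * d) + \<alpha>"
    and d_eq: "sqrt W * R1 \<alpha> \<gamma> (r * sqrt W) d = Z / 2"
begin

text \<open>The profile is \<open>x \<mapsto> f \<bar>x\<bar>\<close>, and \<open>f\<close> solves \<open>f' = - f \<kappa>(f)\<close> for \<open>x \<ge> 0\<close>. The choice of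
  \<open>d\<close> amounts to \<open>\<kappa>(f 0) = Z / 2\<close>, the critical point equation of \<open>g\<close>.\<close>

definition \<kappa> :: "real \<Rightarrow> real" where
  "\<kappa> s = sqrt (W - 2 * \<alpha> * s powr r - \<beta> * s powr (2 * r))"

definition \<rho> :: "real \<Rightarrow> real" where "\<rho> s = s * \<kappa> s"

definition P :: "real \<Rightarrow> real" where "P s = integral {0..s} \<rho>"

definition y :: "real \<Rightarrow> real" where "y x = \<alpha> / W + \<gamma> / W * sinh (r * sqrt W * (x + d))"

definition f :: "real \<Rightarrow> real" where "f x = y x powr (- 1 / r)"

text \<open>The defocusing signs enter here. The bound gives positivity of \<open>\<kappa>\<close>
  and later the square integrability of the profile.\<close>

lemma \<kappa>_radicand: "W \<le> W - 2 * \<alpha> * s powr r - \<beta> * s powr (2 * r)"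
proof -
  have "\<alpha> * s powr r \<le> 0" "\<beta> * s powr (2 * r) \<le> 0"
    using \<alpha> \<beta> by (auto intro: mult_nonpos_nonneg)
  then show ?thesis by simp
qed

lemma \<kappa>_square: "(\<kappa> s)\<^sup>2 = W - 2 * \<alpha> * s powr r - \<beta> * s powr (2 * r)"
  unfolding \<kappa>_def using \<kappa>_radicand[of s] W by (intro real_sqrt_pow2) linarith

lemma \<kappa>_pos: "0 < \<kappa> s"
  unfolding \<kappa>_def using \<kappa>_radicand[of s] W by simp

text \<open>Strictness comes from \<open>\<beta> < 0\<close>, as \<open>\<alpha>\<close> may be 0.
  It makes \<open>f 0\<close> the only positive critical point of \<open>g\<close>.\<close>

lemma \<kappa>_strict_mono: "0 \<le> s \<Longrightarrow> s < t \<Longrightarrow> \<kappa> s < \<kappa> t"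
proof -
  assume st: "0 \<le> s" "s < t"
  have "s powr r \<le> t powr r" using st r by (intro powr_mono2) auto
  then have "\<alpha> * t powr r \<le> \<alpha> * s powr r" using \<alpha> by (rule mult_left_mono_neg)
  moreover have "\<beta> * t powr (2 * r) < \<beta> * s powr (2 * r)"
    using \<beta> st r by (intro mult_strict_left_mono_neg powr_less_mono2) auto
  ultimately show "\<kappa> s < \<kappa> t" by (simp add: \<kappa>_def)
qed

lemma \<rho>_square: "0 \<le> s \<Longrightarrow> (\<rho> s)\<^sup>2 = W * s\<^sup>2 - 2 * \<alpha> * s powr (r + 2) - \<beta> * s powr (2 * r + 2)"
  by (cases "s = 0") (simp_all add: \<rho>_def \<kappa>_square power_mult_distrib powr_add powr_numeral algebra_simps)

lemma \<rho>_cont: "continuous_on {0..} \<rho>"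
  unfolding \<rho>_def \<kappa>_def using r by (intro continuous_intros continuous_on_powr') auto

lemma P_0: "P 0 = 0"
  by (simp add: P_def)

lemma P_deriv_within:
  assumes "0 \<le> s" "s \<le> t" shows "(P has_real_derivative \<rho> s) (at s within {0..t})"
  unfolding P_def using assms
  by (intro integral_has_real_derivative) (auto intro: continuous_on_subset[OF \<rho>_cont])

lemma P_deriv: assumes "0 < s" shows "(P has_real_derivative \<rho> s) (at s)"
  using P_deriv_within[of s "s + 1"] assms by (simp add: at_within_Icc_at)

lemma P_cont: "continuous_on {0..} P"
proof -
  have "continuous (at s within {0..}) P" if "0 \<le> s" for s
  proof -
    have "continuous (at s within {0..s + 1}) P"
      using P_deriv_within[of s "s + 1"] that by (intro DERIV_continuous) auto
    moreover have "at s within {0..s + 1} = at s within {0..}"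
    proof (rule at_within_nhd[of s "{s - 1<..<s + 1}"])
      show "{0..s + 1} \<inter> {s - 1<..<s + 1} - {s} = {0..} \<inter> {s - 1<..<s + 1} - {s}" by auto
    qed auto
    ultimately show ?thesis by simp
  qed
  then show ?thesis by (simp add: continuous_on_eq_continuous_within)
qed

sublocale calibration P \<rho>
proof
  show "0 \<le> \<rho> s" if "0 \<le> s" for s using that less_imp_le[OF \<kappa>_pos] by (simp add: \<rho>_def)
qed (use P_cont P_deriv \<rho>_cont in auto)

text \<open>The action without its point term: the integral of the calibration density, and a
  strongly convex functional. Here \<open>delta_form 0\<close> is the Dirichlet form.\<close>

definition T :: "h1 \<Rightarrow> real" where
  "T v = (delta_form 0 v v + W * L2_inner (h1_fun v) (h1_fun v)
     - 2 * \<alpha> * power_integral r v - \<beta> * power_integral (2 * r) v) / 2"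

definition S :: "h1 \<Rightarrow> real" where "S v = T v - Z / 2 * (cmod (h1_fun v 0))\<^sup>2"

definition g :: "real \<Rightarrow> real" where "g s = 2 * P s - Z / 2 * s\<^sup>2"

lemma T_eq: "integrable lborel (density v)" "(LINT x|lborel. density v x) = T v"
proof -
  have eq: "density v x = ((cmod (h1_deriv v x))\<^sup>2 + W * (cmod (h1_fun v x))\<^sup>2
      - 2 * \<alpha> * cmod (h1_fun v x) powr (r + 2) - \<beta> * cmod (h1_fun v x) powr (2 * r + 2)) / 2" for x
    by (simp add: density_def \<rho>_square diff_divide_distrib add_divide_distrib)
  have int: "integrable lborel (\<lambda>x. (cmod (h1_deriv v x))\<^sup>2)" "integrable lborel (\<lambda>x. (cmod (h1_fun v x))\<^sup>2)"
    "integrable lborel (\<lambda>x. cmod (h1_fun v x) powr (r + 2))" "integrable lborel (\<lambda>x. cmod (h1_fun v x) powr (2 * r + 2))"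
    using r by (auto intro!: L2_square_integrable h1_deriv h1_fun_L2 power_integrable)
  show "integrable lborel (density v)" unfolding eq[abs_def] using int by auto
  show "(LINT x|lborel. density v x) = T v"
    unfolding eq T_def using int by (simp add: delta_form_def L2_inner_self power_integral_def)
qed

text \<open>The calibration bound at the origin, where the point term sits, reduces the minimization
  over H^1 to one real variable.\<close>

lemma S_lower: "g (cmod (h1_fun v 0)) \<le> S v"
  using lower_bound[OF T_eq(1), of v 0] T_eq(2)[of v] by (simp add: S_def g_def P_0)

text \<open>The quadratic part satisfies the parallelogram law, which produces the gain; the power
  terms are convex and enter with the nonnegative coefficients \<open>- \<alpha>\<close> and
  \<open>- \<beta>\<close>.\<close>

lemma T_midpoint:
  "2 * T ((1/2) *\<^sub>R (u + v)) \<le> T u + T v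
     - (delta_form 0 (u - v) (u - v) + W * L2_inner (h1_fun (u - v)) (h1_fun (u - v))) / 4"
proof -
  interpret B: bounded_bilinear "delta_form 0" by (rule bounded_bilinear_delta_form)
  interpret L: bounded_bilinear "\<lambda>u v. L2_inner (h1_fun u) (h1_fun v)" by (rule bounded_bilinear_L2_inner)
  let ?m = "(1/2) *\<^sub>R (u + v)"
  have power: "2 * power_integral q ?m \<le> power_integral q u + power_integral q v" if q: "0 < q" for q
  proof -
    have "2 * power_integral q ?m = (LINT x|lborel. 2 * cmod (h1_fun ?m x) powr (q + 2))"
      by (simp add: power_integral_def)
    also have "\<dots> \<le> (LINT x|lborel. cmod (h1_fun u x) powr (q + 2) + cmod (h1_fun v x) powr (q + 2))"
    proof (rule integral_mono)
      show "2 * cmod (h1_fun ?m x) powr (q + 2) \<le> cmod (h1_fun u x) powr (q + 2) + cmod (h1_fun v x) powr (q + 2)" for x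
        using power_term_midpoint[of q "h1_fun u x" "h1_fun v x"] q by simp
    qed (use power_integrable[OF q] in \<open>auto intro!: integrable_mult_right simp del: h1_fun_scaleR h1_fun_add\<close>)
    also have "\<dots> = power_integral q u + power_integral q v"
      using power_integrable[OF q] by (simp add: power_integral_def)
    finally show ?thesis .
  qed
  have "- \<alpha> * (2 * power_integral r ?m) \<le> - \<alpha> * (power_integral r u + power_integral r v)"
    using \<alpha> r by (intro mult_left_mono power) auto
  moreover have "- \<beta> * (2 * power_integral (2 * r) ?m) \<le> - \<beta> * (power_integral (2 * r) u + power_integral (2 * r) v)"
    using \<beta> r by (intro mult_left_mono power) auto
  moreover have B: "delta_form 0 ?m ?m = (delta_form 0 u u + delta_form 0 v v) / 2 - delta_form 0 (u - v) (u - v) / 4"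
    by (simp add: B.scaleR_left B.scaleR_right B.add_left B.add_right B.diff_left B.diff_right
        delta_form_commute[of 0 v u] field_simps)
  moreover have L: "L2_inner (h1_fun ?m) (h1_fun ?m) = (L2_inner (h1_fun u) (h1_fun u) + L2_inner (h1_fun v) (h1_fun v)) / 2
      - L2_inner (h1_fun (u - v)) (h1_fun (u - v)) / 4"
    by (simp add: L.scaleR_left L.scaleR_right L.add_left L.add_right L.diff_left L.diff_right
        L2_inner_commute[of "h1_fun v" "h1_fun u"] field_simps)
  ultimately show ?thesis unfolding T_def B L by (simp add: algebra_simps add_divide_distrib diff_divide_distrib)
qed

lemma T_rotate: "T (h1_cscale (cis \<theta>) v) = T v"
proof -
  have L: "L2_inner (h1_fun (h1_cscale (cis \<theta>) v)) (h1_fun (h1_cscale (cis \<theta>) v)) = L2_inner (h1_fun v) (h1_fun v)"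
    by (simp add: L2_inner_self norm_mult)
  have "inner (h1_cscale (cis \<theta>) v) (h1_cscale (cis \<theta>) v) = inner v v"
    by (simp add: norm_h1_cscale flip: power2_norm_eq_inner)
  then have "delta_form 0 (h1_cscale (cis \<theta>) v) (h1_cscale (cis \<theta>) v) = delta_form 0 v v"
    using L by (simp add: inner_h1_def delta_form_def)
  then show ?thesis using L by (simp add: T_def power_integral_def norm_mult)
qed

lemma S_eq: "S v = (delta_form Z v v + W * L2_inner (h1_fun v) (h1_fun v)
     - 2 * \<alpha> * power_integral r v - \<beta> * power_integral (2 * r) v) / 2"
  by (simp add: S_def T_def delta_form_def complex_mult_cnj cmod_power2 field_simps)

lemma isCont_S: "isCont S v"
proof -
  have L: "isCont (\<lambda>v. L2_inner (h1_fun v) (h1_fun v)) v"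
    unfolding isCont_def by (intro bounded_bilinear.tendsto[OF bounded_bilinear_L2_inner] tendsto_ident_at)
  have D: "isCont (\<lambda>v. delta_form 0 v v) v" "isCont (\<lambda>v. delta_form Z v v) v"
    unfolding isCont_def by (intro bounded_bilinear.tendsto[OF bounded_bilinear_delta_form] tendsto_ident_at)+
  have "S = (\<lambda>v. (delta_form Z v v + W * L2_inner (h1_fun v) (h1_fun v)
     - 2 * \<alpha> * power_integral r v - \<beta> * power_integral (2 * r) v) / 2)"
    by (simp add: S_eq fun_eq_iff)
  then show ?thesis
    using r by (simp only:) (intro continuous_intros L D isCont_power_integral; simp)
qed

section \<open>The first-order equation of the profile\<close>

lemma y_pos: assumes "0 \<le> x" shows "0 < y x"
proof -
  have "0 < r * sqrt W" using r W by simp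
  then have "r * sqrt W * d \<le> r * sqrt W * (x + d)" using assms by (intro mult_left_mono) auto
  then have "\<gamma> * sinh (r * sqrt W * d) \<le> \<gamma> * sinh (r * sqrt W * (x + d))" using \<gamma> by simp
  then have "0 < (\<alpha> + \<gamma> * sinh (r * sqrt W * (x + d))) / W" using d_pos W by simp
  then show ?thesis by (simp add: y_def add_divide_distrib)
qed

lemma f_pos: "0 \<le> x \<Longrightarrow> 0 < f x"
  using y_pos[of x] by (simp add: f_def)

lemma \<kappa>_f: assumes "0 \<le> x" shows "\<kappa> (f x) = \<gamma> * cosh (r * sqrt W * (x + d)) / (sqrt W * y x)"
proof (rule power2_eq_imp_eq)
  have pos: "0 < y x" by (rule y_pos[OF assms])
  define s where "s = sinh (r * sqrt W * (x + d))"
  have y: "W * y x = \<alpha> + \<gamma> * s" using W by (simp add: y_def s_def distrib_left)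
  have powers: "f x powr r = inverse (y x)" "f x powr (2 * r) = inverse ((y x)\<^sup>2)"
  proof -
    have "f x powr r = y x powr (- 1)" "f x powr (2 * r) = y x powr (- 2)"
      using r by (simp_all add: f_def powr_powr)
    then show "f x powr r = inverse (y x)" "f x powr (2 * r) = inverse ((y x)\<^sup>2)"
      using pos by (simp_all add: powr_minus powr_numeral)
  qed
  then have "(\<kappa> (f x))\<^sup>2 = (W * (y x)\<^sup>2 - 2 * \<alpha> * y x - \<beta>) / (y x)\<^sup>2"
    unfolding \<kappa>_square powers using pos by (simp add: field_simps power2_eq_square)
  \<comment> \<open>Completing the square, with W y - \<alpha> = \<gamma> s and - W \<beta> -
    \<alpha>^2 = \<gamma>^2.\<close>
  also have "W * (W * (y x)\<^sup>2 - 2 * \<alpha> * y x - \<beta>) = \<gamma>\<^sup>2 * (s\<^sup>2 + 1)"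
  proof -
    have "W * (W * (y x)\<^sup>2 - 2 * \<alpha> * y x - \<beta>) = (W * y x)\<^sup>2 - 2 * \<alpha> * (W * y x) - W * \<beta>"
      by (simp add: power2_eq_square algebra_simps)
    also have "\<dots> = (\<gamma> * s)\<^sup>2 + (- W * \<beta> - \<alpha>\<^sup>2)"
      unfolding y by (simp add: power2_eq_square algebra_simps)
    finally show ?thesis unfolding \<gamma>_square[symmetric] by (simp add: power_mult_distrib algebra_simps)
  qed
  then have "W * (y x)\<^sup>2 - 2 * \<alpha> * y x - \<beta> = \<gamma>\<^sup>2 * (s\<^sup>2 + 1) / W" using W by (simp add: field_simps)
  also have "s\<^sup>2 + 1 = (cosh (r * sqrt W * (x + d)))\<^sup>2" by (simp add: s_def cosh_square_eq)
  finally show "(\<kappa> (f x))\<^sup>2 = (\<gamma> * cosh (r * sqrt W * (x + d)) / (sqrt W * y x))\<^sup>2"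
    using W by (simp add: power_mult_distrib power_divide)
  show "0 \<le> \<gamma> * cosh (r * sqrt W * (x + d)) / (sqrt W * y x)" using \<gamma> W pos by simp
qed (use \<kappa>_pos less_imp_le in auto)

lemma f_deriv: assumes "0 \<le> x" shows "(f has_real_derivative - \<rho> (f x)) (at x)"
proof -
  have pos: "0 < y x" by (rule y_pos[OF assms])
  have yd: "(y has_real_derivative \<gamma> / W * (cosh (r * sqrt W * (x + d)) * (r * sqrt W))) (at x)"
    unfolding y_def using W by (auto intro!: derivative_eq_intros)
  have "(f has_real_derivative (- 1 / r) * y x powr (- 1 / r - 1) * (\<gamma> / W * (cosh (r * sqrt W * (x + d)) * (r * sqrt W)))) (at x)"
    unfolding f_def by (rule DERIV_fun_powr[OF yd pos, simplified of_nat_1])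
  moreover have "(- 1 / r) * y x powr (- 1 / r - 1) * (\<gamma> / W * (cosh (r * sqrt W * (x + d)) * (r * sqrt W))) = - \<rho> (f x)"
  proof -
    have "y x powr (- 1 / r - 1) = f x / y x" using pos by (simp add: f_def powr_diff)
    moreover have "sqrt W / W = 1 / sqrt W" using W by (simp add: frac_eq_eq)
    ultimately show ?thesis using r pos W by (simp add: \<rho>_def \<kappa>_f[OF assms] field_simps)
  qed
  ultimately show ?thesis by simp
qed

text \<open>This is the jump condition in the domain of the operator: the even extension has slopes
  of size f(0) \<kappa>(f(0)) on both sides of 0, with opposite signs.\<close>

lemma \<kappa>_f_0: "\<kappa> (f 0) = Z / 2"
proof -
  have "y 0 = (\<gamma> * sinh (r * sqrt W * d) + \<alpha>) / W" by (simp add: y_def add_divide_distrib)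
  then have "\<kappa> (f 0) = \<gamma> * cosh (r * sqrt W * d) * W / (sqrt W * (\<gamma> * sinh (r * sqrt W * d) + \<alpha>))"
    using \<kappa>_f[of 0] by simp
  also have "\<dots> = sqrt W * R1 \<alpha> \<gamma> (r * sqrt W) d"
    using real_div_sqrt[of W] W by (simp add: R1_def mult.commute flip: times_divide_times_eq)
  finally show ?thesis using d_eq by simp
qed

lemma f_tendsto: "(f \<longlongrightarrow> 0) at_top"
proof -
  have "filterlim y at_top at_top"
  proof -
    have "filterlim (\<lambda>x. r * sqrt W * (x + d)) at_top at_top"
      using r W by (intro filterlim_tendsto_pos_mult_at_top[OF tendsto_const])
        (auto intro: filterlim_tendsto_add_at_top[OF tendsto_const, of _ _ d] filterlim_ident simp: add.commute[of _ d])
    then show ?thesis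
      unfolding y_def using \<gamma> W
      by (intro filterlim_tendsto_add_at_top[OF tendsto_const]
          filterlim_tendsto_pos_mult_at_top[OF tendsto_const _ filterlim_compose[OF sinh_real_at_top]]) simp_all
  qed
  then show ?thesis unfolding f_def using r by (intro tendsto_neg_powr) auto
qed

section \<open>The reduced function of the value at the origin\<close>

lemma g_deriv: assumes "0 < s" shows "(g has_real_derivative s * (2 * \<kappa> s - Z)) (at s)"
  unfolding g_def using assms
  by (auto intro!: derivative_eq_intros P_deriv simp: \<rho>_def algebra_simps)

lemma g_cont: "continuous_on {0..} g"
  unfolding g_def by (intro continuous_intros P_cont)

lemma g_decreasing: assumes "0 \<le> s" "s < t" "t \<le> f 0" shows "g t < g s"
proof (rule DERIV_neg_imp_decreasing_open[OF assms(2)])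
  fix x assume x: "s < x" "x < t"
  then have "\<kappa> x < Z / 2" using \<kappa>_strict_mono[of x "f 0"] assms by (simp add: \<kappa>_f_0)
  then show "\<exists>D. (g has_real_derivative D) (at x) \<and> D < 0"
    using g_deriv[of x] x assms by (intro exI conjI) (auto simp: mult_less_0_iff)
qed (use assms in \<open>auto intro: continuous_on_subset[OF g_cont]\<close>)

lemma g_increasing: assumes "f 0 \<le> s" "s < t" shows "g s < g t"
proof (rule DERIV_pos_imp_increasing_open[OF assms(2)])
  have f0: "0 < f 0" by (simp add: f_pos)
  fix x assume x: "s < x" "x < t"
  then have "Z / 2 < \<kappa> x" using \<kappa>_strict_mono[of "f 0" x] assms f0 by (simp add: \<kappa>_f_0)
  then show "\<exists>D. (g has_real_derivative D) (at x) \<and> 0 < D"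
    using g_deriv[of x] x assms f0 by (intro exI[of _ "x * (2 * \<kappa> x - Z)"] conjI) auto
qed (use assms f_pos[of 0] in \<open>auto intro: continuous_on_subset[OF g_cont]\<close>)

lemma g_min: "0 \<le> s \<Longrightarrow> g (f 0) \<le> g s"
  using g_decreasing[of s "f 0"] g_increasing[of "f 0" s] by (cases s "f 0" rule: linorder_cases) auto

lemma g_min_stable:
  assumes "0 < \<epsilon>"
  shows "\<exists>\<delta>>0. \<forall>s\<ge>0. g s < g (f 0) + \<delta> \<longrightarrow> \<bar>s - f 0\<bar> < \<epsilon>"
proof -
  have f0: "0 < f 0" by (simp add: f_pos)
  \<comment> \<open>Capped by \<open>f 0\<close> so that the left endpoint \<open>f 0 - e\<close> is
    nonnegative.\<close>
  define e where "e = min \<epsilon> (f 0)"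
  define \<delta> where "\<delta> = min (g (f 0 - e)) (g (f 0 + e)) - g (f 0)"
  have e: "0 < e" "e \<le> f 0" "e \<le> \<epsilon>" using assms f0 by (auto simp: e_def)
  have "0 < \<delta>" using g_decreasing[of "f 0 - e" "f 0"] g_increasing[of "f 0" "f 0 + e"] e by (simp add: \<delta>_def)
  moreover have "\<bar>s - f 0\<bar> < \<epsilon>" if s: "0 \<le> s" "g s < g (f 0) + \<delta>" for s
  proof (rule ccontr)
    assume "\<not> \<bar>s - f 0\<bar> < \<epsilon>"
    then consider "s \<le> f 0 - e" | "f 0 + e \<le> s" using e by linarith
    then show False
    proof cases
      case 1
      then have "g (f 0 - e) \<le> g s" using g_decreasing[of s "f 0 - e"] s e by (cases "s = f 0 - e") auto
      then show False using s by (simp add: \<delta>_def)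
    next
      case 2
      then have "g (f 0 + e) \<le> g s" using g_increasing[of "f 0 + e" s] e by (cases "s = f 0 + e") auto
      then show False using s by (simp add: \<delta>_def)
    qed
  qed
  ultimately show ?thesis by blast
qed

section \<open>The profile as an element of H^1 and its action\<close>

lemma f_cont: "continuous_on {0..} f"
  using f_deriv by (meson DERIV_isCont atLeast_iff continuous_at_imp_continuous_on)

text \<open>By f' = - \<rho>(f), the integrand is minus the derivative of P(f) on the right
  half-line, and P(f) tends to 0 at infinity.\<close>

lemma \<rho>_f_integral: "has_bochner_integral lborel (\<lambda>x. (\<rho> (f \<bar>x\<bar>))\<^sup>2) (2 * P (f 0))"
proof -
  have "has_bochner_integral lborel (\<lambda>x. (\<rho> (f \<bar>x\<bar>))\<^sup>2) (2 * (- 0 - - P (f 0)))"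
  proof (rule has_bochner_integral_even_extension)
    show "(\<lambda>x. (\<rho> (f x))\<^sup>2) \<in> borel_measurable borel"
      unfolding \<rho>_def \<kappa>_def f_def y_def sinh_field_def by measurable
    show "((\<lambda>x. - P (f x)) has_real_derivative (\<rho> (f x))\<^sup>2) (at x)" if "0 \<le> x" for x
    proof -
      have "((\<lambda>x. P (f x)) has_real_derivative \<rho> (f x) * - \<rho> (f x)) (at x)"
        using that by (intro DERIV_chain2[OF P_deriv f_deriv] f_pos)
      from DERIV_minus[OF this] show ?thesis by (simp add: power2_eq_square)
    qed
    have "((\<lambda>x. P (f x)) \<longlongrightarrow> P 0) at_top"
    proof (rule continuous_on_tendsto_compose[OF P_cont f_tendsto])
      show "\<forall>\<^sub>F x in at_top. f x \<in> {0..}"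
        using eventually_ge_at_top[of 0] by eventually_elim (simp add: f_pos less_imp_le)
    qed simp
    then show "((\<lambda>x. - P (f x)) \<longlongrightarrow> - 0) at_top" unfolding P_0 by (rule tendsto_minus)
  qed auto
  then show ?thesis by simp
qed

lemma f_even_cont: "continuous_on UNIV (\<lambda>x. f \<bar>x\<bar>)"
  by (intro continuous_on_compose2[OF f_cont] continuous_intros) auto

text \<open>As \<kappa>^2 \<ge> W, the square of the profile is dominated by \<rho>(f)^2 / W, whose
  integral is known.\<close>

lemma f_even_L2:
  "(\<lambda>x. complex_of_real (f \<bar>x\<bar>)) \<in> L2" "(\<lambda>x. complex_of_real (sgn x * - \<rho> (f \<bar>x\<bar>))) \<in> L2"
proof -
  have [measurable]: "(\<lambda>x. f \<bar>x\<bar>) \<in> borel_measurable borel"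
    using f_even_cont by (rule borel_measurable_continuous_onI)
  have [measurable]: "\<rho> \<in> borel_measurable borel" unfolding \<rho>_def \<kappa>_def by measurable
  have int: "integrable lborel (\<lambda>x. (\<rho> (f \<bar>x\<bar>))\<^sup>2)"
    using \<rho>_f_integral by (simp only: has_bochner_integral_iff)
  have "integrable lborel (\<lambda>x. (\<rho> (f \<bar>x\<bar>))\<^sup>2 / W)" using int by simp
  then have "integrable lborel (\<lambda>x. (cmod (complex_of_real (f \<bar>x\<bar>)))\<^sup>2)"
  proof (rule Bochner_Integration.integrable_bound, measurable, intro always_eventually allI)
    fix x
    have "W * (f \<bar>x\<bar>)\<^sup>2 \<le> (\<kappa> (f \<bar>x\<bar>))\<^sup>2 * (f \<bar>x\<bar>)\<^sup>2"
      using \<kappa>_radicand by (intro mult_right_mono) (auto simp: \<kappa>_square)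
    also have "\<dots> = (\<rho> (f \<bar>x\<bar>))\<^sup>2" by (simp add: \<rho>_def power_mult_distrib)
    finally show "norm ((cmod (complex_of_real (f \<bar>x\<bar>)))\<^sup>2) \<le> norm ((\<rho> (f \<bar>x\<bar>))\<^sup>2 / W)"
      using W by (simp add: field_simps)
  qed
  moreover have "(\<lambda>x. complex_of_real (f \<bar>x\<bar>)) \<in> borel_measurable borel" by measurable
  ultimately show "(\<lambda>x. complex_of_real (f \<bar>x\<bar>)) \<in> L2" by (simp add: L2_def)
  have "integrable lborel (\<lambda>x. (cmod (complex_of_real (sgn x * - \<rho> (f \<bar>x\<bar>))))\<^sup>2)"
    by (rule Bochner_Integration.integrable_bound[OF int]) (auto simp: abs_mult sgn_if)
  moreover have "(\<lambda>x. complex_of_real (sgn x * - \<rho> (f \<bar>x\<bar>))) \<in> borel_measurable borel" by measurable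
  ultimately show "(\<lambda>x. complex_of_real (sgn x * - \<rho> (f \<bar>x\<bar>))) \<in> L2" by (simp add: L2_def)
qed

lemma f_even_weak_deriv:
  "weak_deriv (\<lambda>x. of_real (f \<bar>x\<bar>)) (\<lambda>x. of_real (sgn x * - \<rho> (f \<bar>x\<bar>)))"
proof (rule even_extension_weak_deriv)
  show "continuous_on {0..} (\<lambda>x. - \<rho> (f x))"
    by (intro continuous_on_minus continuous_on_compose2[OF \<rho>_cont f_cont]) (auto intro: less_imp_le f_pos)
qed (use f_deriv f_even_L2 in auto)

definition \<Phi> :: h1 where "\<Phi> = Abs_h1 (\<lambda>x. of_real (f \<bar>x\<bar>))"

lemma h1_fun_\<Phi>: "h1_fun \<Phi> = (\<lambda>x. of_real (f \<bar>x\<bar>))"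
  unfolding \<Phi>_def
proof (rule Abs_h1_inverse)
  show "(\<lambda>x. complex_of_real (f \<bar>x\<bar>)) \<in> H1"
    unfolding H1_def using f_even_L2 f_even_weak_deriv f_even_cont by (auto intro!: continuous_intros)
qed

text \<open>The equality case of the calibration: |\<Phi>'| = \<rho>(\<Phi>) almost everywhere, so
  the density is \<rho>(f)^2.\<close>

lemma S_\<Phi>: "S \<Phi> = g (f 0)"
proof -
  have "AE x in lborel. h1_deriv \<Phi> x = of_real (sgn x * - \<rho> (f \<bar>x\<bar>))"
    using f_even_L2 f_even_weak_deriv by (intro h1_deriv_AE) (simp_all add: h1_fun_\<Phi>)
  then have "AE x in lborel. density \<Phi> x = (\<rho> (f \<bar>x\<bar>))\<^sup>2"
    using AE_lborel_singleton[of 0]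
  proof eventually_elim
    case (elim x)
    have "cmod (h1_fun \<Phi> x) = f \<bar>x\<bar>" using f_pos[of "\<bar>x\<bar>"] by (simp add: h1_fun_\<Phi>)
    moreover have "cmod (h1_deriv \<Phi> x) = \<bar>\<rho> (f \<bar>x\<bar>)\<bar>" using elim by (simp add: abs_mult sgn_if norm_mult)
    ultimately show ?case by (simp add: density_def)
  qed
  then have "T \<Phi> = (LINT x|lborel. (\<rho> (f \<bar>x\<bar>))\<^sup>2)"
    unfolding T_eq(2)[symmetric] using T_eq(1)[of \<Phi>] \<rho>_f_integral
    by (intro integral_cong_AE) (auto simp only: has_bochner_integral_iff intro: borel_measurable_integrable)
  also have "\<dots> = 2 * P (f 0)" using \<rho>_f_integral by (simp only: has_bochner_integral_iff)
  finally show ?thesis by (simp add: S_def g_def h1_fun_\<Phi>)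
qed

section \<open>Stability of the orbit of the minimizer\<close>

lemma \<Phi>_minimizes: "S \<Phi> \<le> S v"
  using g_min[of "cmod (h1_fun v 0)"] S_lower[of v] by (simp add: S_\<Phi>)

text \<open>Since the midpoint of \<open>u\<close> and the rotated profile cannot have smaller action than the profile,
  the strong convexity of \<open>T\<close> leaves only the values at the origin to be controlled.\<close>

lemma action_controls_distance:
  obtains \<theta> where "min 1 W * (norm (u - h1_cscale (cis \<theta>) \<Phi>))\<^sup>2
    \<le> 4 * (S u - S \<Phi>) + Z * (cmod (h1_fun u 0) - f 0)\<^sup>2"
proof
  \<comment> \<open>With the phase of u(0), the values of \<open>u\<close> and \<open>v\<close> at
    the origin lie on one ray, so the modulus of the midpoint there is the mean of the
    moduli.\<close>
  define \<theta> where "\<theta> = Arg (h1_fun u 0)"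
  define v where "v = h1_cscale (cis \<theta>) \<Phi>"
  define w where "w = u - v"
  define s where "s = cmod (h1_fun u 0)"
  let ?m = "(1/2) *\<^sub>R (u + v)"
  define D where "D = delta_form 0 w w"
  define L where "L = L2_inner (h1_fun w) (h1_fun w)"
  have f0: "0 < f 0" by (simp add: f_pos)
  have u0: "h1_fun u 0 = of_real s * cis \<theta>"
    using rcis_cmod_Arg[of "h1_fun u 0"] by (simp add: rcis_def s_def \<theta>_def)
  have v0: "h1_fun v 0 = of_real (f 0) * cis \<theta>" by (simp add: v_def h1_fun_\<Phi> mult.commute)
  have "h1_fun ?m 0 = of_real ((s + f 0) / 2) * cis \<theta>" by (simp add: u0 v0 field_simps)
  then have m0: "cmod (h1_fun ?m 0) = (s + f 0) / 2"
    using f0 by (simp only: norm_mult norm_of_real norm_cis) (simp add: s_def)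
  have "cmod (h1_fun v 0) = f 0" using f0 by (simp add: v0 norm_mult)
  then have Sv: "S v = S \<Phi>" using f0 by (simp add: S_def v_def T_rotate h1_fun_\<Phi>)
  have "2 * S ?m + Z * ((s + f 0) / 2)\<^sup>2 \<le> S u + S v + Z / 2 * s\<^sup>2 + Z / 2 * (f 0)\<^sup>2 - (D + W * L) / 4"
    using T_midpoint[of u v] unfolding S_def m0 \<open>cmod (h1_fun v 0) = f 0\<close> s_def[symmetric]
    by (simp add: D_def L_def w_def)
  then have "(D + W * L) / 4 \<le> S u - S \<Phi> + (Z / 2 * s\<^sup>2 + Z / 2 * (f 0)\<^sup>2 - Z * ((s + f 0) / 2)\<^sup>2)"
    using \<Phi>_minimizes[of ?m] Sv by linarith
  \<comment> \<open>The midpoint defect of the concave point term, the only loss against the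
    convexity of \<open>T\<close>.\<close>
  also have "Z / 2 * s\<^sup>2 + Z / 2 * (f 0)\<^sup>2 - Z * ((s + f 0) / 2)\<^sup>2 = Z / 4 * (s - f 0)\<^sup>2"
    by (simp add: power2_eq_square field_simps)
  finally have 1: "D + W * L \<le> 4 * (S u - S \<Phi>) + Z * (s - f 0)\<^sup>2" by (simp add: field_simps)
  have DL: "0 \<le> D" "0 \<le> L" "(norm w)\<^sup>2 = L + D"
    by (simp_all add: D_def L_def delta_form_def L2_inner_self_nonneg power2_norm_eq_inner inner_h1_def)
  have "min 1 W * D \<le> 1 * D" "min 1 W * L \<le> W * L" using DL by (intro mult_right_mono; simp)+
  then have "min 1 W * (norm w)\<^sup>2 \<le> D + W * L" by (simp add: DL distrib_left)
  with 1 show "min 1 W * (norm (u - h1_cscale (cis \<theta>) \<Phi>))\<^sup>2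
    \<le> 4 * (S u - S \<Phi>) + Z * (cmod (h1_fun u 0) - f 0)\<^sup>2"
    by (simp add: w_def v_def s_def)
qed

lemma small_action_near_orbit:
  assumes "0 < \<epsilon>"
  shows "\<exists>\<delta>>0. \<forall>u. S u < S \<Phi> + \<delta> \<longrightarrow> (\<exists>\<theta>. norm (u - h1_cscale (cis \<theta>) \<Phi>) < \<epsilon>)"
proof -
  define w where "w = min 1 W"
  have w: "0 < w" using W by (simp add: w_def)
  define c where "c = w * \<epsilon>\<^sup>2"
  have c: "0 < c" using assms w by (simp add: c_def)
  \<comment> \<open>The target \<open>c\<close> is split into halves: one for the values at the
    origin, the other for four times the action excess, which is kept below
    \<open>c / 8\<close>.\<close>
  define e where "e = sqrt (c / (2 * Z))"
  have e: "0 < e" "Z * e\<^sup>2 = c / 2" using c Z by (simp_all add: e_def)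
  obtain \<delta> where \<delta>: "0 < \<delta>" "\<forall>s\<ge>0. g s < g (f 0) + \<delta> \<longrightarrow> \<bar>s - f 0\<bar> < e"
    using g_min_stable[OF e(1)] by blast
  define \<delta>' where "\<delta>' = min \<delta> (c / 8)"
  have \<delta>': "0 < \<delta>'" "\<delta>' \<le> \<delta>" "\<delta>' \<le> c / 8" using \<delta>(1) c by (simp_all add: \<delta>'_def)
  have "\<exists>\<theta>. norm (u - h1_cscale (cis \<theta>) \<Phi>) < \<epsilon>" if u: "S u < S \<Phi> + \<delta>'" for u
  proof -
    obtain \<theta> where \<theta>: "w * (norm (u - h1_cscale (cis \<theta>) \<Phi>))\<^sup>2
        \<le> 4 * (S u - S \<Phi>) + Z * (cmod (h1_fun u 0) - f 0)\<^sup>2"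
      unfolding w_def by (rule action_controls_distance)
    have "g (cmod (h1_fun u 0)) < g (f 0) + \<delta>"
      using S_lower[of u] u \<delta>'(2) S_\<Phi> by linarith
    then have "\<bar>cmod (h1_fun u 0) - f 0\<bar> < e"
      using \<delta>(2)[rule_format, of "cmod (h1_fun u 0)"] norm_ge_zero[of "h1_fun u 0"] by (simp only:)
    then have "(cmod (h1_fun u 0) - f 0)\<^sup>2 < e\<^sup>2"
      using power_strict_mono[of "\<bar>cmod (h1_fun u 0) - f 0\<bar>" e 2] by (simp only: power2_abs)
    then have *: "Z * (cmod (h1_fun u 0) - f 0)\<^sup>2 < c / 2"
      unfolding e(2)[symmetric] using Z by (rule mult_strict_left_mono)
    have "S u - S \<Phi> < c / 8" using u \<delta>'(3) by linarith
    then have "4 * (S u - S \<Phi>) < 4 * (c / 8)" by (rule mult_strict_left_mono) simp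
    from order_le_less_trans[OF \<theta> add_strict_mono[OF this *]]
    have "w * (norm (u - h1_cscale (cis \<theta>) \<Phi>))\<^sup>2 < w * \<epsilon>\<^sup>2"
      by (simp add: c_def)
    then have "(norm (u - h1_cscale (cis \<theta>) \<Phi>))\<^sup>2 < \<epsilon>\<^sup>2" using w by (simp only: mult_less_cancel_left_pos)
    then have "norm (u - h1_cscale (cis \<theta>) \<Phi>) < \<epsilon>" using assms by (simp add: power2_less_imp_less)
    then show ?thesis by (rule exI)
  qed
  then show ?thesis using \<delta>'(1) by blast
qed

lemma S_conserved:
  assumes "nls_solution (r + 1) (\<alpha> * (r + 2)) (\<beta> * (r + 1)) Z u"
  shows "S (u t) = S (u 0)"
proof -
  obtain u_t where "nls_trajectory (r + 1) (\<alpha> * (r + 2)) (\<beta> * (r + 1)) Z u u_t"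
    using assms r unfolding nls_solution_def nls_trajectory_def by auto
  then interpret N: nls_trajectory "r + 1" "\<alpha> * (r + 2)" "\<beta> * (r + 1)" Z u u_t .
  \<comment> \<open>With these coupling constants the coefficients of \<open>energy\<close> become
    those in \<open>S_eq\<close>, so \<open>S\<close> is half of \<open>energy\<close> plus
    \<open>W\<close> times \<open>mass\<close>.\<close>
  have "\<alpha> * (r + 2) * (2 / (r + 1 + 1)) = 2 * \<alpha>" "\<beta> * (r + 1) * (1 / (r + 1)) = \<beta>"
    using r by (simp_all add: field_simps)
  then have "N.energy v = delta_form Z v v - 2 * \<alpha> * power_integral r v - \<beta> * power_integral (2 * r) v" for v
    by (simp add: N.energy_def)
  then have "S v = (N.energy v + W * N.mass v) / 2" for v
    by (simp add: S_eq N.mass_def)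
  then show ?thesis by (simp only: N.energy_conserved[of t] N.mass_conserved[of t])
qed

text \<open>Lyapunov's argument: \<open>S\<close> is continuous at the profile and constant along
  solutions, and a small excess of \<open>S\<close> forces closeness to the orbit.\<close>

lemma orbitally_stable:
  "orbitally_stable (r + 1) (\<alpha> * (r + 2)) (\<beta> * (r + 1)) Z (\<lambda>x. of_real (f \<bar>x\<bar>))"
  unfolding orbitally_stable_def
proof (intro exI[of _ \<Phi>] conjI allI impI h1_fun_\<Phi>)
  fix \<epsilon> :: real assume "0 < \<epsilon>"
  obtain \<delta> where \<delta>: "0 < \<delta>" "\<And>u. S u < S \<Phi> + \<delta> \<Longrightarrow> \<exists>\<theta>. norm (u - h1_cscale (cis \<theta>) \<Phi>) < \<epsilon>"
    using small_action_near_orbit[OF \<open>0 < \<epsilon>\<close>] by blast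
  obtain \<eta> where \<eta>: "0 < \<eta>" "\<And>v. norm (v - \<Phi>) < \<eta> \<Longrightarrow> \<bar>S v - S \<Phi>\<bar> < \<delta>"
    using isCont_S[of \<Phi>, unfolded continuous_at_eps_delta dist_norm real_norm_def] \<delta>(1) by blast
  have "(INF \<theta>. norm (u t - h1_cscale (cis \<theta>) \<Phi>)) < \<epsilon>"
    if "nls_solution (r + 1) (\<alpha> * (r + 2)) (\<beta> * (r + 1)) Z u" "norm (u 0 - \<Phi>) < \<eta>" for u t
  proof -
    have "S (u t) < S \<Phi> + \<delta>" using S_conserved[OF that(1), of t] \<eta>(2)[OF that(2)] by simp
    then obtain \<theta> where \<theta>: "norm (u t - h1_cscale (cis \<theta>) \<Phi>) < \<epsilon>" using \<delta>(2) by blast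
    have "(INF \<theta>. norm (u t - h1_cscale (cis \<theta>) \<Phi>)) \<le> norm (u t - h1_cscale (cis \<theta>) \<Phi>)"
      by (intro cINF_lower bdd_belowI[of _ 0]) auto
    with \<theta> show ?thesis by simp
  qed
  then show "\<exists>\<eta>>0. \<forall>u0. norm (u0 - \<Phi>) < \<eta> \<longrightarrow>
      (\<forall>u. nls_solution (r + 1) (\<alpha> * (r + 2)) (\<beta> * (r + 1)) Z u \<and> u 0 = u0 \<longrightarrow>
        (\<forall>t. (INF \<theta>. norm (u t - h1_cscale (cis \<theta>) \<Phi>)) < \<epsilon>))"
    using \<eta>(1) by blast
qed

end

section \<open>Passage from the parameters of the equation to those of the profile\<close>

theorem theorem1p2:
  fixes p lam1 lam2 Z \<omega> :: real
  assumes "1 < p" and "lam1 \<le> 0" and "lam2 < 0" and "Z > 0"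
    and "- (p * lam1\<^sup>2 / ((p + 1)\<^sup>2 * lam2)) < Z\<^sup>2 / 4"
    and "\<omega> < 0"
    and "- (p * lam1\<^sup>2 / ((p + 1)\<^sup>2 * lam2)) < - \<omega>" and "- \<omega> < Z\<^sup>2 / 4"
  shows "orbitally_stable p lam1 lam2 Z (profile p lam1 lam2 Z \<omega>)"
proof -
  define \<alpha> \<beta> where "\<alpha> = lam1 / (p + 1)" and "\<beta> = lam2 / p"
  define \<gamma> where "\<gamma> = sqrt (\<omega> * \<beta> - \<alpha>\<^sup>2)"
  define k where "k = (p - 1) * sqrt (- \<omega>)"
  define q where "q = Z / (2 * sqrt (- \<omega>))"
  define d where "d = inv_into {- (1 / k * arsinh (\<alpha> / \<gamma>))<..} (R1 \<alpha> \<gamma> k) q"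
  have \<beta>: "\<beta> < 0" using assms by (simp add: \<beta>_def divide_neg_pos)
  have "p * lam1\<^sup>2 / ((p + 1)\<^sup>2 * lam2) = \<alpha>\<^sup>2 / \<beta>"
    using assms by (simp add: \<alpha>_def \<beta>_def power_divide field_simps)
  \<comment> \<open>Multiplying by the negative \<open>\<beta>\<close> turns the lower bound on -
    \<omega> into positivity of the radicand of \<open>\<gamma>\<close>.\<close>
  then have "\<omega> < \<alpha>\<^sup>2 / \<beta>" using assms(7) by simp
  then have disc: "0 < \<omega> * \<beta> - \<alpha>\<^sup>2" using \<beta> by (simp add: neg_less_divide_eq)
  then have \<gamma>: "0 < \<gamma>" by (simp add: \<gamma>_def)
  have k: "0 < k" using assms by (simp add: k_def)
  \<comment> \<open>The upper bound on - \<omega> places \<open>q\<close> above 1, hence in the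
    range of \<open>R1\<close>, so that \<open>inv_into\<close> returns a genuine preimage.\<close>
  have "sqrt (- \<omega>) < sqrt ((Z / 2)\<^sup>2)" using assms(8) by (simp add: power_divide)
  then have "sqrt (- \<omega>) < Z / 2" using assms(4) by simp
  then have q: "1 < q" using assms by (simp add: q_def field_simps)
  have mem: "q \<in> R1 \<alpha> \<gamma> k ` {- (1 / k * arsinh (\<alpha> / \<gamma>))<..}"
    by (rule R1_surj[OF \<gamma> k q])
  have d: "- (1 / k * arsinh (\<alpha> / \<gamma>)) < d" "R1 \<alpha> \<gamma> k d = q"
    using inv_into_into[OF mem] f_inv_into_f[OF mem] by (simp_all add: d_def)
  \<comment> \<open>Lying to the right of the left endpoint means that the denominator of
    \<open>R1\<close> is positive; this keeps the base of the power in the profile positive.\<close>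
  have "- arsinh (\<alpha> / \<gamma>) < k * d" using d(1) k by (simp add: field_simps)
  then have "sinh (- arsinh (\<alpha> / \<gamma>)) < sinh (k * d)" by (simp only: sinh_real_less_iff)
  then have d_pos: "0 < \<gamma> * sinh (k * d) + \<alpha>" using \<gamma> by (simp add: field_simps)
  interpret standing_wave "p - 1" \<alpha> \<beta> \<gamma> "- \<omega>" Z d
  proof
    show "\<alpha> \<le> 0" using assms by (simp add: \<alpha>_def divide_nonpos_pos)
    show "\<gamma>\<^sup>2 = - (- \<omega>) * \<beta> - \<alpha>\<^sup>2" using disc by (simp add: \<gamma>_def)
    show "0 < \<gamma> * sinh ((p - 1) * sqrt (- \<omega>) * d) + \<alpha>" using d_pos by (simp only: k_def)
    show "sqrt (- \<omega>) * R1 \<alpha> \<gamma> ((p - 1) * sqrt (- \<omega>)) d = Z / 2"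
      using d(2) assms by (simp add: k_def[symmetric] q_def)
  qed (use assms \<beta> \<gamma> in auto)
  have "profile p lam1 lam2 Z \<omega> = (\<lambda>x. of_real (f \<bar>x\<bar>))"
    unfolding profile_def Let_def f_def y_def
    unfolding \<alpha>_def[symmetric] \<beta>_def[symmetric] \<gamma>_def[symmetric] k_def[symmetric] q_def[symmetric] d_def[symmetric]
    by (rule refl)
  moreover have "p - 1 + 1 = p" "p - 1 + 2 = p + 1" by simp_all
  moreover have "\<alpha> * (p + 1) = lam1" "\<beta> * p = lam2"
    using assms(1) by (simp_all add: \<alpha>_def \<beta>_def)
  ultimately show ?thesis using orbitally_stable by (simp only:)
qed

end
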